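(* Let $N\ge 2$ be an integer, let $p$ be a real number with $1<p<N$, let $\gamma\ge 0$, and let $q$ satisfy $$p-1<q<\frac{(N+\gamma)(p-1)+p+\gamma}{N-p}.$$ Suppose that $u\in W^{1,p}_{\rm loc}(\mathbb{R}^N)$ is nonnegative and is a weak solution of $$-\operatorname{div}\left(|\nabla u|^{p-2}\nabla u\right)=|x|^\gamma u^q\quad\text{in }\mathbb{R}^N.$$ If $u$ is radial, then $u\equiv 0$.
   Context: A function $u\in W^{1,p}_{\rm loc}(\mathbb{R}^N)$ is a weak solution of $-\operatorname{div}(|\nabla u|^{p-2}\nabla u)=f$ in $\mathbb{R}^N$ if $$\int_{\mathbb{R}^N}|\nabla u|^{p-2}\nabla u\cdot\nabla\varphi\,dx=\int_{\mathbb{R}^N}f\varphi\,dx$$ for all $\varphi\in C_c^\infty(\mathbb{R}^N)$. Radial means that $u(x)$ depends only on $|x|$. *)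

theory Defs
  imports "HOL-Analysis.Analysis"
begin

text \<open>
  Elements of \<open>W\<^sup>1\<^sup>,\<^sup>p\<^sub>loc\<close> are represented by arbitrary Lebesgue measurable functions,
  and pointwise properties of them are understood up to Lebesgue null sets.
\<close>

primrec C_k :: "nat \<Rightarrow> ('a::euclidean_space \<Rightarrow> real) \<Rightarrow> bool" where
  "C_k 0 f \<longleftrightarrow> continuous_on UNIV f"
| "C_k (Suc k) f \<longleftrightarrow> (\<forall>x. f differentiable (at x)) \<and>
     (\<forall>b\<in>Basis. C_k k (\<lambda>x. frechet_derivative f (at x) b))"

definition test_function :: "('a::euclidean_space \<Rightarrow> real) \<Rightarrow> bool" where
  "test_function \<phi> \<longleftrightarrow> (\<forall>k. C_k k \<phi>) \<and> compact (closure {x. \<phi> x \<noteq> 0})"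

definition grad :: "('a::euclidean_space \<Rightarrow> real) \<Rightarrow> 'a \<Rightarrow> 'a" where
  "grad \<phi> x = (\<Sum>b\<in>Basis. frechet_derivative \<phi> (at x) b *\<^sub>R b)"

definition locally_integrable ::
  "('a::euclidean_space \<Rightarrow> 'b::euclidean_space) \<Rightarrow> bool" where
  "locally_integrable f \<longleftrightarrow> f \<in> borel_measurable lebesgue \<and>
     (\<forall>K. compact K \<longrightarrow> set_integrable lebesgue K f)"

definition locally_Lp ::
  "real \<Rightarrow> ('a::euclidean_space \<Rightarrow> 'b::euclidean_space) \<Rightarrow> bool" where
  "locally_Lp p f \<longleftrightarrow> f \<in> borel_measurable lebesgue \<and>
     (\<forall>K. compact K \<longrightarrow> set_integrable lebesgue K (\<lambda>x. norm (f x) powr p))"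

definition has_weak_gradient ::
  "('a::euclidean_space \<Rightarrow> real) \<Rightarrow> ('a \<Rightarrow> 'a) \<Rightarrow> bool" where
  "has_weak_gradient u G \<longleftrightarrow> locally_integrable u \<and> locally_integrable G \<and>
     (\<forall>\<phi>. test_function \<phi> \<longrightarrow> (\<forall>b\<in>Basis.
        (LINT x|lebesgue. u x * (grad \<phi> x \<bullet> b)) = - (LINT x|lebesgue. (G x \<bullet> b) * \<phi> x)))"

definition W1p_loc :: "real \<Rightarrow> ('a::euclidean_space \<Rightarrow> real) set" where
  "W1p_loc p = {u. locally_Lp p u \<and> (\<exists>G. has_weak_gradient u G \<and> locally_Lp p G)}"

text \<open>
  Weak solutions of \<open>- div (|\<nabla>u|\<^sup>p\<^sup>-\<^sup>2 \<nabla>u) = f\<close>. The weak gradient is unique up to null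
  sets, so \<open>G\<close> is \<open>\<nabla>u\<close>. Both integrals are required to exist, since a non-convergent
  Bochner integral is 0 by convention; this matters for the right-hand side.
  The field \<open>|G|\<^sup>p\<^sup>-\<^sup>2 G\<close> is 0 where \<open>G\<close> vanishes, also for \<open>p < 2\<close>.
\<close>

definition weak_solution ::
  "real \<Rightarrow> ('a::euclidean_space \<Rightarrow> real) \<Rightarrow> ('a \<Rightarrow> real) \<Rightarrow> bool" where
  "weak_solution p u f \<longleftrightarrow> locally_Lp p u \<and>
     (\<exists>G. has_weak_gradient u G \<and> locally_Lp p G \<and>
       (\<forall>\<phi>. test_function \<phi> \<longrightarrow>
          integrable lebesgue (\<lambda>x. (norm (G x) powr (p - 2) *\<^sub>R G x) \<bullet> grad \<phi> x) \<and>
          integrable lebesgue (\<lambda>x. f x * \<phi> x) \<and>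
          (LINT x|lebesgue. (norm (G x) powr (p - 2) *\<^sub>R G x) \<bullet> grad \<phi> x)
            = (LINT x|lebesgue. f x * \<phi> x)))"

definition radial :: "('a::euclidean_space \<Rightarrow> real) \<Rightarrow> bool" where
  "radial u \<longleftrightarrow> (\<exists>g. AE x in lebesgue. u x = g (norm x))"

end

theory Submission
  imports Defs "HOL-Probability.Probability" "HOL-Real_Asymp.Real_Asymp"
begin

text \<open>
  A nonnegative radial solution \<open>w(|x|)\<close> satisfies, with \<open>N\<close> the dimension,
  \<open>r^(N-1) |w'|^(p-2) w' = - F(r)\<close>, where \<open>F(r)\<close> is the integral of \<open>s^(N-1+\<gamma>) w(s)^q\<close> over
  \<open>(0, r)\<close>: test functions that are constant near the origin exclude a point source there. So \<open>w\<close> is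
  nonincreasing. The Pohozaev function
  \<open>H = (p - 1) / p r^N |w'|^p + r^(N+\<gamma>) w^(q+1) / (q + 1) - (N - p) / p F w\<close>
  has the derivative \<open>\<kappa> r^(N+\<gamma>-1) w^(q+1)\<close>, and \<open>\<kappa> > 0\<close> is exactly the upper bound on \<open>q\<close>.
  Finite energy near the origin gives \<open>F w \<rightarrow> 0\<close> there, hence \<open>H \<ge> 0\<close>. At infinity,
  \<open>F \<ge> r^(N+\<gamma>) w^q / (N + \<gamma>)\<close> turns the equation into a differential inequality that, for
  \<open>q > p - 1\<close>, bounds \<open>w\<close> by a multiple of \<open>r^(-(p+\<gamma>)/(q-p+1))\<close>; below the critical exponent this
  makes \<open>H\<close> arbitrarily small at some arbitrarily large radii. A positive increasing function cannot do
  that, so \<open>w = 0\<close>. This part is \<open>decreasing_solution_eq_0\<close>.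

  The rest of the work is to reach the differential equation from the weak formulation, in which the
  gradient \<open>G\<close> is only a field in \<open>L^p\<close> locally and is not given to be radial. The nonlinear map
  \<open>G \<mapsto> |G|^(p-2) G\<close> does not commute with averaging over spheres, so radial symmetry of \<open>G\<close> has to
  be proved first: \<open>radial_weak_gradient\<close>. Let \<open>v\<close> be the spherical average of the radial component of \<open>G\<close>, which
  exists as a conditional expectation with respect to the norm (\<open>radial_average_exists\<close>). Testing
  with radial vector fields shows that \<open>v\<close> is the weak derivative of the profile, so the profile is a
  primitive of \<open>v\<close>. The divergence theorem on balls (\<open>radial_integration_by_parts\<close>) then says that
  \<open>v(|x|) x / |x|\<close> is a weak gradient as well, and weak gradients are unique. Finally, radial test
  functions give the equation for the flux in integrated form, and continuity of \<open>F\<close> makes the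
  profile continuously differentiable.
\<close>

section \<open>Smooth functions and bumps\<close>

lemma C_k_continuous: "C_k k f \<Longrightarrow> continuous_on UNIV f"
  by (cases k) (auto intro!: continuous_at_imp_continuous_on differentiable_imp_continuous_within)

lemma C_k_Suc_D: "C_k (Suc k) f \<Longrightarrow> C_k k f"
  by (induction k arbitrary: f)
    (auto intro!: continuous_at_imp_continuous_on differentiable_imp_continuous_within)

lemma C_k_SucI:
  assumes "\<And>x. (f has_derivative f' x) (at x)" and "\<And>b. b \<in> Basis \<Longrightarrow> C_k k (\<lambda>x. f' x b)"
  shows "C_k (Suc k) f"
proof -
  have "frechet_derivative f (at x) = f' x" for x
    using frechet_derivative_at[OF assms(1)] by simp
  then show ?thesis using assms by (auto simp: differentiable_def)
qed

lemma C_k_SucE: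
  assumes "C_k (Suc k) f"
  shows "(f has_derivative frechet_derivative f (at x)) (at x)"
    and "b \<in> Basis \<Longrightarrow> C_k k (\<lambda>x. frechet_derivative f (at x) b)"
  using assms by (auto simp: frechet_derivative_works)

lemma C_k_const: "C_k k (\<lambda>x. c)"
proof (induction k arbitrary: c)
  case (Suc k)
  show ?case by (rule C_k_SucI[where f' = "\<lambda>_ _. 0"]) (auto intro: Suc)
qed auto

lemma C_k_add: "C_k k f \<Longrightarrow> C_k k g \<Longrightarrow> C_k k (\<lambda>x. f x + g x)"
proof (induction k arbitrary: f g)
  case (Suc k)
  show ?case
    by (rule C_k_SucI[OF has_derivative_add[OF C_k_SucE(1)[OF Suc.prems(1)] C_k_SucE(1)[OF Suc.prems(2)]]])
      (intro Suc.IH C_k_SucE(2)[OF Suc.prems(1)] C_k_SucE(2)[OF Suc.prems(2)])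
qed (auto intro: continuous_intros)

lemma C_k_mult: "C_k k f \<Longrightarrow> C_k k g \<Longrightarrow> C_k k (\<lambda>x. f x * g x)"
proof (induction k arbitrary: f g)
  case (Suc k)
  show ?case
    by (rule C_k_SucI[OF has_derivative_mult[OF C_k_SucE(1)[OF Suc.prems(1)] C_k_SucE(1)[OF Suc.prems(2)]]])
      (intro C_k_add Suc.IH Suc.prems[THEN C_k_Suc_D] C_k_SucE(2)[OF Suc.prems(1)] C_k_SucE(2)[OF Suc.prems(2)])
qed (auto intro: continuous_intros)

lemma C_k_sum: "finite I \<Longrightarrow> (\<And>i. i \<in> I \<Longrightarrow> C_k k (f i)) \<Longrightarrow> C_k k (\<lambda>x. \<Sum>i\<in>I. f i x)"
  by (induction I rule: finite_induct) (auto intro: C_k_add C_k_const)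

lemma C_k_prod: "finite I \<Longrightarrow> (\<And>i. i \<in> I \<Longrightarrow> C_k k (f i)) \<Longrightarrow> C_k k (\<lambda>x. \<Prod>i\<in>I. f i x)"
  by (induction I rule: finite_induct) (auto intro: C_k_mult C_k_const)

lemma C_k_linear: "bounded_linear f \<Longrightarrow> C_k k f"
proof (cases k)
  case 0
  then show "bounded_linear f \<Longrightarrow> C_k k f" by (simp add: linear_continuous_on)
next
  case (Suc l)
  show "bounded_linear f \<Longrightarrow> C_k k f" unfolding Suc
    by (rule C_k_SucI[where f' = "\<lambda>_. f"]) (auto intro: C_k_const bounded_linear_imp_has_derivative)
qed

lemma C_k_inner: "C_k k (\<lambda>x. x \<bullet> c)"
  by (rule C_k_linear) (rule bounded_linear_inner_left)

lemma C_k_norm_square: "C_k k (\<lambda>x::'a::euclidean_space. x \<bullet> x)"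
  by (subst euclidean_inner) (intro C_k_sum C_k_mult C_k_inner, auto)

text \<open>
  The outer function is taken on the reals so that the chain rule stays a product and the induction
  closes; this covers every composition below.
\<close>

lemma C_k_compose:
  fixes g :: "real \<Rightarrow> real"
  shows "C_k k g \<Longrightarrow> C_k k f \<Longrightarrow> C_k k (\<lambda>x. g (f x))"
proof (induction k arbitrary: g f)
  case 0
  then show ?case by (auto intro: continuous_on_compose2)
next
  case (Suc k)
  have lin: "frechet_derivative g (at t) h = h * frechet_derivative g (at t) 1" for t h
    using linear_cmul[OF has_derivative_linear[OF C_k_SucE(1)[OF Suc.prems(1)]], of t h 1] by simp
  show ?case
  proof (rule C_k_SucI[OF has_derivative_compose[OF C_k_SucE(1)[OF Suc.prems(2)] C_k_SucE(1)[OF Suc.prems(1)]]])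
    fix b :: 'a assume b: "b \<in> Basis"
    show "C_k k (\<lambda>x. frechet_derivative g (at (f x)) (frechet_derivative f (at x) b))"
      unfolding lin[of _ "frechet_derivative f (at _) b"]
      by (intro C_k_mult Suc.IH[of "\<lambda>t. frechet_derivative g (at t) 1"] C_k_SucE(2)[OF Suc.prems(2) b]
          C_k_SucE(2)[OF Suc.prems(1)] C_k_Suc_D[OF Suc.prems(2)]) auto
  qed
qed

lemma C_k_Suc_realI:
  assumes "\<And>x. (f has_real_derivative f' x) (at x)" and "C_k k f'"
  shows "C_k (Suc k) f"
  using assms by (intro C_k_SucI[where f' = "\<lambda>x h. f' x * h"]) (auto simp: has_field_derivative_def)

lemma C_k_Suc_realE:
  fixes f :: "real \<Rightarrow> real"
  assumes "C_k (Suc k) f"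
  shows "(f has_real_derivative deriv f x) (at x)" and "C_k k (deriv f)"
proof -
  have "f differentiable at x" for x using assms by simp
  then have d: "(f has_real_derivative deriv f x) (at x)" for x
    by (simp add: DERIV_deriv_iff_real_differentiable)
  then show "(f has_real_derivative deriv f x) (at x)" .
  have "frechet_derivative f (at x) = (*) (deriv f x)" for x
    using d[of x] by (metis frechet_derivative_at has_field_derivative_def)
  then show "C_k k (deriv f)" using C_k_SucE(2)[OF assms, of 1] by simp
qed

text \<open>
  The derivative of each function \<open>t^(-n) exp (- 1 / t)\<close>, extended by zero, is a linear combination of
  functions of the same form. Smoothness of all of them follows by one induction, without polynomials in
  \<open>1 / t\<close>.
\<close>

definition flat :: "nat \<Rightarrow> real \<Rightarrow> real" where
  "flat n t = (if t \<le> 0 then 0 else exp (- (1 / t)) / t ^ n)"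

lemma flat_tendsto_0: "(flat n \<longlongrightarrow> 0) (at_right 0)"
proof -
  have "((\<lambda>x. x ^ n / exp x) \<longlongrightarrow> (0::real)) at_top" by (rule tendsto_power_div_exp_0)
  then have "((\<lambda>t. inverse t ^ n / exp (inverse t)) \<longlongrightarrow> (0::real)) (at_right 0)"
    by (rule filterlim_compose[OF _ filterlim_inverse_at_top_right])
  moreover have "eventually (\<lambda>t. inverse t ^ n / exp (inverse t) = flat n t) (at_right 0)"
    unfolding eventually_at_right_field
    by (intro exI[of _ 1]) (auto simp: flat_def exp_minus field_simps power_inverse)
  ultimately show ?thesis by (rule Lim_transform_eventually)
qed

lemma flat_has_derivative:
  "(flat n has_real_derivative flat (n + 2) t - real n * flat (n + 1) t) (at t)"
proof -
  consider "t < 0" | "t = 0" | "t > 0" by linarith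
  then show ?thesis
  proof cases
    case 1
    have "((\<lambda>_. 0) has_real_derivative 0) (at t)" by simp
    then have "(flat n has_real_derivative 0) (at t)"
      by (rule DERIV_cong_ev[THEN iffD1, rotated -1])
        (use 1 eventually_nhds_in_open[of "{..<0}" t] in \<open>auto simp: flat_def elim!: eventually_mono\<close>)
    then show ?thesis using 1 by (simp add: flat_def)
  next
    case 3
    have "real n * t ^ (n - Suc 0) * t = real n * t ^ n" by (cases n) auto
    then have "((\<lambda>t. exp (- (1 / t)) / t ^ n) has_real_derivative
        flat (n + 2) t - real n * flat (n + 1) t) (at t)"
      using 3 by (auto intro!: derivative_eq_intros simp: flat_def field_simps power2_eq_square)
    then show ?thesis
      by (rule DERIV_cong_ev[THEN iffD1, rotated -1])
        (use 3 eventually_nhds_in_open[of "{0<..}" t] in \<open>auto simp: flat_def elim!: eventually_mono\<close>)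
  next
    case 2
    have "((\<lambda>h. (flat n (0 + h) - flat n 0) / h) \<longlongrightarrow> 0) (at 0)"
    proof (rule filterlim_split_at)
      show "((\<lambda>h. (flat n (0 + h) - flat n 0) / h) \<longlongrightarrow> 0) (at_left 0)"
        by (rule tendsto_eventually, unfold eventually_at_left_field)
          (auto intro!: exI[of _ "-1"] simp: flat_def)
      show "((\<lambda>h. (flat n (0 + h) - flat n 0) / h) \<longlongrightarrow> 0) (at_right 0)"
        by (rule Lim_transform_eventually[OF flat_tendsto_0[of "Suc n"]], unfold eventually_at_right_field)
          (auto intro!: exI[of _ "1"] simp: flat_def field_simps)
    qed
    then show ?thesis using 2 by (simp add: DERIV_def flat_def)
  qed
qed

lemma C_k_flat: "C_k k (flat n)"
proof (induction k arbitrary: n)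
  case 0
  show ?case using flat_has_derivative by (auto intro!: continuous_at_imp_continuous_on DERIV_isCont)
next
  case (Suc k)
  have "C_k k (\<lambda>t. flat (n + 2) t + (- real n) * flat (n + 1) t)"
    by (intro C_k_add C_k_mult C_k_const Suc)
  then show ?case by (intro C_k_Suc_realI[OF flat_has_derivative]) simp
qed

text \<open>
  As \<open>n\<close> grows, these tend to the indicator of \<open>(a, b)\<close> while staying between 0 and 1 and supported
  in \<open>[a, b]\<close>. They thus serve for approximation without mollifiers or normalising constants.
\<close>

definition bump :: "real \<Rightarrow> real \<Rightarrow> nat \<Rightarrow> real \<Rightarrow> real" where
  "bump a b n t = flat 0 (real n * (t - a)) * flat 0 (real n * (b - t))"

lemma flat_0_bounds: "0 \<le> flat 0 t" "flat 0 t \<le> 1" "0 < flat 0 t \<longleftrightarrow> 0 < t"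
  by (auto simp: flat_def)

lemma bump_bounds: "0 \<le> bump a b n t" "bump a b n t \<le> 1"
  using mult_mono[of "flat 0 (real n * (t - a))" 1 "flat 0 (real n * (b - t))" 1]
  by (auto simp: bump_def flat_0_bounds)

lemma bump_eq_0: "t \<notin> {a<..<b} \<Longrightarrow> bump a b n t = 0"
  by (auto simp: bump_def flat_def mult_le_0_iff)

lemma bump_pos: "t \<in> {a<..<b} \<Longrightarrow> 0 < n \<Longrightarrow> 0 < bump a b n t"
  by (auto simp: bump_def flat_0_bounds intro!: mult_pos_pos)

lemma C_k_bump: "C_k k (bump a b n)"
proof -
  have "C_k k (\<lambda>t. real n * (t + (-a)))" "C_k k (\<lambda>t. real n * (b + (-1) * t))"
    by (intro C_k_mult C_k_add C_k_const C_k_linear bounded_linear_ident)+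
  then have "C_k k (\<lambda>t. real n * (t - a))" "C_k k (\<lambda>t. real n * (b - t))" by simp_all
  from this[THEN C_k_compose[OF C_k_flat]] show ?thesis
    unfolding bump_def[abs_def] by (rule C_k_mult)
qed

lemma bump_tendsto: "(\<lambda>n. bump a b n t) \<longlonglongrightarrow> indicator {a<..<b} t"
proof (cases "t \<in> {a<..<b}")
  case True
  have lim: "(\<lambda>n. flat 0 (real n * s)) \<longlonglongrightarrow> 1" if "s > 0" for s
  proof -
    have "(\<lambda>n. exp (- (inverse s * inverse (real n)))) \<longlonglongrightarrow> exp (- (inverse s * 0))"
      by (intro tendsto_intros tendsto_inverse_0_at_top filterlim_real_sequentially)
    then have "(\<lambda>n. exp (- (inverse s * inverse (real n)))) \<longlonglongrightarrow> 1" by simp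
    then show ?thesis
      by (rule Lim_transform_eventually[OF _ eventually_mono[OF eventually_gt_at_top[of 0]]])
        (use that in \<open>auto simp: flat_def field_simps mult_le_0_iff\<close>)
  qed
  have "(\<lambda>n. bump a b n t) \<longlonglongrightarrow> 1 * 1"
    unfolding bump_def using True by (intro tendsto_mult lim) auto
  then show ?thesis using True by simp
qed (simp add: bump_eq_0)

text \<open>
  The power is singular at 0 only, where \<open>K\<close> vanishes. The exponent is left free because
  differentiation lowers it.
\<close>

lemma C_k_mult_powr:
  assumes "\<And>k. C_k k K" "0 < a" "\<And>t. t < a \<Longrightarrow> K t = 0"
  shows "C_k k (\<lambda>t. K t * t powr s)"
  using assms(1,3)
proof (induction k arbitrary: K s)
  have d: "((\<lambda>t. K t * t powr s) has_real_derivative deriv K t * t powr s + s * (K t * t powr (s - 1))) (at t)"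
    if K: "\<And>k. C_k k K" "\<And>t. t < a \<Longrightarrow> K t = 0" for K s t
  proof (cases "t < a")
    case True
    have "((\<lambda>_. 0) has_real_derivative 0) (at t)" by simp
    then have "((\<lambda>t. K t * t powr s) has_real_derivative 0) (at t)"
      by (rule DERIV_cong_ev[THEN iffD1, rotated -1])
        (use True K(2) eventually_nhds_in_open[of "{..<a}" t] in \<open>auto elim!: eventually_mono\<close>)
    moreover have "(K has_real_derivative 0) (at t)"
      by (rule DERIV_cong_ev[THEN iffD1, rotated -1, of "\<lambda>_. 0"])
        (use True K(2) eventually_nhds_in_open[of "{..<a}" t] in \<open>auto elim!: eventually_mono\<close>)
    ultimately show ?thesis using True K(2) by (simp add: DERIV_imp_deriv)
  next
    case False
    then have "t > 0" using \<open>0 < a\<close> by simp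
    then show ?thesis
      by (auto intro!: derivative_eq_intros C_k_Suc_realE(1)[OF K(1)])
  qed
  {
    case 0
    show ?case
      using d[OF 0] by (auto intro!: continuous_at_imp_continuous_on DERIV_isCont)
  next
    case (Suc k)
    have K': "C_k k (deriv K)" for k using C_k_Suc_realE(2)[OF Suc.prems(1)] .
    have z: "deriv K t = 0" if "t < a" for t
    proof -
      have "(K has_real_derivative 0) (at t)"
        by (rule DERIV_cong_ev[THEN iffD1, rotated -1, of "\<lambda>_. 0"])
          (use that Suc.prems(2) eventually_nhds_in_open[of "{..<a}" t] in \<open>auto elim!: eventually_mono\<close>)
      then show ?thesis by (simp add: DERIV_imp_deriv)
    qed
    show ?case
    proof (rule C_k_Suc_realI[OF d[OF Suc.prems]])
      show "C_k k (\<lambda>t. deriv K t * t powr s + s * (K t * t powr (s - 1)))"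
        by (intro C_k_add C_k_mult[OF C_k_const] Suc.IH K' z Suc.prems)
    qed
  }
qed

lemma antiderivative_exists:
  fixes f :: "real \<Rightarrow> real"
  assumes "continuous_on UNIV f"
  obtains F where "\<And>x. (F has_real_derivative f x) (at x)"
proof -
  have "\<exists>F. \<forall>x. -\<infinity> < ereal x \<longrightarrow> ereal x < \<infinity> \<longrightarrow> (F has_vector_derivative f x) (at x)"
    using assms by (intro einterval_antiderivative) (auto simp: continuous_on_eq_continuous_at)
  then show thesis using that by (auto simp: has_real_derivative_iff_has_vector_derivative)
qed

lemma bump_antiderivative:
  assumes F: "\<And>t. (F has_real_derivative bump \<alpha> \<beta> n t) (at t)" and \<alpha>\<beta>: "\<alpha> < \<beta>"
  shows "\<beta> \<le> t \<Longrightarrow> F t = F \<beta>" and "t \<le> \<alpha> \<Longrightarrow> F t = F \<alpha>" and "0 < n \<Longrightarrow> F \<alpha> < F \<beta>"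
    and "F \<alpha> \<le> F t" and "F t \<le> F \<beta>"
proof -
  have mono: "F s \<le> F t" if "s \<le> t" for s t
    by (rule DERIV_nonneg_imp_nondecreasing[OF that], rule exI, rule conjI, rule F, rule bump_bounds)
  have anti: "F t \<le> F s" if st: "s \<le> t" "t \<le> \<alpha> \<or> \<beta> \<le> s" for s t
  proof (rule DERIV_nonpos_imp_nonincreasing[OF st(1)])
    fix x assume "s \<le> x" "x \<le> t"
    then have "bump \<alpha> \<beta> n x = 0" using st by (intro bump_eq_0) auto
    then show "\<exists>y. (F has_real_derivative y) (at x) \<and> y \<le> 0" by (metis F order_refl)
  qed
  have 1: "F t = F \<beta>" if "\<beta> \<le> t" for t
    by (rule antisym[OF anti[OF that disjI2[OF order_refl]] mono[OF that]])
  have 2: "F t = F \<alpha>" if "t \<le> \<alpha>" for t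
    by (rule antisym[OF mono[OF that] anti[OF that disjI1[OF order_refl]]])
  show "\<beta> \<le> t \<Longrightarrow> F t = F \<beta>" by (rule 1)
  show "t \<le> \<alpha> \<Longrightarrow> F t = F \<alpha>" by (rule 2)
  show "F \<alpha> \<le> F t"
  proof (cases "t \<le> \<alpha>")
    case True
    show ?thesis unfolding 2[OF True] by (rule order_refl)
  next
    case False
    then show ?thesis by (intro mono) (rule less_imp_le, rule not_le_imp_less)
  qed
  show "F t \<le> F \<beta>"
  proof (cases "\<beta> \<le> t")
    case True
    show ?thesis unfolding 1[OF True] by (rule order_refl)
  next
    case False
    then show ?thesis by (intro mono) (rule less_imp_le, rule not_le_imp_less)
  qed
  show "F \<alpha> < F \<beta>" if "0 < n"
  proof (rule DERIV_pos_imp_increasing_open[OF \<alpha>\<beta>])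
    show "\<exists>y. (F has_real_derivative y) (at x) \<and> 0 < y" if "\<alpha> < x" "x < \<beta>" for x
      by (rule exI, rule conjI, rule F, rule bump_pos) (use that \<open>0 < n\<close> in auto)
    show "continuous_on {\<alpha>..\<beta>} F"
      by (rule continuous_at_imp_continuous_on, rule ballI, rule DERIV_isCont, rule F)
  qed
qed

lemma bump_borel [measurable]: "bump \<alpha> \<beta> n \<in> borel_measurable borel"
  by (rule borel_measurable_continuous_onI[OF C_k_continuous[OF C_k_bump[of 0]]])

text \<open>
  The function \<open>2 s bump(s^2)\<close> is the derivative of \<open>F(s^2)\<close>. Radial test functions are written in
  the variable \<open>s^2\<close> because the squared norm, unlike the norm, is smooth at the origin.
\<close>

lemma bump_radial_FTC:
  assumes F: "\<And>t. (F has_real_derivative bump \<alpha> \<beta> n t) (at t)" and \<alpha>\<beta>: "0 < \<alpha>" "\<alpha> < \<beta>" and a: "0 \<le> a"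
  shows "integrable lborel (\<lambda>s. indicator {a..} s * (indicator {0<..} s * (2 * s * bump \<alpha> \<beta> n (s\<^sup>2))))"
    and "(LBINT s. indicator {a..} s * (indicator {0<..} s * (2 * s * bump \<alpha> \<beta> n (s\<^sup>2)))) = F \<beta> - F (a\<^sup>2)"
proof -
  let ?f = "\<lambda>s. 2 * s * bump \<alpha> \<beta> n (s\<^sup>2)"
  define c where "c = a + sqrt \<beta>"
  have "sqrt \<beta> \<le> c" "0 \<le> sqrt \<beta>" using a \<alpha>\<beta> by (auto simp: c_def)
  then have c: "a \<le> c" "\<beta> \<le> c\<^sup>2" using \<alpha>\<beta> a power_mono[of "sqrt \<beta>" c 2] by (auto simp: c_def)
  have eq: "indicator {a..} s * (indicator {0<..} s * ?f s) = ?f s * indicator {a..c} s" for s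
  proof (cases "c < s")
    case True
    then have "c\<^sup>2 \<le> s\<^sup>2" using a c by (intro power_mono) auto
    then have "bump \<alpha> \<beta> n (s\<^sup>2) = 0" using c by (intro bump_eq_0) auto
    then show ?thesis by simp
  next
    case False
    then show ?thesis using a by (auto simp: indicator_def)
  qed
  have d: "((\<lambda>s. F (s\<^sup>2)) has_real_derivative ?f s) (at s)" for s
    by (rule DERIV_cong[OF DERIV_chain2[OF F]]) (auto intro!: derivative_eq_intros)
  have nn: "0 \<le> ?f s" if "s \<in> {a..c}" for s
    using that a bump_bounds(1)[of \<alpha> \<beta> n "s\<^sup>2"] by simp
  have m: "?f \<in> borel_measurable borel" by measurable
  show "integrable lborel (\<lambda>s. indicator {a..} s * (indicator {0<..} s * ?f s))"
    unfolding eq by (rule integrable_FTC_Icc_nonneg[OF m d nn c(1)])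
  have "(LBINT s. indicator {a..} s * (indicator {0<..} s * ?f s)) = F (c\<^sup>2) - F (a\<^sup>2)"
    unfolding eq by (rule integral_FTC_Icc_nonneg[OF m d nn c(1)])
  then show "(LBINT s. indicator {a..} s * (indicator {0<..} s * ?f s)) = F \<beta> - F (a\<^sup>2)"
    using bump_antiderivative(1)[OF F \<alpha>\<beta>(2) c(2)] by simp
qed

section \<open>Test functions\<close>

lemma test_functionI:
  assumes "\<And>k. C_k k \<phi>" and "\<And>x. norm x > R \<Longrightarrow> \<phi> x = 0"
  shows "test_function \<phi>"
proof -
  have "{x. \<phi> x \<noteq> 0} \<subseteq> cball 0 R" using assms(2) by (auto simp: not_less[symmetric])
  then have "bounded {x. \<phi> x \<noteq> 0}" by (rule bounded_subset[OF bounded_cball])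
  then show ?thesis using assms(1) by (simp add: test_function_def compact_closure)
qed

lemma test_function_C_k: "test_function \<phi> \<Longrightarrow> C_k k \<phi>"
  by (simp add: test_function_def)

lemma test_function_borel: "test_function \<phi> \<Longrightarrow> \<phi> \<in> borel_measurable borel"
  by (intro borel_measurable_continuous_onI C_k_continuous[of 0] test_function_C_k)

lemma grad_eqI:
  assumes "(\<phi> has_derivative (\<lambda>h. v \<bullet> h)) (at x)"
  shows "grad \<phi> x = v"
  unfolding grad_def frechet_derivative_at[OF assms, symmetric] by (rule euclidean_representation)

lemma grad_inner: 
  assumes "(\<phi> has_derivative D) (at x)" "b \<in> Basis"
  shows "grad \<phi> x \<bullet> b = D b"
  using frechet_derivative_at[OF assms(1)] assms(2) by (simp add: grad_def inner_sum_left_Basis)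

lemma radial_has_derivative:
  fixes x :: "'a::euclidean_space"
  assumes "(k has_real_derivative k') (at (x \<bullet> x))"
  shows "((\<lambda>x. k (x \<bullet> x)) has_derivative (\<lambda>h. ((2 * k') *\<^sub>R x) \<bullet> h)) (at x)"
proof -
  have "((\<lambda>x. x \<bullet> x) has_derivative (\<lambda>h. x \<bullet> h + h \<bullet> x)) (at x)"
    by (auto intro!: derivative_eq_intros)
  from has_derivative_compose[OF this assms[unfolded has_field_derivative_def]]
  show ?thesis by (simp add: inner_commute algebra_simps)
qed

lemma integrable_pointwise_bound:
  fixes f :: "'a \<Rightarrow> 'b::{banach, second_countable_topology}" and g :: "'a \<Rightarrow> real"
  assumes "integrable M f" "g \<in> borel_measurable M" "\<And>x. norm (g x) \<le> norm (f x)"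
  shows "integrable M g"
  by (rule Bochner_Integration.integrable_bound[OF assms(1,2)], rule AE_I2, rule assms(3))

lemma has_derivative_imp_directional:
  fixes f :: "'a::euclidean_space \<Rightarrow> real"
  assumes "(f has_derivative D) (at x)"
  shows "((\<lambda>t. (f (x + t *\<^sub>R b) - f x) / t) \<longlongrightarrow> D b) (at 0)"
proof -
  have "((\<lambda>t. x + t *\<^sub>R b) has_derivative (\<lambda>t. t *\<^sub>R b)) (at 0)"
    by (auto intro!: derivative_eq_intros)
  moreover have "(f has_derivative D) (at (x + 0 *\<^sub>R b))" using assms by simp
  ultimately have "((\<lambda>t. f (x + t *\<^sub>R b)) has_derivative (\<lambda>t. D (t *\<^sub>R b))) (at 0)"
    by (rule has_derivative_compose)
  moreover have "D (t *\<^sub>R b) = D b * t" for t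
    using linear_cmul[OF has_derivative_linear[OF assms]] by (simp add: mult.commute)
  ultimately have "((\<lambda>t. f (x + t *\<^sub>R b)) has_field_derivative D b) (at 0)"
    unfolding has_field_derivative_def by (simp add: fun_eq_iff)
  then show ?thesis by (simp add: DERIV_def)
qed

lemma bounded_if_compact_support:
  fixes f :: "'a::euclidean_space \<Rightarrow> real"
  assumes "continuous_on UNIV f" "\<And>x. norm x > R \<Longrightarrow> f x = 0"
  obtains M where "0 \<le> M" "\<And>x. \<bar>f x\<bar> \<le> M"
proof -
  have "compact (f ` cball 0 R)"
    by (intro compact_continuous_image compact_cball continuous_on_subset[OF assms(1)]) auto
  then have "bounded (f ` cball 0 R)" by (rule compact_imp_bounded)
  then obtain M where M: "\<forall>y\<in>f ` cball 0 R. norm y \<le> M" unfolding bounded_iff by blast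
  have "\<bar>f x\<bar> \<le> max M 0" for x
  proof (cases "norm x \<le> R")
    case True
    then have "f x \<in> f ` cball 0 R" by (intro imageI) simp
    then have "\<bar>f x\<bar> \<le> M" using M by fastforce
    then show ?thesis by simp
  qed (simp add: assms(2))
  then show thesis by (intro that[of "max M 0"]) simp_all
qed

lemma integrable_compact_support:
  fixes f :: "'a::euclidean_space \<Rightarrow> real"
  assumes [measurable]: "f \<in> borel_measurable borel"
    and "\<And>x. \<bar>f x\<bar> \<le> M" "\<And>x. norm x > R \<Longrightarrow> f x = 0"
  shows "integrable lborel f"
proof (rule integrable_pointwise_bound[where f = "\<lambda>x. M * indicator (cball 0 R) x"])
  show "integrable lborel (\<lambda>x::'a. M * indicator (cball 0 R) x)"
    by (cases "R \<ge> 0"; intro integrable_mult_right) (auto simp: emeasure_cball integrable_indicator_iff)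
  show "norm (f x) \<le> norm (M * indicator (cball 0 R) x)" for x
  proof (cases "norm x \<le> R")
    case True
    then show ?thesis using assms(2)[of x] by simp
  qed (simp add: assms(3))
qed simp

lemma test_function_has_derivative:
  "test_function \<phi> \<Longrightarrow> (\<phi> has_derivative frechet_derivative \<phi> (at x)) (at x)"
  by (rule C_k_SucE(1)[OF test_function_C_k[where k = "Suc 0"]])

lemma test_function_grad_inner:
  "test_function \<phi> \<Longrightarrow> b \<in> Basis \<Longrightarrow> grad \<phi> x \<bullet> b = frechet_derivative \<phi> (at x) b"
  by (rule grad_inner[OF test_function_has_derivative])

lemma test_function_grad_continuous:
  assumes "test_function \<phi>" "b \<in> Basis"
  shows "continuous_on UNIV (\<lambda>x. grad \<phi> x \<bullet> b)"
  unfolding test_function_grad_inner[OF assms]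
  by (rule C_k_continuous[OF C_k_SucE(2)[OF test_function_C_k[where k = "Suc 0"], OF assms]])

lemma grad_eq_0_if_locally_0:
  assumes "test_function \<phi>" "open S" "x \<in> S" "\<And>y. y \<in> S \<Longrightarrow> \<phi> y = 0"
  shows "grad \<phi> x = 0"
proof (rule grad_eqI)
  have "((\<lambda>_. 0) has_derivative (\<lambda>h. 0 \<bullet> h)) (at x)" by simp
  then show "(\<phi> has_derivative (\<lambda>h. 0 \<bullet> h)) (at x)"
    by (rule has_derivative_transform_within_open[OF _ assms(2,3)]) (simp add: assms(4))
qed

lemma test_function_support:
  assumes "test_function \<phi>"
  obtains R where "0 < R" "\<And>x. norm x > R \<Longrightarrow> \<phi> x = 0"
proof -
  have "bounded {x. \<phi> x \<noteq> 0}"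
    using bounded_subset[OF compact_imp_bounded closure_subset] assms by (simp add: test_function_def)
  then obtain R where "0 < R" "\<forall>x\<in>{x. \<phi> x \<noteq> 0}. norm x \<le> R"
    unfolding bounded_pos by blast
  then show thesis using that[of R] by (metis (mono_tags, lifting) mem_Collect_eq not_less)
qed

lemma test_function_lipschitz:
  fixes \<phi> :: "'a::euclidean_space \<Rightarrow> real"
  assumes tf: "test_function \<phi>"
  obtains L where "0 \<le> L" "\<And>x y. \<bar>\<phi> x - \<phi> y\<bar> \<le> L * norm (x - y)"
proof -
  obtain R where R: "\<And>x. norm x > R \<Longrightarrow> \<phi> x = 0" using test_function_support[OF tf] by blast
  have "grad \<phi> x = 0" if "norm x > R" for x
    by (rule grad_eq_0_if_locally_0[OF tf, of "- cball 0 R"]) (use R that in auto)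
  then have z: "grad \<phi> x \<bullet> b = 0" if "norm x > R" for x b using that by simp
  have "\<exists>M. 0 \<le> M \<and> (\<forall>x. \<bar>grad \<phi> x \<bullet> b\<bar> \<le> M)" if b: "b \<in> Basis" for b
    using bounded_if_compact_support[OF test_function_grad_continuous[OF tf b] z] by metis
  then obtain M where M: "\<And>b. b \<in> Basis \<Longrightarrow> 0 \<le> M b" "\<And>b x. b \<in> Basis \<Longrightarrow> \<bar>grad \<phi> x \<bullet> b\<bar> \<le> M b" by metis
  let ?L = "\<Sum>b\<in>Basis. M b"
  have bound: "\<bar>frechet_derivative \<phi> (at x) h\<bar> \<le> ?L * norm h" for x h
  proof -
    have lin: "linear (frechet_derivative \<phi> (at x))"
      by (rule has_derivative_linear[OF test_function_has_derivative[OF tf]])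
    have "frechet_derivative \<phi> (at x) h = frechet_derivative \<phi> (at x) (\<Sum>b\<in>Basis. (h \<bullet> b) *\<^sub>R b)"
      by (simp add: euclidean_representation)
    also have "\<dots> = (\<Sum>b\<in>Basis. (h \<bullet> b) * (grad \<phi> x \<bullet> b))"
      by (simp add: linear_sum[OF lin] linear_cmul[OF lin] test_function_grad_inner[OF tf])
    also have "\<bar>\<dots>\<bar> \<le> (\<Sum>b\<in>Basis. norm h * M b)"
      unfolding abs_mult
      by (intro order_trans[OF sum_abs] sum_mono)
        (simp add: abs_mult mult_mono Basis_le_norm M)
    also have "\<dots> = ?L * norm h" by (simp only: sum_distrib_left[symmetric]) (rule mult.commute)
    finally show ?thesis .
  qed
  show thesis
  proof
    show "0 \<le> ?L" by (intro sum_nonneg M)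
    show "\<bar>\<phi> x - \<phi> y\<bar> \<le> ?L * norm (x - y)" for x y
    proof -
      have "norm (\<phi> x - \<phi> y) \<le> ?L * norm (x - y)"
      proof (rule differentiable_bound[of UNIV \<phi> "\<lambda>x. frechet_derivative \<phi> (at x)"])
        show "onorm (frechet_derivative \<phi> (at x)) \<le> ?L" for x
        proof (rule onorm_bound)
          show "0 \<le> ?L" by (intro sum_nonneg M)
          show "norm (frechet_derivative \<phi> (at x) h) \<le> ?L * norm h" for h
            using bound[of x h] by simp
        qed
      qed (auto intro: test_function_has_derivative[OF tf])
      then show ?thesis by simp
    qed
  qed
qed

section \<open>Functions determined by their integrals\<close>

text \<open>
  The positive and the negative part of \<open>h\<close> are densities of two finite measures that agree on the
  intersection-stable generator of open boxes, hence agree.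
\<close>

lemma AE_eq_0_if_box_integrals_0:
  fixes h :: "'a::euclidean_space \<Rightarrow> real"
  assumes h: "integrable lborel h"
    and box: "\<And>a b. (LBINT x:box a b. h x) = 0"
  shows "AE x in lborel. h x = 0"
proof -
  have [measurable]: "h \<in> borel_measurable borel" using h by auto
  define m where "m s = density lborel (\<lambda>x. ennreal (s * h x))" for s :: real
  have int: "integrable lborel (\<lambda>x. max 0 (s * h x) * indicator A x)" if "A \<in> sets borel" for s A
    using that h by (intro integrable_real_mult_indicator integrable_max) auto
  have em: "emeasure (m s) A = ennreal (LBINT x. max 0 (s * h x) * indicator A x)"
    if A[measurable]: "A \<in> sets borel" for s A
  proof -
    have "emeasure (m s) A = (\<integral>\<^sup>+x. ennreal (max 0 (s * h x) * indicator A x) \<partial>lborel)"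
      unfolding m_def by (subst emeasure_density)
        (auto intro!: nn_integral_cong simp: indicator_def max_def ennreal_neg)
    also have "\<dots> = ennreal (LBINT x. max 0 (s * h x) * indicator A x)"
      using int[OF A] by (intro nn_integral_eq_integral) auto
    finally show ?thesis .
  qed
  have diff: "(LBINT x. max 0 (1 * h x) * indicator A x) - (LBINT x. max 0 ((-1) * h x) * indicator A x)
      = (LBINT x:A. h x)" if A: "A \<in> sets borel" for A
    unfolding set_lebesgue_integral_def Bochner_Integration.integral_diff[OF int[OF A] int[OF A], symmetric]
    by (intro Bochner_Integration.integral_cong) (auto simp: max_def indicator_def)
  have "m 1 = m (-1)"
  proof (rule measure_eqI_generator_eq[where E = "range (\<lambda>(a, b). box a b)" and \<Omega> = UNIV
        and A = "\<lambda>n. box (- real n *\<^sub>R One) (real n *\<^sub>R One)"])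
    show "Int_stable (range (\<lambda>(a, b). box a b :: 'a set))"
    proof (rule Int_stableI)
      fix A B assume "A \<in> range (\<lambda>(a, b). box a b :: 'a set)" "B \<in> range (\<lambda>(a, b). box a b :: 'a set)"
      then obtain a b c d where "A = box a b" "B = box c d" by auto
      then show "A \<inter> B \<in> range (\<lambda>(a, b). box a b)"
        by (auto simp: box_Int_box)
    qed
    fix X assume "X \<in> range (\<lambda>(a, b). box a b :: 'a set)"
    then obtain a b where X: "X = box a b" by auto
    show "emeasure (m 1) X = emeasure (m (-1)) X"
      using diff[of X] box[of a b] X by (simp add: em)
  next
    show "sets (m 1) = sigma_sets UNIV (range (\<lambda>(a, b). box a b))"
      "sets (m (-1)) = sigma_sets UNIV (range (\<lambda>(a, b). box a b))"
      unfolding m_def by (simp_all add: borel_eq_box)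
    show "(\<Union>n. box (- real n *\<^sub>R One) (real n *\<^sub>R One)) = (UNIV :: 'a set)"
      using UN_box_eq_UNIV by simp
    fix n show "emeasure (m 1) (box (- real n *\<^sub>R One) (real n *\<^sub>R One)) \<noteq> \<infinity>"
      by (simp add: em)
  qed auto
  then have "(LBINT x:A. h x) = (LBINT x:A. 0)" if A: "A \<in> sets lborel" for A
  proof -
    have A': "A \<in> sets borel" using A by simp
    have "ennreal (LBINT x. max 0 (1 * h x) * indicator A x)
        = ennreal (LBINT x. max 0 ((-1) * h x) * indicator A x)"
      using em[OF A', of 1] em[OF A', of "-1"] \<open>m 1 = m (-1)\<close> by simp
    then have "(LBINT x. max 0 (1 * h x) * indicator A x)
        = (LBINT x. max 0 ((-1) * h x) * indicator A x)"
      by (subst (asm) ennreal_inj) (auto intro!: Bochner_Integration.integral_nonneg)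
    then show ?thesis using diff[OF A'] by (simp add: set_lebesgue_integral_def)
  qed
  then show ?thesis
    using h by (intro density_unique_real) auto
qed

text \<open>
  Products of one-dimensional bumps tend boundedly to indicators of boxes.
\<close>

lemma fundamental_lemma:
  fixes h :: "'a::euclidean_space \<Rightarrow> real"
  assumes h: "integrable lebesgue h"
    and test: "\<And>\<phi>. test_function \<phi> \<Longrightarrow> (LINT x|lebesgue. h x * \<phi> x) = 0"
  shows "AE x in lebesgue. h x = 0"
proof -
  obtain h' where h'[measurable]: "h' \<in> borel_measurable lborel" and eq: "AE x in lborel. h x = h' x"
    using completion_ex_borel_measurable_real[of h lborel] h by auto
  have eq': "AE x in lebesgue. h x = h' x" using eq by (rule AE_completion)
  have mh: "h \<in> borel_measurable lebesgue" using h by (rule borel_measurable_integrable)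
  have mh': "h' \<in> borel_measurable lebesgue" by (rule measurable_completion[OF h'])
  have "integrable lebesgue h'"
    using h integrable_cong_AE[OF mh mh' eq'] by simp
  then have h'_int: "integrable lborel h'" by (simp add: integrable_completion)
  have test': "(LBINT x. h' x * \<phi> x) = 0" if "test_function \<phi>" for \<phi>
  proof -
    have [measurable]: "\<phi> \<in> borel_measurable borel"
      using that by (rule test_function_borel)
    have "(LBINT x. h' x * \<phi> x) = (LINT x|lebesgue. h' x * \<phi> x)"
      by (rule integral_completion[symmetric]) measurable
    also have "\<dots> = (LINT x|lebesgue. h x * \<phi> x)"
    proof (rule integral_cong_AE)
      show "AE x in lebesgue. h' x * \<phi> x = h x * \<phi> x" using eq' by eventually_elim simp
      have "\<phi> \<in> borel_measurable lebesgue" by (rule measurable_completion) measurable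
      then show "(\<lambda>x. h' x * \<phi> x) \<in> borel_measurable lebesgue" "(\<lambda>x. h x * \<phi> x) \<in> borel_measurable lebesgue"
        using mh mh' by (intro borel_measurable_times; simp)+
    qed
    finally show ?thesis using test[OF that] by simp
  qed
  have "AE x in lborel. h' x = 0"
  proof (rule AE_eq_0_if_box_integrals_0[OF h'_int])
    fix a b :: 'a
    define \<phi> where "\<phi> n x = (\<Prod>i\<in>Basis. bump (a \<bullet> i) (b \<bullet> i) n (x \<bullet> i))" for n and x :: 'a
    have z: "\<phi> n x = 0" if x: "x \<notin> box a b" for n x
    proof -
      obtain i where "i \<in> Basis" "x \<bullet> i \<notin> {a \<bullet> i<..<b \<bullet> i}" using x by (auto simp: mem_box)
      then show ?thesis unfolding \<phi>_def by (intro prod_zero bexI[of _ i] bump_eq_0) auto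
    qed
    obtain R where R: "\<forall>x\<in>box a b. norm x \<le> R"
      using bounded_box[of a b] unfolding bounded_iff by blast
    have tf: "test_function (\<phi> n)" for n
    proof (rule test_functionI[where R = R])
      show "C_k k (\<phi> n)" for k
        unfolding \<phi>_def[abs_def] by (intro C_k_prod C_k_compose[OF C_k_bump] C_k_inner) auto
      show "\<phi> n x = 0" if "norm x > R" for x
        using R z[of x n] that by (cases "x \<in> box a b") auto
    qed
    have [measurable]: "\<phi> n \<in> borel_measurable borel" for n
      using tf by (rule test_function_borel)
    have lim: "(\<lambda>n. \<phi> n x) \<longlonglongrightarrow> indicator (box a b) x" for x
    proof -
      have "(\<lambda>n. \<phi> n x) \<longlonglongrightarrow> (\<Prod>i\<in>Basis. indicator {a \<bullet> i<..<b \<bullet> i} (x \<bullet> i))"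
        unfolding \<phi>_def by (intro tendsto_prod bump_tendsto)
      moreover have "(\<Prod>i\<in>Basis. indicator {a \<bullet> i<..<b \<bullet> i} (x \<bullet> i)) = (indicator (box a b) x :: real)"
      proof (cases "x \<in> box a b")
        case False
        then obtain i where "i \<in> Basis" "x \<bullet> i \<notin> {a \<bullet> i<..<b \<bullet> i}" by (auto simp: mem_box)
        then have "(\<Prod>i\<in>Basis. indicator {a \<bullet> i<..<b \<bullet> i} (x \<bullet> i)) = (0 :: real)"
          by (intro prod_zero bexI[of _ i]) auto
        then show ?thesis using False by simp
      qed (simp add: mem_box)
      ultimately show ?thesis by simp
    qed
    have "(\<lambda>n. LBINT x. h' x * \<phi> n x) \<longlonglongrightarrow> (LBINT x. h' x * indicator (box a b) x)"
    proof (rule integral_dominated_convergence[where w = "\<lambda>x. norm (h' x)"])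
      show "AE x in lborel. (\<lambda>n. h' x * \<phi> n x) \<longlonglongrightarrow> h' x * indicator (box a b) x"
        by (intro AE_I2 tendsto_intros lim)
      have "0 \<le> \<phi> n x \<and> \<phi> n x \<le> 1" for n x
        unfolding \<phi>_def by (intro conjI prod_nonneg prod_le_1) (simp_all add: bump_bounds)
      then show "AE x in lborel. norm (h' x * \<phi> n x) \<le> norm (h' x)" for n
        by (intro AE_I2) (simp add: abs_mult mult_left_le)
    qed (use h'_int in auto)
    then show "(LBINT x:box a b. h' x) = 0"
      unfolding test'[OF tf] set_lebesgue_integral_def
      by (simp add: LIMSEQ_const_iff mult.commute)
  qed
  from AE_completion[OF this] eq' show ?thesis by eventually_elim simp
qed

text \<open>
  One-dimensional counterpart on the half line, where \<open>z\<close> may fail to be integrable near 0; hence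
  the criterion for boxes is applied to its restrictions to intervals away from 0.
\<close>

lemma AE_eq_0_if_radial_bump_integrals_0:
  fixes z :: "real \<Rightarrow> real"
  assumes z[measurable]: "z \<in> borel_measurable borel"
    and int: "\<And>a b. 0 < a \<Longrightarrow> a < b \<Longrightarrow> set_integrable lborel {a..b} z"
    and test: "\<And>a b n. 0 < a \<Longrightarrow> a < b \<Longrightarrow> (LBINT r:{0<..}. z r * bump a b n (r\<^sup>2)) = 0"
  shows "AE r in lborel. 0 < r \<longrightarrow> z r = 0"
proof -
  have I: "(LBINT r:{a<..<b}. z r) = 0" if ab: "0 < a" "a < b" for a b
  proof -
    have "(\<lambda>n. LBINT r. indicator {0<..} r * (z r * bump (a\<^sup>2) (b\<^sup>2) n (r\<^sup>2)))
        \<longlonglongrightarrow> (LBINT r. indicator {0<..} r * (z r * indicator {a\<^sup>2<..<b\<^sup>2} (r\<^sup>2)))"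
    proof (rule integral_dominated_convergence[where w = "\<lambda>r. norm (indicator {a..b} r *\<^sub>R z r)"])
      show "(\<lambda>r. indicator {0<..} r * (z r * bump (a\<^sup>2) (b\<^sup>2) n (r\<^sup>2))) \<in> borel_measurable lborel" for n
        using borel_measurable_continuous_onI[OF C_k_continuous[OF C_k_bump[of 0 "a\<^sup>2" "b\<^sup>2" n]]]
        by measurable
      show "integrable lborel (\<lambda>r. norm (indicator {a..b} r *\<^sub>R z r))"
        using int[OF ab] unfolding set_integrable_def by (rule integrable_norm)
      show "AE r in lborel. (\<lambda>n. indicator {0<..} r * (z r * bump (a\<^sup>2) (b\<^sup>2) n (r\<^sup>2)))
          \<longlonglongrightarrow> indicator {0<..} r * (z r * indicator {a\<^sup>2<..<b\<^sup>2} (r\<^sup>2))"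
        by (intro AE_I2 tendsto_intros bump_tendsto)
      show "AE r in lborel. norm (indicator {0<..} r * (z r * bump (a\<^sup>2) (b\<^sup>2) n (r\<^sup>2)))
          \<le> norm (indicator {a..b} r *\<^sub>R z r)" (is "AE r in _. ?P r") for n
      proof (rule AE_I2)
        fix r :: real
        show "?P r"
        proof (cases "0 < r \<and> r \<in> {a..b}")
          case True
          then show ?thesis
            using bump_bounds[of "a\<^sup>2" "b\<^sup>2" n "r\<^sup>2"] by (auto simp: abs_mult intro!: mult_left_le)
        next
          case False
          then have "r \<le> 0 \<or> r\<^sup>2 \<notin> {a\<^sup>2<..<b\<^sup>2}"
            using ab power_mono_iff[of r a 2] power_mono_iff[of b r 2] by (auto simp: not_less)
          then show ?thesis by (auto simp: bump_eq_0)
        qed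
      qed
    qed measurable
    moreover have "(LBINT r. indicator {0<..} r * (z r * bump (a\<^sup>2) (b\<^sup>2) n (r\<^sup>2))) = 0" for n
      using test[of "a\<^sup>2" "b\<^sup>2" n] ab by (simp add: set_lebesgue_integral_def power_strict_mono)
    moreover have "(LBINT r. indicator {0<..} r * (z r * indicator {a\<^sup>2<..<b\<^sup>2} (r\<^sup>2)))
        = (LBINT r:{a<..<b}. z r)"
      unfolding set_lebesgue_integral_def
    proof (rule Bochner_Integration.integral_cong)
      fix r :: real
      have "r > 0 \<Longrightarrow> (a\<^sup>2 < r\<^sup>2 \<longleftrightarrow> a < r) \<and> (r\<^sup>2 < b\<^sup>2 \<longleftrightarrow> r < b)"
        using ab power_mono_iff[of r a 2] power_mono_iff[of b r 2] by (simp add: not_le[symmetric])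
      then show "indicator {0<..} r * (z r * indicator {a\<^sup>2<..<b\<^sup>2} (r\<^sup>2)) = indicator {a<..<b} r *\<^sub>R z r"
        using ab by (auto simp: indicator_def)
    qed simp
    ultimately show ?thesis by (simp add: LIMSEQ_const_iff)
  qed
  have "AE r in lborel. indicator {1 / real (Suc n)<..<real (Suc n)} r * z r = 0" for n
  proof (rule AE_eq_0_if_box_integrals_0)
    let ?a = "1 / real (Suc n)" and ?b = "real (Suc n)"
    have "set_integrable lborel {?a<..<?b} z"
    proof (rule set_integrable_subset)
      have "?a \<le> 1" by (simp add: divide_le_eq_1)
      then have "?a < ?b + 1" by (rule le_less_trans) simp
      then show "set_integrable lborel {?a..?b + 1} z" by (intro int) auto
    qed auto
    then show "integrable lborel (\<lambda>r. indicator {?a<..<?b} r * z r)"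
      by (simp add: set_integrable_def)
    fix c d :: real
    have "(LBINT r:box c d. indicator {?a<..<?b} r * z r) = (LBINT r:{max c ?a<..<min d ?b}. z r)"
      unfolding set_lebesgue_integral_def
      by (rule Bochner_Integration.integral_cong) (auto simp: indicator_def box_real)
    also have "\<dots> = 0"
    proof (cases "max c ?a < min d ?b")
      case True
      moreover have "0 < max c ?a" by (simp add: less_max_iff_disj)
      ultimately show ?thesis by (intro I)
    next
      case False
      then have "{max c ?a<..<min d ?b} = {}" by (simp only: greaterThanLessThan_empty_iff not_less)
      then show ?thesis by (simp add: set_lebesgue_integral_def)
    qed
    finally show "(LBINT r:box c d. indicator {?a<..<?b} r * z r) = 0" .
  qed
  then have "AE r in lborel. \<forall>n. indicator {1 / real (Suc n)<..<real (Suc n)} r * z r = 0"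
    by (subst AE_all_countable) blast
  then show ?thesis
  proof eventually_elim
    case (elim r)
    show ?case
    proof
      assume r: "0 < r"
      obtain n1 n2 :: nat where n: "1 / r < real n1" "r < real n2" using reals_Archimedean2 by metis
      define n where "n = n1 + n2"
      have "1 / r < real (Suc n)" "r < real (Suc n)" using n by (auto simp: n_def)
      then have "r \<in> {1 / real (Suc n)<..<real (Suc n)}" using r by (simp add: divide_less_eq mult.commute)
      then show "z r = 0" using elim by (auto simp: indicator_def split: if_splits)
    qed
  qed
qed

section \<open>Polar coordinates and spherical averages\<close>

abbreviation sphere_area :: "'a::euclidean_space itself \<Rightarrow> real" where
  "sphere_area _ \<equiv> real (DIM('a)) * unit_ball_vol (real DIM('a))"

text \<open>
  Both sides give the volume of a ball to every half line \<open>(-\<infinity>, a]\<close>. Polar coordinates are only needed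
  for functions of the norm, and for these the image measure says everything.
\<close>

lemma distr_norm_lborel:
  "distr lborel borel (norm :: 'a::euclidean_space \<Rightarrow> real)
    = density lborel (\<lambda>r. ennreal (indicator {0<..} r * (sphere_area TYPE('a) * r ^ (DIM('a) - 1))))"
    (is "?L = ?R")
proof (rule measure_eqI_generator_eq[where E = "range (\<lambda>a::real. {..a})" and \<Omega> = UNIV
      and A = "\<lambda>n. {..real n}"])
  let ?w = "\<lambda>r. sphere_area TYPE('a) * r ^ (DIM('a) - 1)"
  have w0: "0 \<le> ?w r" if "0 \<le> r" for r using that by simp
  have val: "emeasure ?L {..a} = ennreal (unit_ball_vol (real DIM('a)) * max 0 a ^ DIM('a))" for a
  proof -
    have "emeasure ?L {..a} = emeasure lborel {x::'a. norm x \<le> a}"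
      by (subst emeasure_distr) (auto intro!: arg_cong2[where f = emeasure])
    also have "\<dots> = ennreal (unit_ball_vol (real DIM('a)) * max 0 a ^ DIM('a))"
    proof (cases "0 \<le> a")
      case True
      have "{x::'a. norm x \<le> a} = cball 0 a" by auto
      then show ?thesis using emeasure_cball[OF True, of "0::'a"] True by simp
    next
      case False
      then have "{x::'a. norm x \<le> a} = {}" by (auto simp: not_le intro: less_le_trans[OF _ norm_ge_zero])
      then show ?thesis using False by simp
    qed
    finally show ?thesis .
  qed
  show "emeasure ?L X = emeasure ?R X" if "X \<in> range (\<lambda>a::real. {..a})" for X
  proof -
    obtain a where X: "X = {..a}" using \<open>X \<in> _\<close> by auto
    have "emeasure ?R {..a} = (\<integral>\<^sup>+r. ennreal (?w r) * indicator {0..max 0 a} r \<partial>lborel)"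
    proof (subst emeasure_density)
      show "(\<integral>\<^sup>+r. ennreal (indicator {0<..} r * ?w r) * indicator {..a} r \<partial>lborel)
          = (\<integral>\<^sup>+r. ennreal (?w r) * indicator {0..max 0 a} r \<partial>lborel)"
        by (rule nn_integral_cong_AE, rule AE_mp[OF AE_lborel_singleton[of 0]])
          (auto simp: indicator_def)
    qed auto
    also have "\<dots> = ennreal (unit_ball_vol (real DIM('a)) * max 0 a ^ DIM('a) - unit_ball_vol (real DIM('a)) * 0 ^ DIM('a))"
      by (rule nn_integral_FTC_Icc) (auto intro!: derivative_eq_intros)
    finally show ?thesis unfolding X val by simp
  qed
  show "Int_stable (range (\<lambda>a::real. {..a}))"
    by (auto simp: Int_stable_def)
  show "sets ?L = sigma_sets UNIV (range (\<lambda>a::real. {..a}))"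
    "sets ?R = sigma_sets UNIV (range (\<lambda>a::real. {..a}))"
    by (simp_all add: borel_eq_atMost)
  show "(\<Union>n. {..real n}) = UNIV" by (auto intro: real_arch_simple)
  show "emeasure ?L {..real n} \<noteq> \<infinity>" for n by (simp add: val)
qed auto

lemma polar_integrable:
  fixes f :: "real \<Rightarrow> real"
  assumes [measurable]: "f \<in> borel_measurable borel"
  shows "integrable lebesgue (\<lambda>x::'a::euclidean_space. f (norm x))
    \<longleftrightarrow> set_integrable lborel {0<..} (\<lambda>r. r ^ (DIM('a) - 1) * f r)"
proof -
  have "integrable lebesgue (\<lambda>x::'a. f (norm x)) \<longleftrightarrow> integrable lborel (\<lambda>x::'a. f (norm x))"
    by (rule integrable_completion) measurable
  also have "\<dots> \<longleftrightarrow> integrable (distr lborel borel (norm :: 'a \<Rightarrow> real)) f"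
    by (simp add: integrable_distr_eq)
  also have "\<dots> \<longleftrightarrow> integrable lborel (\<lambda>r. (indicator {0<..} r * (sphere_area TYPE('a) * r ^ (DIM('a) - 1))) *\<^sub>R f r)"
    unfolding distr_norm_lborel by (rule integrable_density) (auto simp: indicator_def)
  also have "\<dots> \<longleftrightarrow> integrable lborel (\<lambda>r. sphere_area TYPE('a) * (indicator {0<..} r *\<^sub>R (r ^ (DIM('a) - 1) * f r)))"
    by (rule arg_cong[where f = "integrable lborel"]) (auto simp: mult_ac)
  also have "\<dots> \<longleftrightarrow> set_integrable lborel {0<..} (\<lambda>r. r ^ (DIM('a) - 1) * f r)"
    unfolding set_integrable_def using less_imp_neq[OF unit_ball_vol_pos[of "real DIM('a)"]]
    by (subst integrable_mult_left_iff) auto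
  finally show ?thesis .
qed

lemma polar_integral:
  fixes f :: "real \<Rightarrow> real"
  assumes [measurable]: "f \<in> borel_measurable borel"
  shows "(LINT x|lebesgue. f (norm (x::'a::euclidean_space)))
    = sphere_area TYPE('a) * (LBINT r:{0<..}. r ^ (DIM('a) - 1) * f r)"
proof -
  have "(LINT x|lebesgue. f (norm (x::'a))) = (LBINT x. f (norm (x::'a)))"
    by (rule integral_completion) measurable
  also have "\<dots> = (LINT r|distr lborel borel (norm :: 'a \<Rightarrow> real). f r)"
    by (simp add: integral_distr)
  also have "\<dots> = (LBINT r. (indicator {0<..} r * (sphere_area TYPE('a) * r ^ (DIM('a) - 1))) *\<^sub>R f r)"
    unfolding distr_norm_lborel by (rule integral_density) (auto simp: indicator_def)
  also have "\<dots> = (LBINT r. sphere_area TYPE('a) * (indicator {0<..} r *\<^sub>R (r ^ (DIM('a) - 1) * f r)))"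
    by (rule Bochner_Integration.integral_cong) (auto simp: mult_ac)
  finally show ?thesis by (simp add: set_lebesgue_integral_def)
qed

lemma polar_AE:
  assumes [measurable]: "Measurable.pred borel P"
  shows "(AE x in lebesgue. P (norm (x::'a::euclidean_space))) \<longleftrightarrow> (AE r in lborel. 0 < r \<longrightarrow> P r)"
proof -
  have "(AE x in lebesgue. P (norm (x::'a))) \<longleftrightarrow> (AE x in lborel. P (norm (x::'a)))"
    by (rule AE_completion_iff)
  also have "\<dots> \<longleftrightarrow> (AE r in distr lborel borel (norm :: 'a \<Rightarrow> real). P r)"
    by (subst AE_distr_iff) auto
  also have "\<dots> \<longleftrightarrow> (AE r in lborel. 0 < r \<longrightarrow> P r)"
    unfolding distr_norm_lborel
    by (subst AE_density) (auto simp: indicator_def zero_less_mult_iff unit_ball_vol_pos intro!: AE_cong)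
  finally show ?thesis .
qed

text \<open>
  The average is the conditional expectation of \<open>h\<close> given the norm. Lebesgue measure is sigma-finite
  on the algebra generated by the norm, since that algebra contains all balls around 0; and a function that
  is measurable for this algebra is constant on spheres, so it can be read off along one ray.
\<close>

lemma radial_average_exists:
  fixes h :: "'a::euclidean_space \<Rightarrow> real"
  assumes h: "h \<in> borel_measurable lebesgue"
  obtains v where "v \<in> borel_measurable borel"
    and "\<And>k. k \<in> borel_measurable borel \<Longrightarrow> integrable lebesgue (\<lambda>x. k (norm x) * h x) \<Longrightarrow>
        integrable lebesgue (\<lambda>x::'a. k (norm x) * v (norm x))"
    and "\<And>k. k \<in> borel_measurable borel \<Longrightarrow> integrable lebesgue (\<lambda>x. k (norm x) * h x) \<Longrightarrow>
        (LINT x|lebesgue. k (norm x) * v (norm (x::'a))) = (LINT x|lebesgue. k (norm x) * h x)"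
proof -
  define F where "F = vimage_algebra UNIV (norm :: 'a \<Rightarrow> real) borel"
  have sF: "sets F = {norm -` A | A. A \<in> sets borel}"
    unfolding F_def by (subst sets_vimage_algebra2) auto
  have sub: "subalgebra lebesgue F"
    unfolding subalgebra_def
  proof (intro conjI subsetI)
    fix X assume "X \<in> sets F"
    then obtain A where A: "A \<in> sets borel" "X = norm -` A" unfolding sF by auto
    have "norm -` A \<inter> space (borel::'a measure) \<in> sets borel"
      by (rule measurable_sets[OF _ A(1)]) measurable
    then show "X \<in> sets lebesgue" using A(2) by (auto intro: sets_completionI_sets)
  qed (simp add: F_def)
  have "sigma_finite_subalgebra lebesgue F"
  proof (rule sigma_finite_subalgebra.intro[OF sub], rule sigma_finite_measure.intro)
    show "\<exists>A. countable A \<and> A \<subseteq> sets (restr_to_subalg lebesgue F) \<and> \<Union> A = space (restr_to_subalg lebesgue F)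
        \<and> (\<forall>a\<in>A. emeasure (restr_to_subalg lebesgue F) a \<noteq> \<infinity>)"
    proof (intro exI conjI ballI)
      show "countable (range (\<lambda>n::nat. (norm :: 'a \<Rightarrow> real) -` {..real n}))" by simp
      have mem: "(norm :: 'a \<Rightarrow> real) -` {..real n} \<in> sets F" for n
        unfolding sF by (intro CollectI exI[of _ "{..real n}"]) simp
      then show "range (\<lambda>n::nat. (norm :: 'a \<Rightarrow> real) -` {..real n}) \<subseteq> sets (restr_to_subalg lebesgue F)"
        by (auto simp: sets_restr_to_subalg[OF sub])
      show "\<Union> (range (\<lambda>n::nat. (norm :: 'a \<Rightarrow> real) -` {..real n})) = space (restr_to_subalg lebesgue F)"
        by (auto simp: space_restr_to_subalg intro: real_arch_simple)
      fix a assume "a \<in> range (\<lambda>n::nat. (norm :: 'a \<Rightarrow> real) -` {..real n})"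
      then obtain n where a: "a = (norm :: 'a \<Rightarrow> real) -` {..real n}" by auto
      have "emeasure (restr_to_subalg lebesgue F) a = emeasure lebesgue a"
        unfolding a by (rule emeasure_restr_to_subalg[OF sub mem])
      moreover have eq: "a = cball 0 (real n)" unfolding a by auto
      have "emeasure lebesgue a \<noteq> \<infinity>" unfolding eq by (simp add: emeasure_cball)
      ultimately show "emeasure (restr_to_subalg lebesgue F) a \<noteq> \<infinity>" by simp
    qed
  qed
  then interpret sigma_finite_subalgebra lebesgue F .
  define ce where "ce = real_cond_exp lebesgue F h"
  have ce_meas: "ce \<in> borel_measurable F" unfolding ce_def by simp
  obtain e :: 'a where e: "norm e = 1" using norm_Basis nonempty_Basis by (metis ex_in_conv)
  define v where "v r = ce (r *\<^sub>R e)" for r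
  have "(\<lambda>r. r *\<^sub>R e) \<in> measurable borel F"
    unfolding F_def by (rule measurable_vimage_algebra2) auto
  then have v_meas: "v \<in> borel_measurable borel"
    unfolding v_def[abs_def] using ce_meas by (rule measurable_compose)
  have v_ce: "v (norm x) = ce x" for x
  proof -
    have "ce -` {ce x} \<inter> space F \<in> sets F" by (rule measurable_sets[OF ce_meas]) simp
    then obtain A where A: "A \<in> sets borel" "ce -` {ce x} = norm -` A"
      unfolding sF by (auto simp: F_def)
    then have "norm x \<in> A" by auto
    then have "norm x *\<^sub>R e \<in> norm -` A" using e by simp
    then show ?thesis unfolding A(2)[symmetric] v_def by simp
  qed
  show thesis
  proof
    show "v \<in> borel_measurable borel" by (rule v_meas)
    fix k :: "real \<Rightarrow> real"
    assume k: "k \<in> borel_measurable borel" and int: "integrable lebesgue (\<lambda>x. k (norm x) * h x)"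
    have "(norm :: 'a \<Rightarrow> real) \<in> borel_measurable F"
      unfolding F_def by (rule measurable_vimage_algebra1) auto
    then have k': "(\<lambda>x::'a. k (norm x)) \<in> borel_measurable F" using k by (rule measurable_compose)
    show "integrable lebesgue (\<lambda>x::'a. k (norm x) * v (norm x))"
      unfolding v_ce unfolding ce_def by (rule real_cond_exp_intg(1)[OF int k' h])
    show "(LINT x|lebesgue. k (norm x) * v (norm (x::'a))) = (LINT x|lebesgue. k (norm x) * h x)"
      unfolding v_ce unfolding ce_def by (rule real_cond_exp_intg(2)[OF int k' h])
  qed
qed

text \<open>
  The profile of a radial function need not be measurable a priori. By inner regularity each sublevel
  set is, up to a null set, a countable union of compact subsets; the image of this union under the norm is
  Borel and still lies in the corresponding sublevel set of the profile. The profile is recovered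
  from these images for countably many levels.
\<close>

lemma radial_borel_representative:
  fixes u :: "'a::euclidean_space \<Rightarrow> real"
  assumes u: "u \<in> borel_measurable lebesgue" and rad: "radial u"
  obtains g where "g \<in> borel_measurable borel" "AE x in lebesgue. u x = g (norm x)"
proof -
  obtain g where g: "AE x in lebesgue. u x = g (norm x)" using rad by (auto simp: radial_def)
  have meas: "(\<lambda>x::'a. g (norm x)) \<in> borel_measurable lebesgue"
    by (rule Equivalence_Measurable_On_Borel.borel_measurable_AE[OF u g])
  have "\<exists>B. B \<in> sets borel \<and> (\<forall>r\<in>B. g r \<le> c) \<and> (AE x::'a in lebesgue. g (norm x) \<le> c \<longrightarrow> norm x \<in> B)" for c
  proof -
    have "{x::'a. g (norm x) \<le> c} \<in> sets lebesgue"
      using borel_measurable_le[OF meas borel_measurable_const[of c]] by simp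
    then obtain C T where CT: "fsigma C" "T \<in> null_sets lebesgue" "C \<union> T = {x::'a. g (norm x) \<le> c}"
      by (rule lebesgue_set_almost_fsigma)
    obtain K :: "nat \<Rightarrow> 'a set" where K: "range K \<subseteq> Collect compact" "C = \<Union> (range K)"
      using CT(1) fsigma_Union_compact by metis
    define B where "B = (\<Union>n. norm ` K n)"
    have "compact (norm ` K n)" for n
      using K(1) by (intro compact_continuous_image continuous_intros) auto
    then have "B \<in> sets borel" unfolding B_def by (intro sets.countable_UN) (auto intro: borel_compact)
    moreover have "\<forall>r\<in>B. g r \<le> c" using CT(3) K(2) unfolding B_def by auto
    moreover have "AE x::'a in lebesgue. g (norm x) \<le> c \<longrightarrow> norm x \<in> B"
    proof (rule AE_I'[OF CT(2)])
      show "{x \<in> space lebesgue. \<not> (g (norm x) \<le> c \<longrightarrow> norm x \<in> B)} \<subseteq> T"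
        using CT(3) K(2) unfolding B_def by auto
    qed
    ultimately show ?thesis by blast
  qed
  then obtain B where B: "\<And>c. B c \<in> sets borel" "\<And>c r. r \<in> B c \<Longrightarrow> g r \<le> c"
      "\<And>c. AE x::'a in lebesgue. g (norm x) \<le> c \<longrightarrow> norm x \<in> B c" by metis
  \<comment> \<open>The infimum of the levels \<open>c\<close> with \<open>r \<in> B c\<close>; the other levels contribute infinity.\<close>
  define k where "k r = (INF c::rat. if r \<in> B (of_rat c) then ereal (of_rat c) else \<infinity>)" for r
  have [measurable]: "Measurable.pred borel (\<lambda>r. r \<in> B c)" for c using B(1)[of c] by measurable
  have k_meas: "k \<in> borel_measurable borel"
    unfolding k_def[abs_def] by measurable
  have "AE x::'a in lebesgue. \<forall>c::rat. g (norm x) \<le> of_rat c \<longrightarrow> norm x \<in> B (of_rat c)"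
    by (subst AE_all_countable) (intro allI B(3))
  then have "AE x::'a in lebesgue. g (norm x) = real_of_ereal (k (norm x))"
  proof eventually_elim
    case (elim x)
    have "k (norm x) = ereal (g (norm x))"
    proof (rule antisym)
      show "ereal (g (norm x)) \<le> k (norm x)"
        unfolding k_def by (rule INF_greatest) (auto dest: B(2))
      show "k (norm x) \<le> ereal (g (norm x))"
      proof (rule ereal_le_epsilon2)
        fix e :: real assume "0 < e"
        then obtain c :: rat where c: "g (norm x) < of_rat c" "of_rat c < g (norm x) + e"
          using of_rat_dense[of "g (norm x)" "g (norm x) + e"] by auto
        then have "norm x \<in> B (of_rat c)" using elim by auto
        then have "k (norm x) \<le> ereal (of_rat c)"
          unfolding k_def by (intro INF_lower2[of c]) auto
        also have "\<dots> \<le> ereal (g (norm x)) + ereal e" using c by simp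
        finally show "k (norm x) \<le> ereal (g (norm x)) + ereal e" .
      qed
    qed
    then show ?case by simp
  qed
  with g have "AE x in lebesgue. u x = real_of_ereal (k (norm x))"
    by eventually_elim simp
  then show thesis using that[of "\<lambda>r. real_of_ereal (k r)"] k_meas by measurable
qed

lemma polar_integral_AE:
  fixes h :: "'a::euclidean_space \<Rightarrow> real"
  assumes h: "integrable lebesgue h" and hk: "AE x in lebesgue. h x = k (norm x)"
    and k: "k \<in> borel_measurable borel"
  shows "set_integrable lborel {0<..} (\<lambda>r. r ^ (DIM('a) - 1) * k r)"
    and "(LINT x|lebesgue. h x) = sphere_area TYPE('a) * (LBINT r:{0<..}. r ^ (DIM('a) - 1) * k r)"
proof -
  have mk: "(\<lambda>x::'a. k (norm x)) \<in> borel_measurable lebesgue"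
    by (rule measurable_completion) (use k in measurable)
  note mh = borel_measurable_integrable[OF h]
  have "integrable lebesgue (\<lambda>x::'a. k (norm x))" using h integrable_cong_AE[OF mh mk hk] by simp
  then show "set_integrable lborel {0<..} (\<lambda>r. r ^ (DIM('a) - 1) * k r)" using polar_integrable[OF k] by blast
  show "(LINT x|lebesgue. h x) = sphere_area TYPE('a) * (LBINT r:{0<..}. r ^ (DIM('a) - 1) * k r)"
    using integral_cong_AE[OF mh mk hk] polar_integral[OF k, where 'a = 'a] by simp
qed

lemma AE_norm_pos: "AE x::'a::euclidean_space in lebesgue. 0 < norm x"
  using polar_AE[of "\<lambda>r. 0 < r", where 'a = 'a] by simp

section \<open>Integration by parts against radial functions\<close>

text \<open>
  Difference quotients of \<open>\<psi>\<close> have integral 0 by translation invariance, and the Lipschitz bound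
  allows dominated convergence. Differentiability is only required almost everywhere, so that
  \<open>\<psi>\<close> may have kinks along spheres.
\<close>

lemma integral_directional_derivative_eq_0:
  fixes \<psi> d :: "'a::euclidean_space \<Rightarrow> real"
  assumes lip: "\<And>x y. \<bar>\<psi> x - \<psi> y\<bar> \<le> L * norm (x - y)"
    and supp: "\<And>x. norm x > R \<Longrightarrow> \<psi> x = 0"
    and deriv: "AE x in lborel. ((\<lambda>t. (\<psi> (x + t *\<^sub>R b) - \<psi> x) / t) \<longlongrightarrow> d x) (at 0)"
    and d: "d \<in> borel_measurable borel"
  shows "(LBINT x. d x) = 0"
proof -
  have L: "L \<ge> 0"
    using lip[of 0 "SOME i. i \<in> Basis"] by (auto simp: norm_Basis some_in_eq[THEN iffD2])
  have cont: "continuous_on UNIV \<psi>"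
  proof (rule continuous_onI)
    fix x :: 'a and e :: real assume e: "0 < e"
    show "\<exists>d>0. \<forall>x'\<in>UNIV. dist x' x < d \<longrightarrow> dist (\<psi> x') (\<psi> x) \<le> e"
    proof (intro exI[of _ "e / (L + 1)"] conjI ballI impI)
      fix x' assume "dist x' x < e / (L + 1)"
      then have "(L + 1) * norm (x' - x) \<le> e" using L by (simp add: field_simps dist_norm)
      moreover have "L * norm (x' - x) \<le> (L + 1) * norm (x' - x)" by (simp add: algebra_simps)
      ultimately show "dist (\<psi> x') (\<psi> x) \<le> e" using lip[of x' x] by (simp add: dist_real_def)
    qed (use e L in simp)
  qed
  then have m[measurable]: "\<psi> \<in> borel_measurable borel" by (rule borel_measurable_continuous_onI)
  have bd: "\<bar>\<psi> x\<bar> \<le> L * (2 * \<bar>R\<bar> + 2) * indicator (cball 0 \<bar>R\<bar>) x" for x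
  proof (cases "norm x > R")
    case True
    then show ?thesis using supp[OF True] L by simp
  next
    case False
    obtain i :: 'a where i: "norm i = 1" using norm_Basis nonempty_Basis by (metis ex_in_conv)
    have "\<psi> ((\<bar>R\<bar> + 1) *\<^sub>R i) = 0" using i by (intro supp) simp
    then have "\<bar>\<psi> x\<bar> \<le> L * norm (x - (\<bar>R\<bar> + 1) *\<^sub>R i)" using lip[of x "(\<bar>R\<bar> + 1) *\<^sub>R i"] by simp
    also have "\<dots> \<le> L * (norm x + norm ((\<bar>R\<bar> + 1) *\<^sub>R i))" using L by (intro mult_left_mono norm_triangle_ineq4)
    also have "\<dots> \<le> L * (2 * \<bar>R\<bar> + 2)" using False i L by (intro mult_left_mono) auto
    finally show ?thesis using False by (auto simp: indicator_def)
  qed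
  have int: "integrable lborel \<psi>"
  proof (rule integrable_pointwise_bound[where f = "\<lambda>x. L * (2 * \<bar>R\<bar> + 2) * indicator (cball 0 \<bar>R\<bar>) x"])
    show "integrable lborel (\<lambda>x::'a. L * (2 * \<bar>R\<bar> + 2) * indicator (cball 0 \<bar>R\<bar>) x)"
      by (intro integrable_mult_right) (auto simp: emeasure_cball integrable_indicator_iff)
    show "norm (\<psi> x) \<le> norm (L * (2 * \<bar>R\<bar> + 2) * indicator (cball 0 \<bar>R\<bar>) x)" for x
      using order_trans[OF bd[of x] abs_ge_self] by (simp only: real_norm_def)
  qed simp
  define t where "t n = 1 / real (Suc n)" for n
  have t: "t n > 0" "t n \<le> 1" for n by (auto simp: t_def)
  have lim_t: "filterlim t (at 0) sequentially"
    unfolding filterlim_at using LIMSEQ_inverse_real_of_nat t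
    by (auto simp: t_def[abs_def] inverse_eq_divide less_imp_neq[symmetric])
  have z: "(LBINT x. (\<psi> (x + c) - \<psi> x) / s) = 0" for c s
  proof -
    have "integrable lborel (\<lambda>x. \<psi> (c + x))"
      using int integrable_distr_eq[of "(+) c" lborel borel \<psi>] by (simp add: lborel_distr_plus)
    moreover have "(LBINT x. \<psi> (c + x)) = (LBINT x. \<psi> x)"
      using integral_distr[of "(+) c" lborel borel \<psi>] by (simp add: lborel_distr_plus)
    ultimately show ?thesis using int by (simp add: add.commute)
  qed
  have "(\<lambda>n. LBINT x. (\<psi> (x + t n *\<^sub>R b) - \<psi> x) / t n) \<longlonglongrightarrow> (LBINT x. d x)"
  proof (rule integral_dominated_convergence[where w = "\<lambda>x. L * norm b * indicator (cball 0 (\<bar>R\<bar> + norm b)) x"])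
    show "integrable lborel (\<lambda>x::'a. L * norm b * indicator (cball 0 (\<bar>R\<bar> + norm b)) x)"
      by (intro integrable_mult_right) (auto simp: emeasure_cball integrable_indicator_iff)
    show "AE x in lborel. (\<lambda>n. (\<psi> (x + t n *\<^sub>R b) - \<psi> x) / t n) \<longlonglongrightarrow> d x"
      using deriv
    proof eventually_elim
      case (elim x)
      from filterlim_compose[OF this lim_t] show ?case .
    qed
    show "AE x in lborel. norm ((\<psi> (x + t n *\<^sub>R b) - \<psi> x) / t n) \<le> L * norm b * indicator (cball 0 (\<bar>R\<bar> + norm b)) x" for n
    proof (rule AE_I2)
      fix x
      have tb: "norm (t n *\<^sub>R b) \<le> norm b" using t[of n] by (simp add: mult_left_le_one_le)
      show "norm ((\<psi> (x + t n *\<^sub>R b) - \<psi> x) / t n) \<le> L * norm b * indicator (cball 0 (\<bar>R\<bar> + norm b)) x"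
      proof (cases "norm x \<le> \<bar>R\<bar> + norm b")
        case True
        have "\<bar>\<psi> (x + t n *\<^sub>R b) - \<psi> x\<bar> \<le> L * (t n * norm b)"
          using lip[of "x + t n *\<^sub>R b" x] t[of n] by simp
        then show ?thesis using True t[of n] by (simp add: field_simps)
      next
        case False
        have "norm x \<le> norm (x + t n *\<^sub>R b) + norm (t n *\<^sub>R b)" by (metis add_diff_cancel_right' norm_triangle_ineq4)
        then have "norm (x + t n *\<^sub>R b) > R" "norm x > R" using False tb norm_ge_zero[of b] by linarith+
        then show ?thesis using supp False by simp
      qed
    qed
  qed (use d in measurable)
  then show ?thesis unfolding z by (simp add: LIMSEQ_const_iff)
qed

text \<open>
  Fubini on the set of pairs with \<open>norm x \<le> s\<close>: the inner integral on the right runs over a ball.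
\<close>

lemma radial_layer_cake:
  fixes D :: "'a::euclidean_space \<Rightarrow> real" and V :: "real \<Rightarrow> real"
  assumes D: "integrable lborel D" and V: "integrable lborel V"
  shows "integrable lborel (\<lambda>x. (LBINT s. indicator {norm x..} s * V s) * D x)"
    and "integrable lborel (\<lambda>s. V s * (LBINT x. indicator {norm x..} s * D x))"
    and "(LBINT x. (LBINT s. indicator {norm x..} s * V s) * D x)
      = (LBINT s. V s * (LBINT x. indicator {norm x..} s * D x))"
proof -
  have [measurable]: "D \<in> borel_measurable borel" "V \<in> borel_measurable borel" using D V by auto
  have [measurable]: "Measurable.pred (lborel \<Otimes>\<^sub>M lborel) (\<lambda>y::'a \<times> real. snd y \<in> {norm (fst y)..})"
    unfolding atLeast_iff by measurable
  have prod: "integrable (lborel \<Otimes>\<^sub>M lborel) (\<lambda>(x, s). D x * V s)"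
  proof (rule lborel_pair.Fubini_integrable)
    show "integrable lborel (\<lambda>x. LBINT s. norm (case (x, s) of (x, s) \<Rightarrow> D x * V s))"
      using D V by (simp add: abs_mult integrable_abs)
    show "AE x in lborel. integrable lborel (\<lambda>s. case (x, s) of (x, s) \<Rightarrow> D x * V s)"
      using V by simp
  qed measurable
  have f: "integrable (lborel \<Otimes>\<^sub>M lborel) (\<lambda>(x, s). indicator {norm x..} s * (D x * V s))"
  proof (rule integrable_pointwise_bound[OF prod])
    show "(\<lambda>(x, s). indicator {norm x..} s * (D x * V s)) \<in> borel_measurable (lborel \<Otimes>\<^sub>M lborel)"
      by measurable
  qed (auto simp: indicator_def)
  have e1: "(LBINT s. indicator {norm x..} s * (D x * V s)) = (LBINT s. indicator {norm x..} s * V s) * D x" for x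
    by (subst integral_mult_left_zero[symmetric]) (simp add: mult_ac)
  have e2: "(LBINT x. indicator {norm x..} s * (D x * V s)) = V s * (LBINT x. indicator {norm x..} s * D x)" for s
    by (subst integral_mult_right_zero[symmetric]) (simp add: mult_ac)
  show "integrable lborel (\<lambda>x. (LBINT s. indicator {norm x..} s * V s) * D x)"
    using lborel_pair.integrable_fst[OF f] by (simp add: e1)
  show "integrable lborel (\<lambda>s. V s * (LBINT x. indicator {norm x..} s * D x))"
    using lborel_pair.integrable_snd[OF f] by (simp add: e2)
  show "(LBINT x. (LBINT s. indicator {norm x..} s * V s) * D x)
      = (LBINT s. V s * (LBINT x. indicator {norm x..} s * D x))"
    using lborel_pair.Fubini_integral[OF f] by (simp add: e1 e2)
qed

text \<open>
  The divergence theorem in the shell between the radii \<open>a\<close> and \<open>c\<close>, obtained by integrating the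
  derivative of \<open>\<phi>\<close> times a piecewise linear function of the norm.
\<close>

lemma integral_radial_ramp:
  fixes \<phi> :: "'a::euclidean_space \<Rightarrow> real"
  assumes tf: "test_function \<phi>" and b: "b \<in> Basis" and ab: "0 < a" "a < c"
  shows "(LBINT x. (c - max a (min (norm x) c)) * (grad \<phi> x \<bullet> b))
    = (LBINT x. indicator {a<..<c} (norm x) * ((x \<bullet> b) / norm x * \<phi> x))"
proof -
  define \<Lambda> where "\<Lambda> r = c - max a (min r c)" for r
  obtain R where R: "0 < R" "\<And>x. norm x > R \<Longrightarrow> \<phi> x = 0" using test_function_support[OF tf] by blast
  obtain L where L: "0 \<le> L" "\<And>x y. \<bar>\<phi> x - \<phi> y\<bar> \<le> L * norm (x - y)" using test_function_lipschitz[OF tf] by blast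
  obtain M where M: "0 \<le> M" "\<And>x. \<bar>\<phi> x\<bar> \<le> M"
    using bounded_if_compact_support[OF C_k_continuous[OF test_function_C_k[OF tf, of 0]] R(2)] by blast
  have [measurable]: "\<phi> \<in> borel_measurable borel" by (rule test_function_borel[OF tf])
  have [measurable]: "(\<lambda>x. grad \<phi> x \<bullet> b) \<in> borel_measurable borel"
    by (rule borel_measurable_continuous_onI[OF test_function_grad_continuous[OF tf b]])
  have z: "grad \<phi> x = 0" if "norm x > R" for x
    by (rule grad_eq_0_if_locally_0[OF tf, of "- cball 0 R"]) (use R that in auto)
  have \<Lambda>_bd: "0 \<le> \<Lambda> r" "\<Lambda> r \<le> c" for r using ab by (auto simp: \<Lambda>_def)
  have \<Lambda>_lip: "\<bar>\<Lambda> r - \<Lambda> s\<bar> \<le> \<bar>r - s\<bar>" for r s using ab by (auto simp: \<Lambda>_def max_def min_def)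
  have \<Lambda>_deriv: "(\<Lambda> has_real_derivative - indicator {a<..<c} r) (at r)" if r: "r \<noteq> a" "r \<noteq> c" for r
  proof -
    consider "r < a" | "a < r" "r < c" | "c < r" using r by linarith
    then show ?thesis
    proof cases
      case 1
      then have "((\<lambda>_. c - a) has_real_derivative - indicator {a<..<c} r) (at r)" by simp
      then show ?thesis
        by (rule has_field_derivative_transform_within_open[of _ _ _ "{..<a}"]) (use 1 ab in \<open>auto simp: \<Lambda>_def\<close>)
    next
      case 2
      then have "((\<lambda>r. c - r) has_real_derivative - indicator {a<..<c} r) (at r)"
        by (auto intro!: derivative_eq_intros)
      then show ?thesis
        by (rule has_field_derivative_transform_within_open[of _ _ _ "{a<..<c}"]) (use 2 in \<open>auto simp: \<Lambda>_def\<close>)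
    next
      case 3
      then have "((\<lambda>_. 0) has_real_derivative - indicator {a<..<c} r) (at r)" by simp
      then show ?thesis
        by (rule has_field_derivative_transform_within_open[of _ _ _ "{c<..}"]) (use 3 ab in \<open>auto simp: \<Lambda>_def\<close>)
    qed
  qed
  let ?d = "\<lambda>x. \<Lambda> (norm x) * (grad \<phi> x \<bullet> b) - indicator {a<..<c} (norm x) * ((x \<bullet> b) / norm x * \<phi> x)"
  have [measurable]: "\<Lambda> \<in> borel_measurable borel" unfolding \<Lambda>_def[abs_def] by measurable
  have "(LBINT x. ?d x) = 0"
  proof (rule integral_directional_derivative_eq_0[where \<psi> = "\<lambda>x. \<phi> x * \<Lambda> (norm x)" and R = R and L = "L * c + M" and b = b])
    show "\<bar>\<phi> x * \<Lambda> (norm x) - \<phi> y * \<Lambda> (norm y)\<bar> \<le> (L * c + M) * norm (x - y)" for x y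
    proof -
      have "\<phi> x * \<Lambda> (norm x) - \<phi> y * \<Lambda> (norm y) = (\<phi> x - \<phi> y) * \<Lambda> (norm x) + \<phi> y * (\<Lambda> (norm x) - \<Lambda> (norm y))"
        by (simp add: algebra_simps)
      also have "\<bar>\<dots>\<bar> \<le> \<bar>\<phi> x - \<phi> y\<bar> * \<bar>\<Lambda> (norm x)\<bar> + \<bar>\<phi> y\<bar> * \<bar>\<Lambda> (norm x) - \<Lambda> (norm y)\<bar>"
        by (rule order_trans[OF abs_triangle_ineq]) (simp add: abs_mult)
      also have "\<dots> \<le> (L * norm (x - y)) * c + M * norm (x - y)"
        using L M \<Lambda>_bd order_trans[OF \<Lambda>_lip norm_triangle_ineq3, of x y]
        by (intro add_mono mult_mono) auto
      finally show ?thesis by (simp add: algebra_simps)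
    qed
    show "AE x in lborel. ((\<lambda>t. (\<phi> (x + t *\<^sub>R b) * \<Lambda> (norm (x + t *\<^sub>R b)) - \<phi> x * \<Lambda> (norm x)) / t) \<longlongrightarrow> ?d x) (at 0)"
    proof -
      have "AE r in lborel. 0 < r \<longrightarrow> r \<noteq> 0 \<and> r \<noteq> a \<and> r \<noteq> (c::real)"
        using AE_lborel_singleton[of 0] AE_lborel_singleton[of a] AE_lborel_singleton[of c] by eventually_elim simp
      then have "AE x in lebesgue. norm (x::'a) \<noteq> 0 \<and> norm x \<noteq> a \<and> norm x \<noteq> c"
        using polar_AE[of "\<lambda>r. r \<noteq> 0 \<and> r \<noteq> a \<and> r \<noteq> c", where 'a = 'a] by simp
      then have "AE x in lborel. norm (x::'a) \<noteq> 0 \<and> norm x \<noteq> a \<and> norm x \<noteq> c"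
        by (simp add: AE_completion_iff)
      then show ?thesis
      proof eventually_elim
        case (elim x)
        have "((\<lambda>x. \<Lambda> (norm x)) has_derivative (\<lambda>h. - indicator {a<..<c} (norm x) * (h \<bullet> sgn x))) (at x)"
          using has_derivative_compose[OF has_derivative_norm \<Lambda>_deriv[unfolded has_field_derivative_def], of x] elim by simp
        from has_derivative_imp_directional[OF has_derivative_mult[OF test_function_has_derivative[OF tf] this], of b]
        show ?case
          unfolding test_function_grad_inner[OF tf b] by (simp add: sgn_div_norm inner_commute field_simps)
      qed
    qed
  qed (use R in \<open>auto\<close>)
  moreover have "integrable lborel (\<lambda>x. \<Lambda> (norm x) * (grad \<phi> x \<bullet> b))"
  proof -
    obtain M' where M': "0 \<le> M'" "\<And>x. \<bar>grad \<phi> x \<bullet> b\<bar> \<le> M'"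
      using bounded_if_compact_support[OF test_function_grad_continuous[OF tf b], of R] z by (metis inner_zero_left)
    show ?thesis
    proof (rule integrable_compact_support[where M = "c * M'" and R = R])
      show "\<bar>\<Lambda> (norm x) * (grad \<phi> x \<bullet> b)\<bar> \<le> c * M'" for x
        unfolding abs_mult using \<Lambda>_bd M' ab by (intro mult_mono) auto
    qed (use z in auto)
  qed
  moreover have "integrable lborel (\<lambda>x. indicator {a<..<c} (norm x) * ((x \<bullet> b) / norm x * \<phi> x))"
  proof (rule integrable_compact_support[where M = M and R = R])
    show "\<bar>indicator {a<..<c} (norm x) * ((x \<bullet> b) / norm x * \<phi> x)\<bar> \<le> M" for x
    proof -
      have "\<bar>x \<bullet> b / norm x\<bar> \<le> 1" using Basis_le_norm[OF b, of x] by (auto simp: divide_le_eq_1)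
      then have "\<bar>indicator {a<..<c} (norm x)\<bar> * (\<bar>x \<bullet> b / norm x\<bar> * \<bar>\<phi> x\<bar>) \<le> 1 * (1 * M)"
        using M by (intro mult_mono) (auto simp: indicator_def)
      then show ?thesis by (simp add: abs_mult)
    qed
  qed (use R in auto)
  ultimately show ?thesis by (simp add: \<Lambda>_def)
qed

text \<open>
  For a primitive \<open>w\<close> of \<open>v\<close>, the field \<open>v(|x|) x / |x|\<close> is the weak gradient of \<open>w(|x|)\<close>. As \<open>w\<close> is
  merely absolutely continuous, the product rule is not available; instead \<open>w\<close> is written as an
  integral of \<open>v\<close>, and Fubini reduces the claim to the divergence theorem on the ball of radius \<open>s\<close>,
  for almost every \<open>s\<close>.
\<close>

lemma radial_integration_by_parts:
  fixes \<phi> :: "'a::euclidean_space \<Rightarrow> real" and v w :: "real \<Rightarrow> real"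
  assumes tf: "test_function \<phi>" and b: "b \<in> Basis" and aR: "0 < a" "a < R"
    and supp: "\<And>x. norm x \<notin> {a..R} \<Longrightarrow> \<phi> x = 0"
    and v[measurable]: "v \<in> borel_measurable borel" and vint: "set_integrable lborel {a..R} v"
    and w: "\<And>r. r \<in> {a..R} \<Longrightarrow> w r = w R - (LBINT s:{r..R}. v s)"
  shows "integrable lborel (\<lambda>x. w (norm x) * (grad \<phi> x \<bullet> b))"
    and "integrable lborel (\<lambda>x. v (norm x) * ((x \<bullet> b) / norm x * \<phi> x))"
    and "(LBINT x. w (norm x) * (grad \<phi> x \<bullet> b))
      = - (LBINT x. v (norm x) * ((x \<bullet> b) / norm x * \<phi> x))"
proof -
  define D where "D x = grad \<phi> x \<bullet> b" for x
  define \<psi> where "\<psi> x = (x \<bullet> b) / norm x * \<phi> x" for x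
  define N where "N = DIM('a) - 1"
  define c where "c = sphere_area TYPE('a)"
  have \<phi>R: "\<phi> x = 0" if "norm x > R" for x using supp[of x] that by simp
  obtain M where M: "0 \<le> M" "\<And>x. \<bar>\<phi> x\<bar> \<le> M"
    using bounded_if_compact_support[OF C_k_continuous[OF test_function_C_k[OF tf, of 0]] \<phi>R] by blast
  have [measurable]: "\<phi> \<in> borel_measurable borel" by (rule test_function_borel[OF tf])
  have [measurable]: "D \<in> borel_measurable borel" unfolding D_def[abs_def]
    by (rule borel_measurable_continuous_onI[OF test_function_grad_continuous[OF tf b]])
  have [measurable]: "\<psi> \<in> borel_measurable borel" unfolding \<psi>_def[abs_def] by measurable
  have D0: "D x = 0" if "norm x \<notin> {a..R}" for x
  proof -
    have "open (norm -` (- {a..R}) :: 'a set)"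
      by (intro open_vimage continuous_intros)
    then have "grad \<phi> x = 0"
      by (rule grad_eq_0_if_locally_0[OF tf]) (use that supp in auto)
    then show ?thesis by (simp add: D_def)
  qed
  have \<psi>_bd: "\<bar>\<psi> x\<bar> \<le> M * indicator {a..R} (norm x)" for x
  proof (cases "norm x \<in> {a..R}")
    case True
    have "\<bar>x \<bullet> b / norm x\<bar> \<le> 1" using Basis_le_norm[OF b, of x] by (auto simp: divide_le_eq_1)
    then have "\<bar>x \<bullet> b / norm x\<bar> * \<bar>\<phi> x\<bar> \<le> 1 * M" using M by (intro mult_mono) auto
    then show ?thesis using True by (simp add: \<psi>_def abs_mult)
  qed (simp add: \<psi>_def supp)
  obtain M' where M': "0 \<le> M'" "\<And>x. \<bar>D x\<bar> \<le> M'"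
    using bounded_if_compact_support[OF test_function_grad_continuous[OF tf b], of R] D0
    unfolding D_def by (metis atLeastAtMost_iff not_less)
  have intD: "integrable lborel D"
    by (rule integrable_compact_support[where M = M' and R = R]) (use M' D0 in auto)
  have intD0: "(LBINT x. D x) = 0"
  proof -
    obtain L where L: "0 \<le> L" "\<And>x y. \<bar>\<phi> x - \<phi> y\<bar> \<le> L * norm (x - y)" using test_function_lipschitz[OF tf] by blast
    show ?thesis
    proof (rule integral_directional_derivative_eq_0[OF L(2) \<phi>R])
      show "AE x in lborel. ((\<lambda>t. (\<phi> (x + t *\<^sub>R b) - \<phi> x) / t) \<longlongrightarrow> D x) (at 0)"
        unfolding D_def test_function_grad_inner[OF tf b]
        by (intro AE_I2 has_derivative_imp_directional test_function_has_derivative[OF tf])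
    qed simp_all
  qed
  define V where "V s = indicator {a..R} s * v s" for s
  have [measurable]: "V \<in> borel_measurable borel" unfolding V_def[abs_def] by measurable
  have V: "integrable lborel V" using vint by (simp add: V_def[abs_def] set_integrable_def)
  define \<Phi> where "\<Phi> s = (LBINT x. indicator {norm x..} s * D x)" for s
  have W: "(LBINT s. indicator {norm x..} s * V s) * D x = (w R - w (norm x)) * D x" for x
  proof (cases "norm x \<in> {a..R}")
    case True
    have "(LBINT s. indicator {norm x..} s * V s) = (LBINT s:{norm x..R}. v s)"
      unfolding set_lebesgue_integral_def
      by (rule Bochner_Integration.integral_cong) (use True in \<open>auto simp: V_def indicator_def\<close>)
    then show ?thesis using w[OF True] by simp
  qed (simp add: D0)
  note cake = radial_layer_cake[OF intD V, folded \<Phi>_def, unfolded W]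
  have wD: "w (norm x) * D x = w R * D x - (w R - w (norm x)) * D x" for x by (simp add: algebra_simps)
  show "integrable lborel (\<lambda>x. w (norm x) * (grad \<phi> x \<bullet> b))"
    unfolding D_def[symmetric] unfolding wD by (intro Bochner_Integration.integrable_diff integrable_mult_right intD cake(1))
  have lhs: "(LBINT x. w (norm x) * D x) = - (LBINT s. V s * \<Phi> s)"
    unfolding wD by (subst Bochner_Integration.integral_diff) (auto simp: intD intD0 cake)

  have \<psi>_k: "integrable lborel (\<lambda>x. k (norm x) * \<psi> x)"
    if k[measurable]: "k \<in> borel_measurable borel" and ki: "integrable lborel (\<lambda>s. indicator {a..R} s * k s)" for k
  proof (rule integrable_pointwise_bound)
    have "set_integrable lborel {0<..} (\<lambda>r. r ^ N * (indicator {a..R} r * k r))"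
      unfolding set_integrable_def
    proof (rule integrable_pointwise_bound[OF integrable_mult_right[OF ki, of "R ^ N"]])
      show "norm (indicator {0<..} r *\<^sub>R (r ^ N * (indicator {a..R} r * k r)))
          \<le> norm (R ^ N * (indicator {a..R} r * k r))" for r
        using aR by (auto simp: indicator_def abs_mult intro!: mult_right_mono power_mono)
    qed measurable
    then have "integrable lebesgue (\<lambda>x::'a. indicator {a..R} (norm x) * k (norm x))"
      by (subst polar_integrable) (simp_all add: N_def)
    then have "integrable lborel (\<lambda>x::'a. indicator {a..R} (norm x) * k (norm x))"
      by (subst (asm) integrable_completion) measurable
    then show "integrable lborel (\<lambda>x::'a. M * (indicator {a..R} (norm x) * k (norm x)))"
      by (rule integrable_mult_right)
    show "norm (k (norm x) * \<psi> x) \<le> norm (M * (indicator {a..R} (norm x) * k (norm x)))" for x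
      using mult_left_mono[OF \<psi>_bd[of x], of "\<bar>k (norm x)\<bar>"] M
      by (simp add: abs_mult mult_ac)
  qed measurable
  obtain \<Psi> where [measurable]: "\<Psi> \<in> borel_measurable borel"
    and \<Psi>: "\<And>k. k \<in> borel_measurable borel \<Longrightarrow> integrable lebesgue (\<lambda>x. k (norm x) * \<psi> x) \<Longrightarrow>
        integrable lebesgue (\<lambda>x::'a. k (norm x) * \<Psi> (norm x))"
      "\<And>k. k \<in> borel_measurable borel \<Longrightarrow> integrable lebesgue (\<lambda>x. k (norm x) * \<psi> x) \<Longrightarrow>
        (LINT x|lebesgue. k (norm x) * \<Psi> (norm (x::'a))) = (LINT x|lebesgue. k (norm x) * \<psi> x)"
    using radial_average_exists[OF measurable_completion[of \<psi> lborel borel]] by auto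
  \<comment> \<open>The integral of \<open>\<psi>\<close> over the sphere of radius \<open>s\<close>; the claim is that it equals \<open>\<Phi> s\<close> for almost every \<open>s\<close>.\<close>
  define \<Theta> where "\<Theta> s = c * (s ^ N * \<Psi> s)" for s
  have [measurable]: "\<Theta> \<in> borel_measurable borel" unfolding \<Theta>_def[abs_def] by measurable
  have avg: "integrable lborel (\<lambda>s. k s * \<Theta> s)" "(LBINT x. k (norm x) * \<psi> x) = (LBINT s. k s * \<Theta> s)"
    if k[measurable]: "k \<in> borel_measurable borel" and ki: "integrable lborel (\<lambda>s. indicator {a..R} s * k s)"
      and k0: "\<And>s. s \<notin> {a..R} \<Longrightarrow> k s = 0" for k
  proof -
    have i: "integrable lebesgue (\<lambda>x. k (norm x) * \<psi> x)"
      using \<psi>_k[OF k ki] by (subst integrable_completion) measurable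
    have eq: "(\<lambda>s. c * (indicator {0<..} s *\<^sub>R (s ^ N * (k s * \<Psi> s)))) = (\<lambda>s. k s * \<Theta> s)"
    proof
      fix s show "c * (indicator {0<..} s *\<^sub>R (s ^ N * (k s * \<Psi> s))) = k s * \<Theta> s"
        using k0[of s] aR by (auto simp: \<Theta>_def indicator_def)
    qed
    have "set_integrable lborel {0<..} (\<lambda>s. s ^ N * (k s * \<Psi> s))"
      using \<Psi>(1)[OF k i] by (subst (asm) polar_integrable) (auto simp: N_def)
    from integrable_mult_right[OF this[unfolded set_integrable_def], of c]
    show "integrable lborel (\<lambda>s. k s * \<Theta> s)" unfolding eq .
    have "(LBINT x. k (norm x) * \<psi> x) = (LINT x|lebesgue. k (norm x) * \<psi> x)"
      by (rule integral_completion[symmetric]) measurable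
    also have "\<dots> = (LINT x|lebesgue. k (norm x) * \<Psi> (norm (x::'a)))" by (rule \<Psi>(2)[OF k i, symmetric])
    also have "\<dots> = c * (LBINT s:{0<..}. s ^ N * (k s * \<Psi> s))"
      unfolding c_def N_def by (rule polar_integral) measurable
    also have "\<dots> = (LBINT s. k s * \<Theta> s)"
      unfolding set_lebesgue_integral_def integral_mult_right_zero[symmetric] eq ..
    finally show "(LBINT x. k (norm x) * \<psi> x) = (LBINT s. k s * \<Theta> s)" .
  qed

  define J where "J = (indicator {a..R} :: real \<Rightarrow> real)"
  have J: "integrable lborel J" "\<And>s. indicator {a..R} s * J s = J s"
  proof -
    show "integrable lborel J" unfolding J_def using aR by (intro integrable_real_indicator) auto
  qed (auto simp: J_def indicator_def)
  have "AE s in lborel. J s * \<Phi> s - J s * \<Theta> s = 0"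
  proof (rule AE_eq_0_if_box_integrals_0)
    have i1: "integrable lborel (\<lambda>s. J s * \<Phi> s)"
      unfolding \<Phi>_def by (rule radial_layer_cake(2)[OF intD J(1)])
    have i2: "integrable lborel (\<lambda>s. J s * \<Theta> s)"
    proof (rule avg(1))
      show "J \<in> borel_measurable borel" using J(1) by auto
    qed (simp_all only: J(2) J(1), simp add: J_def)
    show "integrable lborel (\<lambda>s. J s * \<Phi> s - J s * \<Theta> s)" by (rule Bochner_Integration.integrable_diff[OF i1 i2])
    fix \<alpha> \<beta> :: real
    define k :: "real \<Rightarrow> real" where "k s = indicator {max \<alpha> a<..<min \<beta> R} s" for s
    have [measurable]: "k \<in> borel_measurable borel" unfolding k_def[abs_def] by measurable
    have k: "integrable lborel k" "\<And>s. indicator {a..R} s * k s = k s" "\<And>s. s \<notin> {a..R} \<Longrightarrow> k s = 0"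
    proof -
      show "integrable lborel k"
        by (rule integrable_pointwise_bound[OF J(1)]) (auto simp: k_def J_def indicator_def)
    qed (auto simp: k_def indicator_def)
    have "(LBINT s:box \<alpha> \<beta>. J s * \<Phi> s - J s * \<Theta> s) = (LBINT s. k s * \<Phi> s - k s * \<Theta> s)"
      unfolding set_lebesgue_integral_def
    proof (rule integral_cong_AE)
      show "AE s in lborel. indicator (box \<alpha> \<beta>) s *\<^sub>R (J s * \<Phi> s - J s * \<Theta> s) = k s * \<Phi> s - k s * \<Theta> s"
        using AE_lborel_singleton[of a] AE_lborel_singleton[of R]
        by eventually_elim (auto simp: k_def J_def indicator_def box_real)
      show "(\<lambda>s. indicator (box \<alpha> \<beta>) s *\<^sub>R (J s * \<Phi> s - J s * \<Theta> s)) \<in> borel_measurable lborel"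
        using borel_measurable_integrable[OF i1] borel_measurable_integrable[OF i2] by measurable
      show "(\<lambda>s. k s * \<Phi> s - k s * \<Theta> s) \<in> borel_measurable lborel"
        using borel_measurable_integrable[OF radial_layer_cake(2)[OF intD k(1)]]
        unfolding \<Phi>_def[symmetric] by measurable
    qed
    also have "\<dots> = (LBINT s. k s * \<Phi> s) - (LBINT s. k s * \<Theta> s)"
      using radial_layer_cake(2)[OF intD k(1)] avg(1)[of k] k
      by (intro Bochner_Integration.integral_diff) (auto simp: \<Phi>_def)
    also have "\<dots> = 0"
    proof (cases "max \<alpha> a < min \<beta> R")
      case True
      have "(LBINT s. k s * \<Phi> s) = (LBINT x. (LBINT s. indicator {norm x..} s * k s) * D x)"
        unfolding \<Phi>_def by (rule radial_layer_cake(3)[OF intD k(1), symmetric])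
      also have "\<dots> = (LBINT x. (min \<beta> R - max (max \<alpha> a) (min (norm x) (min \<beta> R))) * D x)"
      proof (rule Bochner_Integration.integral_cong)
        fix x :: 'a
        have "(LBINT s. indicator {norm x..} s * k s)
            = (LBINT s. indicator {max (max \<alpha> a) (min (norm x) (min \<beta> R))..min \<beta> R} s)"
        proof (rule integral_cong_AE)
          show "AE s in lborel. indicator {norm x..} s * k s
              = indicator {max (max \<alpha> a) (min (norm x) (min \<beta> R))..min \<beta> R} s"
            using AE_lborel_singleton[of "max \<alpha> a"] AE_lborel_singleton[of "min \<beta> R"]
          proof eventually_elim
            case (elim s)
            then show ?case using True unfolding k_def indicator_def by (simp add: min_def max_def split: if_splits)
          qed
        qed measurable
        also have "\<dots> = min \<beta> R - max (max \<alpha> a) (min (norm x) (min \<beta> R))"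
        proof -
          have "max (max \<alpha> a) (min (norm x) (min \<beta> R)) \<le> min \<beta> R"
            by (rule max.boundedI[OF less_imp_le[OF True] min.cobounded2])
          then show ?thesis by simp
        qed
        finally show "(LBINT s. indicator {norm x..} s * k s) * D x
            = (min \<beta> R - max (max \<alpha> a) (min (norm x) (min \<beta> R))) * D x" by simp
      qed simp
      also have "\<dots> = (LBINT x. k (norm x) * \<psi> x)"
        unfolding D_def \<psi>_def k_def by (rule integral_radial_ramp[OF tf b]) (use aR True in auto)
      also have "\<dots> = (LBINT s. k s * \<Theta> s)" by (intro avg(2) k(3)) (simp_all add: k(2)[abs_def] k(1))
      finally show ?thesis by simp
    next
      case False
      then have "{max \<alpha> a<..<min \<beta> R} = {}" by (simp only: greaterThanLessThan_empty_iff not_less)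
      then show ?thesis by (simp add: k_def)
    qed
    finally show "(LBINT s:box \<alpha> \<beta>. J s * \<Phi> s - J s * \<Theta> s) = 0" .
  qed
  then have "AE s in lborel. V s * \<Phi> s = V s * \<Theta> s"
    by eventually_elim (auto simp: V_def J_def indicator_def)
  then have "(LBINT s. V s * \<Phi> s) = (LBINT s. V s * \<Theta> s)"
    using borel_measurable_integrable[OF cake(2)] by (intro integral_cong_AE) auto
  also have "\<dots> = (LBINT x. V (norm x) * \<psi> x)"
  proof (intro avg(2)[symmetric])
    have "(\<lambda>s. indicator {a..R} s * V s) = V" by (auto simp: V_def indicator_def)
    then show "integrable lborel (\<lambda>s. indicator {a..R} s * V s)" using V by simp
  qed (auto simp: V_def)
  also have "\<dots> = (LBINT x. v (norm x) * \<psi> x)"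
  proof (rule Bochner_Integration.integral_cong)
    show "V (norm x) * \<psi> x = v (norm x) * \<psi> x" for x
      by (cases "norm x \<in> {a..R}") (simp_all add: V_def \<psi>_def supp)
  qed simp
  finally show "(LBINT x. w (norm x) * (grad \<phi> x \<bullet> b))
      = - (LBINT x. v (norm x) * ((x \<bullet> b) / norm x * \<phi> x))"
    using lhs unfolding D_def \<psi>_def by simp
  have "integrable lborel (\<lambda>x. v (norm x) * \<psi> x)"
    using vint by (intro \<psi>_k) (auto simp: set_integrable_def)
  then show "integrable lborel (\<lambda>x. v (norm x) * ((x \<bullet> b) / norm x * \<phi> x))" by (simp add: \<psi>_def)
qed

section \<open>Primitives on the half line\<close>

lemma integral_increments_continuous:
  fixes \<rho> F :: "real \<Rightarrow> real"
  assumes int: "\<And>a b. 0 < a \<Longrightarrow> a < b \<Longrightarrow> set_integrable lborel {a..b} \<rho>"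
    and F: "\<And>r s. 0 < r \<Longrightarrow> r \<le> s \<Longrightarrow> F s - F r = (LBINT t:{r..s}. \<rho> t)"
  shows "continuous_on {0<..} F"
proof (rule continuous_at_imp_continuous_on, rule ballI)
  fix r :: real assume "r \<in> {0<..}"
  then have r: "0 < r" by simp
  define a where "a = r / 2"
  define b where "b = r + 1"
  have ab: "0 < a" "a < r" "r < b" using r by (auto simp: a_def b_def)
  have ii: "set_integrable lborel {a..b} \<rho>" using ab by (intro int) auto
  have "continuous_on {a..b} (\<lambda>s. F a + integral {a..s} \<rho>)"
    by (intro continuous_intros indefinite_integral_continuous_1 set_borel_integral_eq_integral(1)[OF ii])
  moreover have "F a + integral {a..s} \<rho> = F s" if "s \<in> {a..b}" for s
  proof -
    have "set_integrable lborel {a..s} \<rho>" by (rule set_integrable_subset[OF ii]) (use that in auto)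
    from set_borel_integral_eq_integral(2)[OF this] show ?thesis using F[of a s] ab that by simp
  qed
  ultimately have "continuous_on {a..b} F" by (rule continuous_on_eq)
  then have "continuous_on {a<..<b} F" by (rule continuous_on_subset) auto
  then show "isCont F r" using ab by (simp add: continuous_on_eq_continuous_at)
qed

lemma integral_increments_has_derivative:
  fixes \<rho> F k :: "real \<Rightarrow> real"
  assumes [measurable]: "\<rho> \<in> borel_measurable borel"
    and F: "\<And>r s. 0 < r \<Longrightarrow> r \<le> s \<Longrightarrow> F s - F r = (LBINT t:{r..s}. \<rho> t)"
    and k: "continuous_on {0<..} k" and eq: "AE t in lborel. 0 < t \<longrightarrow> \<rho> t = k t"
    and r: "0 < r"
  shows "(F has_real_derivative k r) (at r)"
proof -
  define a where "a = r / 2"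
  define b where "b = r + 1"
  have ab: "0 < a" "a < r" "r < b" using r by (auto simp: a_def b_def)
  have kc: "continuous_on {a..b} k" by (rule continuous_on_subset[OF k]) (use ab in auto)
  have "((\<lambda>s. F a + integral {a..s} k) has_real_derivative k r) (at r within {a..b})"
    using ab by (auto intro!: derivative_eq_intros integral_has_real_derivative[OF kc])
  then have "((\<lambda>s. F a + integral {a..s} k) has_real_derivative k r) (at r)"
    using ab at_within_Icc_at[of a r b] by simp
  then show ?thesis
  proof (rule has_field_derivative_transform_within_open[of _ _ _ "{a<..<b}"])
    fix s assume s: "s \<in> {a<..<b}"
    have kc': "continuous_on {a..s} k" by (rule continuous_on_subset[OF k]) (use ab in auto)
    have m: "(\<lambda>t. indicator {a..s} t *\<^sub>R k t) \<in> borel_measurable borel"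
      by (rule borel_measurable_continuous_on_indicator[OF _ kc']) simp
    have "F s - F a = (LBINT t:{a..s}. \<rho> t)" using ab s by (intro F) auto
    also have "\<dots> = (LBINT t:{a..s}. k t)"
      unfolding set_lebesgue_integral_def
    proof (rule integral_cong_AE)
      show "AE t in lborel. indicator {a..s} t *\<^sub>R \<rho> t = indicator {a..s} t *\<^sub>R k t"
        using eq by eventually_elim (use ab in \<open>auto simp: indicator_def\<close>)
    qed (use m in auto)
    also have "\<dots> = integral {a..s} k"
      by (rule set_borel_integral_eq_integral(2)[OF borel_integrable_atLeastAtMost'[OF kc']])
    finally show "F a + integral {a..s} k = F s" by simp
  qed (use ab in auto)
qed

lemma integral_from_0_increments:
  fixes \<rho> :: "real \<Rightarrow> real"
  assumes int: "\<And>R. set_integrable lborel {0<..R} \<rho>" and r: "0 < r" "r \<le> s"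
  shows "(LBINT t:{0<..s}. \<rho> t) - (LBINT t:{0<..r}. \<rho> t) = (LBINT t:{r..s}. \<rho> t)"
proof -
  have i: "set_integrable lborel {r..s} \<rho>"
    by (rule set_integrable_subset[OF int[of s]]) (use r in auto)
  have "(LBINT t:{0<..s}. \<rho> t) - (LBINT t:{0<..r}. \<rho> t)
      = (LBINT t. indicator {0<..s} t *\<^sub>R \<rho> t - indicator {0<..r} t *\<^sub>R \<rho> t)"
    unfolding set_lebesgue_integral_def
    using int unfolding set_integrable_def by (intro Bochner_Integration.integral_diff[symmetric])
  also have "\<dots> = (LBINT t:{r..s}. \<rho> t)"
    unfolding set_lebesgue_integral_def
  proof (rule integral_cong_AE)
    show "AE t in lborel. indicator {0<..s} t *\<^sub>R \<rho> t - indicator {0<..r} t *\<^sub>R \<rho> t = indicator {r..s} t *\<^sub>R \<rho> t"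
      using AE_lborel_singleton[of r] by eventually_elim (use r in \<open>auto simp: indicator_def\<close>)
  qed (use int[of s] int[of r] i in \<open>auto simp: set_integrable_def\<close>)
  finally show ?thesis .
qed

lemma integral_from_0_tendsto_0:
  fixes \<rho> :: "real \<Rightarrow> real"
  assumes int: "\<And>R. set_integrable lborel {0<..R} \<rho>"
  shows "((\<lambda>r. LBINT t:{0<..r}. \<rho> t) \<longlongrightarrow> 0) (at_right 0)"
proof (rule tendsto_at_right_sequentially[of 0 1])
  fix S :: "nat \<Rightarrow> real" assume S: "\<And>n. 0 < S n" "\<And>n. S n < 1" "decseq S" "S \<longlonglongrightarrow> 0"
  have "(\<lambda>n. LBINT t. indicator {0<..S n} t *\<^sub>R \<rho> t) \<longlonglongrightarrow> (LBINT t::real. 0)"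
  proof (rule integral_dominated_convergence[where w = "\<lambda>t. norm (indicator {0<..1} t *\<^sub>R \<rho> t)"])
    show "integrable lborel (\<lambda>t. norm (indicator {0<..1} t *\<^sub>R \<rho> t))"
      using int[of 1] unfolding set_integrable_def by (rule integrable_norm)
    show "(\<lambda>t. indicator {0<..S n} t *\<^sub>R \<rho> t) \<in> borel_measurable lborel" for n
      using int[of "S n"] unfolding set_integrable_def by (rule borel_measurable_integrable)
    show "AE t in lborel. (\<lambda>n. indicator {0<..S n} t *\<^sub>R \<rho> t) \<longlonglongrightarrow> 0" (is "AE t in _. ?P t")
    proof (rule AE_I2)
      fix t :: real
      show "?P t"
      proof (cases "0 < t")
        case True
        have "eventually (\<lambda>n. S n < t) sequentially" using S(4) True by (rule order_tendstoD)
        then have "eventually (\<lambda>n. indicator {0<..S n} t *\<^sub>R \<rho> t = 0) sequentially"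
          by eventually_elim simp
        then show ?thesis by (rule tendsto_eventually)
      qed simp
    qed
    show "AE t in lborel. norm (indicator {0<..S n} t *\<^sub>R \<rho> t) \<le> norm (indicator {0<..1} t *\<^sub>R \<rho> t)" for n
      using S(2)[of n] by (intro AE_I2) (auto simp: indicator_def)
  qed simp
  then show "(\<lambda>n. LBINT t:{0<..S n}. \<rho> t) \<longlonglongrightarrow> 0" by (simp add: set_lebesgue_integral_def)
qed simp

text \<open>
  The base point of the primitive is 1, since \<open>v\<close> need not be integrable near 0.
\<close>

lemma integral_increments_exist:
  fixes v :: "real \<Rightarrow> real"
  assumes int: "\<And>a b. 0 < a \<Longrightarrow> a < b \<Longrightarrow> set_integrable lborel {a..b} v"
  obtains w where "\<And>r s. 0 < r \<Longrightarrow> r \<le> s \<Longrightarrow> w s - w r = (LBINT t:{r..s}. v t)"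
proof
  fix r s :: real assume rs: "0 < r" "r \<le> s"
  define a where "a = min 1 (min r s)"
  define b where "b = max 1 (max r s)"
  have "set_integrable lborel {a<..<b} v"
    by (rule set_integrable_subset[OF int[of a "b + 1"]]) (use rs in \<open>auto simp: a_def b_def\<close>)
  moreover have "a \<le> b" by (auto simp: a_def b_def)
  ultimately have "interval_lebesgue_integrable lborel (ereal a) (ereal b) v"
    by (simp add: interval_lebesgue_integrable_def)
  moreover have "ereal a = min (ereal 1) (min (ereal r) (ereal s))" "ereal b = max (ereal 1) (max (ereal r) (ereal s))"
    unfolding a_def b_def by (auto simp: min_def max_def)
  ultimately have "(LBINT t=ereal 1..ereal r. v t) + (LBINT t=ereal r..ereal s. v t) = (LBINT t=ereal 1..ereal s. v t)"
    by (intro interval_integral_sum) simp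
  then show "(LBINT t=ereal 1..ereal s. v t) - (LBINT t=ereal 1..ereal r. v t) = (LBINT t:{r..s}. v t)"
    using interval_integral_Icc[OF rs(2), of v] by simp
qed

lemma nonneg_if_AE_nonneg:
  fixes w :: "real \<Rightarrow> real"
  assumes cont: "continuous_on {0<..} w" and ae: "AE r in lborel. 0 < r \<longrightarrow> 0 \<le> w r" and r: "0 < r"
  shows "0 \<le> w r"
proof (rule ccontr)
  assume "\<not> 0 \<le> w r"
  moreover have "isCont w r" using cont r by (simp add: continuous_on_eq_continuous_at)
  ultimately have "eventually (\<lambda>s. w s < 0) (nhds r)"
    by (intro order_tendstoD(2)[of w "w r"]) (auto simp: isCont_def tendsto_nhds_iff)
  moreover have "eventually (\<lambda>s. 0 < s) (nhds r)"
    using r eventually_nhds_in_open[of "{0<..}" r] by simp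
  ultimately have "eventually (\<lambda>s. w s < 0 \<and> 0 < s) (nhds r)" by (rule eventually_conj)
  then obtain d where d: "0 < d" "\<And>s. dist s r < d \<Longrightarrow> w s < 0 \<and> 0 < s"
    unfolding eventually_nhds_metric by blast
  have "AE s in lborel. s \<notin> {r - d<..<r + d}"
    using ae
  proof eventually_elim
    case (elim s)
    show ?case
    proof
      assume "s \<in> {r - d<..<r + d}"
      then have "dist s r < d" by (auto simp: dist_real_def)
      from d(2)[OF this] elim show False by simp
    qed
  qed
  then have "emeasure lborel {r - d<..<r + d} = 0"
    by (subst (asm) AE_iff_measurable[of "{r - d<..<r + d}"]) auto
  then show False using d(1) by simp
qed

section \<open>The weak gradient of a radial function\<close>

lemma locally_integrable_times_test:
  fixes f :: "'a::euclidean_space \<Rightarrow> real"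
  assumes f: "locally_integrable f" and [measurable]: "\<psi> \<in> borel_measurable borel"
    and bd: "\<And>x. \<bar>\<psi> x\<bar> \<le> M" and supp: "\<And>x. norm x > R \<Longrightarrow> \<psi> x = 0"
  shows "integrable lebesgue (\<lambda>x. f x * \<psi> x)"
proof (rule integrable_pointwise_bound[where f = "\<lambda>x. M * (indicator (cball 0 R) x *\<^sub>R f x)"])
  show "integrable lebesgue (\<lambda>x. M * (indicator (cball 0 R) x *\<^sub>R f x))"
    using f unfolding locally_integrable_def set_integrable_def by (intro integrable_mult_right) auto
  have "\<psi> \<in> borel_measurable lebesgue" by (rule measurable_completion) measurable
  then show "(\<lambda>x. f x * \<psi> x) \<in> borel_measurable lebesgue"
    using f unfolding locally_integrable_def by (intro borel_measurable_times) auto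
  show "norm (f x * \<psi> x) \<le> norm (M * (indicator (cball 0 R) x *\<^sub>R f x))" for x
  proof (cases "norm x > R")
    case False
    have "\<bar>f x\<bar> * \<bar>\<psi> x\<bar> \<le> \<bar>f x\<bar> * \<bar>M\<bar>"
      using bd[of x] by (intro mult_left_mono) auto
    then show ?thesis using False by (simp add: abs_mult mult.commute)
  qed (simp add: supp)
qed

text \<open>
  Away from the origin the weight \<open>r^(N-1)\<close> is bounded below.
\<close>

lemma locally_integrable_polar:
  fixes u :: "'a::euclidean_space \<Rightarrow> real"
  assumes u: "locally_integrable u" and [measurable]: "g \<in> borel_measurable borel"
    and ug: "AE x in lebesgue. u x = g (norm x)" and ab: "0 < a"
  shows "set_integrable lborel {a..b} g"
proof -
  let ?N = "DIM('a) - 1"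
  have 1: "integrable lebesgue (\<lambda>x. u x * indicator {a..b} (norm x))"
    by (rule locally_integrable_times_test[OF u, of _ 1 b]) (auto simp: indicator_def)
  have 2: "AE x in lebesgue. u x * indicator {a..b} (norm x) = indicator {a..b} (norm x) * g (norm x)"
    using ug by eventually_elim simp
  have 3: "(\<lambda>x::'a. indicator {a..b} (norm x) * g (norm x)) \<in> borel_measurable lebesgue"
    by (rule measurable_completion) measurable
  have "integrable lebesgue (\<lambda>x::'a. indicator {a..b} (norm x) * g (norm x))"
    using 1 integrable_cong_AE[OF borel_measurable_integrable[OF 1] 3 2] by simp
  then have i: "set_integrable lborel {0<..} (\<lambda>r. r ^ ?N * (indicator {a..b} r * g r))"
    by (subst (asm) polar_integrable) auto
  show ?thesis
    unfolding set_integrable_def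
  proof (rule integrable_pointwise_bound[OF integrable_mult_right[OF i[unfolded set_integrable_def], of "1 / a ^ ?N"]])
    show "norm (indicator {a..b} r *\<^sub>R g r)
        \<le> norm (1 / a ^ ?N * (indicator {0<..} r *\<^sub>R (r ^ ?N * (indicator {a..b} r * g r))))" for r :: real
    proof (cases "r \<in> {a..b}")
      case True
      then have "a ^ ?N \<le> r ^ ?N" using ab by (intro power_mono) auto
      then have "1 \<le> r ^ ?N / a ^ ?N" using ab by simp
      then have "1 * \<bar>g r\<bar> \<le> (r ^ ?N / a ^ ?N) * \<bar>g r\<bar>" by (rule mult_right_mono) simp
      then show ?thesis using True ab by (simp add: abs_mult)
    qed simp
  qed measurable
qed

text \<open>
  The vector field with the components \<open>\<phi> b\<close> points in radial direction. The power of \<open>|x|\<close> is chosen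
  so that the term of the divergence without a derivative of \<open>K\<close> cancels: in polar coordinates,
  including the weight \<open>r^(N-1)\<close>, the divergence is the derivative of \<open>K(r^2)\<close>.
\<close>

lemma smooth_radial_vector_field:
  fixes K :: "real \<Rightarrow> real" and b :: "'a::euclidean_space"
  assumes K: "\<And>k. C_k k K" and ab: "0 < a" and K0: "\<And>t. t \<notin> {a\<^sup>2..R\<^sup>2} \<Longrightarrow> K t = 0" and aR: "a < R"
  defines "\<phi> \<equiv> \<lambda>b x. K (x \<bullet> x) * (x \<bullet> x) powr (- (real DIM('a) / 2)) * (x \<bullet> b)"
  shows "test_function (\<phi> b)"
    and "norm (x::'a) \<notin> {a..R} \<Longrightarrow> \<phi> b x = 0"
    and "(\<Sum>b\<in>Basis. grad (\<phi> b) x \<bullet> b) = 2 * deriv K ((norm x)\<^sup>2) * norm x powr (2 - real DIM('a))"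
proof -
  define s where "s = real DIM('a) / 2"
  define k where "k t = K t * t powr (- s)" for t
  have K0': "K t = 0" if "t < a\<^sup>2" for t using that by (intro K0) auto
  have k_smooth: "C_k j k" for j
    unfolding k_def[abs_def] by (rule C_k_mult_powr[where a = "a\<^sup>2"]) (use K ab K0' in auto)
  have \<phi>_eq: "\<phi> b = (\<lambda>x. k (x \<bullet> x) * (x \<bullet> b))" for b by (simp add: \<phi>_def k_def s_def)
  have z: "\<phi> b x = 0" if "norm x \<notin> {a..R}" for b x
  proof -
    have "x \<bullet> x \<notin> {a\<^sup>2..R\<^sup>2}"
    proof
      assume "x \<bullet> x \<in> {a\<^sup>2..R\<^sup>2}"
      then have "a\<^sup>2 \<le> (norm x)\<^sup>2" "(norm x)\<^sup>2 \<le> R\<^sup>2" by (auto simp: power2_norm_eq_inner)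
      then have "norm x \<in> {a..R}"
        using power2_le_imp_le[of a "norm x"] power2_le_imp_le[of "norm x" R] ab aR by auto
      with that show False by simp
    qed
    then show ?thesis by (simp add: \<phi>_def K0)
  qed
  show "norm x \<notin> {a..R} \<Longrightarrow> \<phi> b x = 0" by (rule z)
  show "test_function (\<phi> b)"
  proof (rule test_functionI[where R = R])
    show "C_k j (\<phi> b)" for j
      unfolding \<phi>_eq by (intro C_k_mult C_k_compose[OF k_smooth] C_k_norm_square C_k_inner)
    show "\<phi> b x = 0" if "norm x > R" for x using that by (intro z) auto
  qed
  have k': "(k has_real_derivative deriv k t) (at t)" for t by (rule C_k_Suc_realE(1)[OF k_smooth])
  have grad: "grad (\<phi> b) x \<bullet> b = k (x \<bullet> x) + 2 * deriv k (x \<bullet> x) * (x \<bullet> b)\<^sup>2" if b: "b \<in> Basis" for b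
  proof -
    have "(\<phi> b has_derivative (\<lambda>h. k (x \<bullet> x) * (h \<bullet> b) + ((2 * deriv k (x \<bullet> x)) *\<^sub>R x) \<bullet> h * (x \<bullet> b))) (at x)"
      unfolding \<phi>_eq by (rule has_derivative_mult[OF radial_has_derivative[OF k']]) (auto intro!: derivative_eq_intros)
    from grad_inner[OF this b] show ?thesis using b by (simp add: power2_eq_square)
  qed
  have sum1: "(\<Sum>b\<in>Basis. grad (\<phi> b) x \<bullet> b) = real DIM('a) * k (x \<bullet> x) + 2 * deriv k (x \<bullet> x) * (x \<bullet> x)"
  proof -
    have "(\<Sum>b\<in>Basis. grad (\<phi> b) x \<bullet> b) = (\<Sum>b\<in>Basis. k (x \<bullet> x) + 2 * deriv k (x \<bullet> x) * (x \<bullet> b)\<^sup>2)"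
      using grad by (intro sum.cong) auto
    also have "\<dots> = real DIM('a) * k (x \<bullet> x) + 2 * deriv k (x \<bullet> x) * (\<Sum>b\<in>Basis. (x \<bullet> b)\<^sup>2)"
      by (simp add: sum.distrib sum_distrib_left)
    also have "(\<Sum>b\<in>Basis. (x \<bullet> b)\<^sup>2) = x \<bullet> x" by (simp add: euclidean_inner[of x x] power2_eq_square)
    finally show ?thesis .
  qed
  show "(\<Sum>b\<in>Basis. grad (\<phi> b) x \<bullet> b) = 2 * deriv K ((norm x)\<^sup>2) * norm x powr (2 - real DIM('a))"
  proof (cases "x = 0")
    case True
    have "k 0 = 0" using K0'[of 0] ab by (simp add: k_def)
    moreover have "deriv K 0 = 0"
    proof (rule DERIV_imp_deriv)
      have "((\<lambda>_. 0) has_real_derivative 0) (at (0::real))" by simp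
      then show "(K has_real_derivative 0) (at 0)"
        by (rule has_field_derivative_transform_within_open[of _ _ _ "{..<a\<^sup>2}"]) (use K0' ab in auto)
    qed
    ultimately show ?thesis using True sum1 by simp
  next
    case False
    define t where "t = x \<bullet> x"
    have t: "t > 0" using False by (simp add: t_def)
    have "(k has_real_derivative deriv K t * t powr (- s) + K t * (- s * t powr (- s - 1))) (at t)"
      unfolding k_def[abs_def]
      by (rule DERIV_cong[OF DERIV_mult[OF C_k_Suc_realE(1)[OF K] has_real_derivative_powr[OF t]]]) simp
    then have "deriv k t = deriv K t * t powr (- s) + K t * (- s * t powr (- s - 1))" by (rule DERIV_imp_deriv)
    moreover have "t powr (- s - 1) * t = t powr (- s)"
      using powr_add[of t "- s - 1" 1] t by simp
    moreover have "2 * (d * P + k0 * (- s * Q)) * t = 2 * d * (P * t) - 2 * s * k0 * (Q * t)" for d P Q k0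
      by (simp add: algebra_simps)
    ultimately have "2 * deriv k t * t = 2 * deriv K t * (t powr (- s) * t) - 2 * s * K t * t powr (- s)"
      by simp
    then have "real DIM('a) * k t + 2 * deriv k t * t = 2 * deriv K t * (t powr (- s) * t)"
      by (simp add: k_def s_def)
    moreover have "t powr (- s) * t = norm x powr (2 - real DIM('a))"
    proof -
      have "t = norm x powr 2" using False by (simp add: t_def power2_norm_eq_inner[symmetric])
      then have "t powr (- s) * t = (norm x powr 2) powr (- s) * norm x powr 2" by (simp only:)
      also have "\<dots> = norm x powr (2 * (- s) + 2)" unfolding powr_powr powr_add ..
      also have "2 * (- s) + 2 = 2 - real DIM('a)" by (simp add: s_def)
      finally show ?thesis .
    qed
    ultimately show ?thesis using sum1 by (simp add: t_def power2_norm_eq_inner)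
  qed
qed

text \<open>
  The du Bois-Reymond lemma in the variable \<open>r^2\<close>: a function whose weak derivative vanishes is
  constant.
\<close>

lemma constant_if_radial_test_integrals_0:
  fixes z :: "real \<Rightarrow> real"
  assumes z[measurable]: "z \<in> borel_measurable borel"
    and int: "\<And>a b. 0 < a \<Longrightarrow> a < b \<Longrightarrow> set_integrable lborel {a..b} z"
    and test: "\<And>K a R. 0 < a \<Longrightarrow> a < R \<Longrightarrow> (\<And>k. C_k k K) \<Longrightarrow> (\<And>t. t \<notin> {a\<^sup>2..R\<^sup>2} \<Longrightarrow> K t = 0) \<Longrightarrow>
        (LBINT r:{0<..}. 2 * r * deriv K (r\<^sup>2) * z r) = 0"
  obtains C where "AE r in lborel. 0 < r \<longrightarrow> z r = C"
proof -
  define T where "T f = (LBINT r. indicator {0<..} r * (2 * r * f (r\<^sup>2) * z r))" for f :: "real \<Rightarrow> real"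
  have bump_int: "integrable lborel (\<lambda>r. indicator {0<..} r * (2 * r * bump \<alpha> \<beta> n (r\<^sup>2) * z r))"
    if \<alpha>\<beta>: "0 < \<alpha>" "\<alpha> < \<beta>" for \<alpha> \<beta> n
  proof (rule integrable_pointwise_bound[OF integrable_mult_right[OF int[of "sqrt \<alpha>" "sqrt \<beta>", unfolded set_integrable_def], of "2 * sqrt \<beta>"]])
    show "norm (indicator {0<..} r * (2 * r * bump \<alpha> \<beta> n (r\<^sup>2) * z r))
        \<le> norm (2 * sqrt \<beta> * (indicator {sqrt \<alpha>..sqrt \<beta>} r *\<^sub>R z r))" for r :: real
    proof (cases "0 < r \<and> r\<^sup>2 \<in> {\<alpha><..<\<beta>}")
      case True
      then have r: "0 < r" "sqrt \<alpha> \<le> r" "r \<le> sqrt \<beta>"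
        by (auto intro!: real_le_rsqrt real_le_lsqrt)
      then have "2 * r * bump \<alpha> \<beta> n (r\<^sup>2) * \<bar>z r\<bar> \<le> 2 * sqrt \<beta> * 1 * \<bar>z r\<bar>"
        using bump_bounds[of \<alpha> \<beta> n "r\<^sup>2"] \<alpha>\<beta> by (intro mult_right_mono mult_mono) auto
      then show ?thesis using r bump_bounds(1)[of \<alpha> \<beta> n "r\<^sup>2"] \<alpha>\<beta> by (simp add: abs_mult)
    next
      case False
      then show ?thesis by (auto simp: bump_eq_0)
    qed
  qed (use \<alpha>\<beta> in auto)
  obtain F2 where F2: "\<And>t. (F2 has_real_derivative bump 1 2 1 t) (at t)"
    using antiderivative_exists[OF C_k_continuous[OF C_k_bump[of 0 1 2 1]]] by blast
  define m2 where "m2 = F2 2 - F2 1"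
  have m2: "m2 > 0" using bump_antiderivative(3)[OF F2] by (simp add: m2_def)
  define C where "C = T (bump 1 2 1) / m2"
  have main: "(LBINT r:{0<..}. 2 * r * (z r - C) * bump \<alpha> \<beta> n (r\<^sup>2)) = 0" if \<alpha>\<beta>: "0 < \<alpha>" "\<alpha> < \<beta>" for \<alpha> \<beta> n
  proof -
    obtain F1 where F1: "\<And>t. (F1 has_real_derivative bump \<alpha> \<beta> n t) (at t)"
      using antiderivative_exists[OF C_k_continuous[OF C_k_bump[of 0 \<alpha> \<beta> n]]] by blast
    define m1 where "m1 = F1 \<beta> - F1 \<alpha>"
    \<comment> \<open>Subtracting a multiple of a fixed bump makes the mean zero, so the primitive has compact support.\<close>
    define K where "K t = (F1 t - F1 \<alpha>) - (m1 / m2) * (F2 t - F2 1)" for t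
    have dK: "(K has_real_derivative bump \<alpha> \<beta> n t - (m1 / m2) * bump 1 2 1 t) (at t)" for t
      unfolding K_def[abs_def] using m2 by (auto intro!: derivative_eq_intros F1 F2)
    have K_smooth: "C_k k K" for k
    proof (rule C_k_Suc_D, rule C_k_Suc_realI[OF dK])
      have "C_k k (\<lambda>t. bump \<alpha> \<beta> n t + (- (m1 / m2)) * bump 1 2 1 t)"
        by (intro C_k_add C_k_mult C_k_const C_k_bump)
      then show "C_k k (\<lambda>t. bump \<alpha> \<beta> n t - (m1 / m2) * bump 1 2 1 t)" by simp
    qed
    define a where "a = sqrt (min \<alpha> 1)"
    define R where "R = sqrt (max \<beta> 2)"
    have sq: "a\<^sup>2 = min \<alpha> 1" "R\<^sup>2 = max \<beta> 2" using \<alpha>\<beta> by (auto simp: a_def R_def)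
    have aR: "0 < a" "a < R" using \<alpha>\<beta> by (auto simp: a_def R_def)
    have K0: "K t = 0" if t: "t \<notin> {a\<^sup>2..R\<^sup>2}" for t
    proof -
      have "t < min \<alpha> 1 \<or> max \<beta> 2 < t" using t sq by auto
      then show ?thesis
      proof
        assume "t < min \<alpha> 1"
        then show ?thesis
          using bump_antiderivative(2)[OF F1 \<alpha>\<beta>(2), of t] bump_antiderivative(2)[OF F2, of t] by (simp add: K_def)
      next
        assume "max \<beta> 2 < t"
        then show ?thesis
          using bump_antiderivative(1)[OF F1 \<alpha>\<beta>(2), of t] bump_antiderivative(1)[OF F2, of t] m2
          by (simp add: K_def m1_def m2_def)
      qed
    qed
    have dK': "deriv K t = bump \<alpha> \<beta> n t - (m1 / m2) * bump 1 2 1 t" for t by (rule DERIV_imp_deriv[OF dK])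
    have i1: "integrable lborel (\<lambda>r. indicator {0<..} r * (2 * r * bump \<alpha> \<beta> n (r\<^sup>2) * z r))"
      by (rule bump_int[OF \<alpha>\<beta>])
    have i2: "integrable lborel (\<lambda>r. (m1 / m2) * (indicator {0<..} r * (2 * r * bump 1 2 1 (r\<^sup>2) * z r)))"
      by (intro integrable_mult_right bump_int) auto
    have "0 = (LBINT r:{0<..}. 2 * r * deriv K (r\<^sup>2) * z r)"
      by (rule test[OF aR K_smooth K0, symmetric])
    also have "\<dots> = (LBINT r. indicator {0<..} r * (2 * r * bump \<alpha> \<beta> n (r\<^sup>2) * z r)
        - (m1 / m2) * (indicator {0<..} r * (2 * r * bump 1 2 1 (r\<^sup>2) * z r)))"
      unfolding set_lebesgue_integral_def dK' by (rule Bochner_Integration.integral_cong) (auto simp: algebra_simps)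
    also have "\<dots> = T (bump \<alpha> \<beta> n) - (m1 / m2) * T (bump 1 2 1)"
      unfolding T_def Bochner_Integration.integral_diff[OF i1 i2] by simp
    finally have T1: "T (bump \<alpha> \<beta> n) = C * m1" by (simp add: C_def)
    note FTC = bump_radial_FTC[OF F1 \<alpha>\<beta> order_refl]
    have ind: "indicator {0..} s * (indicator {0<..} s * x) = (indicator {0<..} s * x :: real)" for s x :: real
      by (auto simp: indicator_def)
    have "F1 (0\<^sup>2) = F1 \<alpha>" by (rule bump_antiderivative(2)[OF F1 \<alpha>\<beta>(2)]) (use \<alpha>\<beta> in simp)
    then have m1: "(LBINT r. indicator {0<..} r * (2 * r * bump \<alpha> \<beta> n (r\<^sup>2))) = m1"
      using FTC(2) unfolding ind m1_def by simp
    have i3: "integrable lborel (\<lambda>r. C * (indicator {0<..} r * (2 * r * bump \<alpha> \<beta> n (r\<^sup>2))))"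
      using FTC(1) unfolding ind by (rule integrable_mult_right)
    have "(LBINT r:{0<..}. 2 * r * (z r - C) * bump \<alpha> \<beta> n (r\<^sup>2))
        = (LBINT r. indicator {0<..} r * (2 * r * bump \<alpha> \<beta> n (r\<^sup>2) * z r)
           - C * (indicator {0<..} r * (2 * r * bump \<alpha> \<beta> n (r\<^sup>2))))"
      unfolding set_lebesgue_integral_def by (rule Bochner_Integration.integral_cong) (auto simp: algebra_simps)
    also have "\<dots> = T (bump \<alpha> \<beta> n) - C * m1"
      unfolding Bochner_Integration.integral_diff[OF i1 i3] T_def integral_mult_right_zero m1 ..
    finally show ?thesis using T1 by simp
  qed
  have "AE r in lborel. 0 < r \<longrightarrow> 2 * r * (z r - C) = 0"
  proof (rule AE_eq_0_if_radial_bump_integrals_0)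
    fix a b :: real assume ab: "0 < a" "a < b"
    have i: "set_integrable lborel {a..b} (\<lambda>r. z r - C)"
      by (intro set_integral_diff int[OF ab] borel_integrable_atLeastAtMost' continuous_on_const)
    show "set_integrable lborel {a..b} (\<lambda>r. 2 * r * (z r - C))"
      unfolding set_integrable_def
    proof (rule integrable_pointwise_bound[OF integrable_mult_right[OF i[unfolded set_integrable_def], of "2 * b"]])
      show "norm (indicator {a..b} r *\<^sub>R (2 * r * (z r - C))) \<le> norm (2 * b * (indicator {a..b} r *\<^sub>R (z r - C)))" for r
        using ab by (auto simp: indicator_def abs_mult intro!: mult_right_mono)
    qed measurable
  qed (use main in auto)
  then have "AE r in lborel. 0 < r \<longrightarrow> z r = C" by eventually_elim auto
  then show thesis by (rule that)
qed

lemma locally_integrable_inner: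
  fixes G :: "'a::euclidean_space \<Rightarrow> 'a"
  assumes "locally_integrable G"
  shows "locally_integrable (\<lambda>x. G x \<bullet> b)"
proof -
  have "set_integrable lebesgue K (\<lambda>x. G x \<bullet> b)" if "compact K" for K
    using integrable_inner_left[of b lebesgue "\<lambda>x. indicator K x *\<^sub>R G x"] assms that
    unfolding locally_integrable_def set_integrable_def by simp
  then show ?thesis using assms unfolding locally_integrable_def by auto
qed

lemma locally_integrable_radial_component:
  fixes G :: "'a::euclidean_space \<Rightarrow> 'a"
  assumes G: "locally_integrable G"
  shows "locally_integrable (\<lambda>x. (G x \<bullet> x) / norm x)"
  unfolding locally_integrable_def
proof (intro conjI allI impI)
  have [measurable]: "G \<in> borel_measurable lebesgue" using G by (simp add: locally_integrable_def)
  have [measurable]: "(\<lambda>x::'a. x) \<in> borel_measurable lebesgue" "(norm :: 'a \<Rightarrow> real) \<in> borel_measurable lebesgue"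
    by (rule measurable_completion; simp)+
  show m: "(\<lambda>x. (G x \<bullet> x) / norm x) \<in> borel_measurable lebesgue" by measurable
  fix K :: "'a set" assume K: "compact K"
  show "set_integrable lebesgue K (\<lambda>x. (G x \<bullet> x) / norm x)"
    unfolding set_integrable_def
  proof (rule integrable_pointwise_bound)
    show "integrable lebesgue (\<lambda>x. indicator K x *\<^sub>R G x)"
      using G K by (simp add: locally_integrable_def set_integrable_def)
    have "K \<in> sets lebesgue" using K by (simp add: borel_compact sets_completionI_sets)
    then show "(\<lambda>x. indicator K x *\<^sub>R ((G x \<bullet> x) / norm x)) \<in> borel_measurable lebesgue"
      using m by (intro borel_measurable_scaleR borel_measurable_indicator)
    show "norm (indicator K x *\<^sub>R ((G x \<bullet> x) / norm x)) \<le> norm (indicator K x *\<^sub>R G x)" for x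
    proof -
      have "\<bar>G x \<bullet> x\<bar> \<le> norm (G x) * norm x" by (rule Cauchy_Schwarz_ineq2)
      then have "\<bar>G x \<bullet> x / norm x\<bar> \<le> norm (G x)" by (cases "x = 0") (auto simp: divide_le_eq)
      then show "norm (indicator K x *\<^sub>R ((G x \<bullet> x) / norm x)) \<le> norm (indicator K x *\<^sub>R G x)"
        by (simp add: indicator_def)
    qed
  qed
qed

text \<open>
  Two uses of integration by parts. With radial vector fields it compares \<open>g\<close> with a primitive of the
  spherical average \<open>v\<close> of the radial component of \<open>G\<close>, in which step only this average matters. With
  arbitrary test functions it then identifies \<open>G\<close> itself.
\<close>

lemma radial_weak_gradient:
  fixes u :: "'a::euclidean_space \<Rightarrow> real"
  assumes wg: "has_weak_gradient u G" and g[measurable]: "g \<in> borel_measurable borel"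
    and ug: "AE x in lebesgue. u x = g (norm x)"
  obtains v w where "v \<in> borel_measurable borel"
    and "\<And>a b. 0 < a \<Longrightarrow> a < b \<Longrightarrow> set_integrable lborel {a..b} v"
    and "\<And>r s. 0 < r \<Longrightarrow> r \<le> s \<Longrightarrow> w s - w r = (LBINT t:{r..s}. v t)"
    and "AE r in lborel. 0 < r \<longrightarrow> g r = w r"
    and "AE x in lebesgue. G x = (v (norm x) / norm x) *\<^sub>R x"
proof -
  have u_loc: "locally_integrable u" and G_loc: "locally_integrable G"
    and weak: "\<And>\<phi> b. test_function \<phi> \<Longrightarrow> b \<in> Basis \<Longrightarrow>
        (LINT x|lebesgue. u x * (grad \<phi> x \<bullet> b)) = - (LINT x|lebesgue. (G x \<bullet> b) * \<phi> x)"
    using wg by (auto simp: has_weak_gradient_def)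
  define h where "h x = (G x \<bullet> x) / norm x" for x
  have h_loc: "locally_integrable h" unfolding h_def[abs_def] by (rule locally_integrable_radial_component[OF G_loc])
  then have h_meas: "h \<in> borel_measurable lebesgue" by (simp add: locally_integrable_def)
  obtain v where v[measurable]: "v \<in> borel_measurable borel"
    and v_int: "\<And>k. k \<in> borel_measurable borel \<Longrightarrow> integrable lebesgue (\<lambda>x. k (norm x) * h x) \<Longrightarrow>
        integrable lebesgue (\<lambda>x::'a. k (norm x) * v (norm x))"
    and v_avg: "\<And>k. k \<in> borel_measurable borel \<Longrightarrow> integrable lebesgue (\<lambda>x. k (norm x) * h x) \<Longrightarrow>
        (LINT x|lebesgue. k (norm x) * v (norm (x::'a))) = (LINT x|lebesgue. k (norm x) * h x)"
    using radial_average_exists[OF h_meas] by blast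
  have h_ind: "integrable lebesgue (\<lambda>x. k (norm x) * h x)"
    if [measurable]: "k \<in> borel_measurable borel" and "\<And>r. \<bar>k r\<bar> \<le> M" "\<And>r. r > R \<Longrightarrow> k r = 0" for k :: "real \<Rightarrow> real" and M R
    using locally_integrable_times_test[OF h_loc, of "\<lambda>x. k (norm x)" M R] that by (simp add: mult.commute)
  have v_loc: "set_integrable lborel {a..b} v" if ab: "0 < a" "a < b" for a b
  proof -
    have iv: "integrable lebesgue (\<lambda>x::'a. indicator {a..b} (norm x) * v (norm x))"
      by (rule v_int[OF _ h_ind[of _ 1 b]]) (auto simp: indicator_def)
    have "locally_integrable (\<lambda>x::'a. indicator {a..b} (norm x) * v (norm x))"
      unfolding locally_integrable_def set_integrable_def
    proof (intro conjI allI impI)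
      fix K :: "'a set" assume "compact K"
      then have "K \<in> sets lebesgue" by (simp add: borel_compact sets_completionI_sets)
      then show "integrable lebesgue (\<lambda>x. indicator K x *\<^sub>R (indicator {a..b} (norm x) * v (norm x)))"
        using iv by (rule integrable_mult_indicator)
    qed (rule borel_measurable_integrable[OF iv])
    then have "set_integrable lborel {a..b} (\<lambda>r. indicator {a..b} r * v r)"
      by (rule locally_integrable_polar[OF _ _ AE_I2]) (use ab in auto)
    moreover have "indicator {a..b} r *\<^sub>R (indicator {a..b} r * v r) = indicator {a..b} r *\<^sub>R v r" for r
      by (simp add: indicator_def)
    ultimately show ?thesis by (simp only: set_integrable_def)
  qed
  obtain w0 where w0: "\<And>r s. 0 < r \<Longrightarrow> r \<le> s \<Longrightarrow> w0 s - w0 r = (LBINT t:{r..s}. v t)"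
    using integral_increments_exist[OF v_loc] by blast
  have w0_cont: "continuous_on {0<..} w0" by (rule integral_increments_continuous[OF v_loc w0])
  define z where "z r = indicator {0<..} r * (g r - w0 r)" for r
  have w0_ind: "(\<lambda>r. indicator {0<..} r *\<^sub>R w0 r) \<in> borel_measurable borel"
    by (rule borel_measurable_continuous_on_indicator[OF _ w0_cont]) simp
  have z_eq: "z = (\<lambda>r. indicator {0<..} r * g r - indicator {0<..} r *\<^sub>R w0 r)"
    by (auto simp: z_def algebra_simps)
  have z_meas[measurable]: "z \<in> borel_measurable borel" unfolding z_eq using w0_ind by measurable
  have z_int: "set_integrable lborel {a..b} z" if ab: "0 < a" "a < b" for a b
  proof -
    have "set_integrable lborel {a..b} (\<lambda>r. g r - w0 r)"
      by (intro set_integral_diff locally_integrable_polar[OF u_loc g ug ab(1)]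
          borel_integrable_atLeastAtMost' continuous_on_subset[OF w0_cont]) (use ab in auto)
    moreover have "indicator {a..b} r *\<^sub>R (g r - w0 r) = indicator {a..b} r *\<^sub>R z r" for r
      using ab by (auto simp: z_def indicator_def)
    ultimately show ?thesis by (simp only: set_integrable_def)
  qed
  have by_parts:
      "integrable lborel (\<lambda>x. w (norm x) * (grad \<phi> x \<bullet> b))"
      "integrable lborel (\<lambda>x. v (norm x) * ((x \<bullet> b) / norm x * \<phi> x))"
      "(LBINT x. w (norm x) * (grad \<phi> x \<bullet> b)) = - (LBINT x. v (norm x) * ((x \<bullet> b) / norm x * \<phi> x))"
    if w: "\<And>r s. 0 < r \<Longrightarrow> r \<le> s \<Longrightarrow> w s - w r = (LBINT t:{r..s}. v t)"
      and \<phi>: "test_function \<phi>" "b \<in> Basis" "0 < a" "a < R" "\<And>x. norm x \<notin> {a..R} \<Longrightarrow> \<phi> x = 0"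
    for w \<phi> and b :: 'a and a R
  proof -
    have w': "w r = w R - (LBINT s:{r..R}. v s)" if "r \<in> {a..R}" for r
      using w[of r R] that \<phi>(3) by simp
    note * = radial_integration_by_parts[where w = w, OF \<phi> v v_loc[OF \<phi>(3,4)] w']
    show "integrable lborel (\<lambda>x. w (norm x) * (grad \<phi> x \<bullet> b))" by (rule *(1))
    show "integrable lborel (\<lambda>x. v (norm x) * ((x \<bullet> b) / norm x * \<phi> x))" by (rule *(2))
    show "(LBINT x. w (norm x) * (grad \<phi> x \<bullet> b)) = - (LBINT x. v (norm x) * ((x \<bullet> b) / norm x * \<phi> x))"
      by (rule *(3))
  qed
  have u_grad: "integrable lebesgue (\<lambda>x. u x * (grad \<phi> x \<bullet> b))" if tf: "test_function \<phi>" and b: "b \<in> Basis" for \<phi> and b :: 'a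
  proof -
    obtain R where R: "0 < R" "\<And>x. norm x > R \<Longrightarrow> \<phi> x = 0" using test_function_support[OF tf] by blast
    have z: "grad \<phi> x \<bullet> b = 0" if "norm x > R" for x
    proof -
      have "grad \<phi> x = 0" by (rule grad_eq_0_if_locally_0[OF tf, of "- cball 0 R"]) (use R that in auto)
      then show ?thesis by simp
    qed
    obtain M where "\<And>x. \<bar>grad \<phi> x \<bullet> b\<bar> \<le> M"
      using bounded_if_compact_support[OF test_function_grad_continuous[OF tf b] z] by blast
    then show ?thesis
      by (intro locally_integrable_times_test[OF u_loc _ _ z]
          borel_measurable_continuous_onI[OF test_function_grad_continuous[OF tf b]])
  qed
  have G_phi: "integrable lebesgue (\<lambda>x. (G x \<bullet> b) * \<phi> x)" if tf: "test_function \<phi>" for \<phi> and b :: 'a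
  proof -
    obtain R where R: "0 < R" "\<And>x. norm x > R \<Longrightarrow> \<phi> x = 0" using test_function_support[OF tf] by blast
    obtain M where "\<And>x. \<bar>\<phi> x\<bar> \<le> M"
      using bounded_if_compact_support[OF C_k_continuous[OF test_function_C_k[OF tf, of 0]] R(2)] by blast
    then show ?thesis
      by (intro locally_integrable_times_test[OF locally_integrable_inner[OF G_loc] test_function_borel[OF tf] _ R(2)])
  qed
  have test0: "(LBINT r:{0<..}. 2 * r * deriv K (r\<^sup>2) * z r) = 0"
    if aR: "0 < a" "a < R" and K: "\<And>k. C_k k K" and K0: "\<And>t. t \<notin> {a\<^sup>2..R\<^sup>2} \<Longrightarrow> K t = 0" for K a R
  proof -
    let ?N = "real DIM('a)"
    define k where "k r = K (r\<^sup>2) * (r\<^sup>2) powr (- (?N / 2)) * r" for r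
    \<comment> \<open>Radial test fields involve \<open>G\<close> only through its radial component, so \<open>v\<close> can replace it.\<close>
    define \<phi> where "\<phi> b x = K (x \<bullet> x) * (x \<bullet> x) powr (- (real DIM('a) / 2)) * (x \<bullet> b)" for b x :: 'a
    define \<sigma> where "\<sigma> r = 2 * deriv K (r\<^sup>2) * r powr (2 - ?N)" for r
    note field = smooth_radial_vector_field[OF K aR(1) K0 aR(2), folded \<phi>_def]
    have [measurable]: "K \<in> borel_measurable borel" "deriv K \<in> borel_measurable borel"
      by (rule borel_measurable_continuous_onI[OF C_k_continuous[OF K[of 0]]],
          rule borel_measurable_continuous_onI[OF C_k_continuous[OF C_k_Suc_realE(2)[OF K[of "Suc 0"]]]])
    have [measurable]: "k \<in> borel_measurable borel" "\<sigma> \<in> borel_measurable borel"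
      unfolding k_def[abs_def] \<sigma>_def[abs_def] by measurable
    have S: "(\<Sum>b\<in>Basis. c * (grad (\<phi> b) x \<bullet> b)) = c * \<sigma> (norm x)" for c x
      unfolding sum_distrib_left[symmetric] using field(3)[of x] by (simp add: \<phi>_def[abs_def] \<sigma>_def)
    have rad: "(\<Sum>b\<in>Basis. (y \<bullet> b) * \<phi> b x) = k (norm x) * ((y \<bullet> x) / norm x)" for x y
    proof (cases "x = 0")
      case False
      have "(\<Sum>b\<in>Basis. (y \<bullet> b) * \<phi> b x) = K (x \<bullet> x) * (x \<bullet> x) powr (- (?N / 2)) * (y \<bullet> x)"
        unfolding \<phi>_def by (simp add: euclidean_inner[of y x] sum_distrib_left sum_distrib_right mult_ac)
      then show ?thesis using False by (simp add: k_def power2_norm_eq_inner)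
    qed (simp add: \<phi>_def k_def)
    have tf: "test_function (\<phi> b)" for b using field(1)[of b] by (simp add: \<phi>_def[abs_def])
    have supp: "norm x \<notin> {a..R} \<Longrightarrow> \<phi> b x = 0" for b x using field(2)[of x b] by (simp add: \<phi>_def)
    have iu: "integrable lebesgue (\<lambda>x. u x * \<sigma> (norm x))"
      unfolding S[symmetric] by (intro Bochner_Integration.integrable_sum u_grad tf)
    have "(LINT x|lebesgue. u x * \<sigma> (norm x)) = (\<Sum>b\<in>Basis. LINT x|lebesgue. u x * (grad (\<phi> b) x \<bullet> b))"
      unfolding S[symmetric] by (intro Bochner_Integration.integral_sum u_grad tf)
    also have "\<dots> = (\<Sum>b\<in>Basis. - (LINT x|lebesgue. (G x \<bullet> b) * \<phi> b x))"
      by (intro sum.cong refl weak tf)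
    also have "\<dots> = - (LINT x|lebesgue. (\<Sum>b\<in>Basis. (G x \<bullet> b) * \<phi> b x))"
      by (subst Bochner_Integration.integral_sum) (auto intro: G_phi tf simp: sum_negf)
    also have "\<dots> = - (LINT x|lebesgue. k (norm x) * h x)" by (simp add: rad h_def)
    finally have eq1: "(LINT x|lebesgue. u x * \<sigma> (norm x)) = - (LINT x|lebesgue. k (norm x) * h x)" .
    have kh: "integrable lebesgue (\<lambda>x. k (norm x) * h x)"
      unfolding h_def rad[symmetric] by (intro Bochner_Integration.integrable_sum G_phi tf)
    have iw: "integrable lborel (\<lambda>x::'a. w0 (norm x) * \<sigma> (norm x))"
      unfolding S[symmetric] by (intro Bochner_Integration.integrable_sum by_parts(1)[OF w0 tf _ aR supp])
    have kv: "(\<Sum>b\<in>Basis. v (norm x) * ((x \<bullet> b) / norm x * \<phi> b x)) = k (norm x) * v (norm x)" for x :: 'a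
    proof -
      have "(\<Sum>b\<in>Basis. v (norm x) * ((x \<bullet> b) / norm x * \<phi> b x)) = v (norm x) / norm x * (\<Sum>b\<in>Basis. (x \<bullet> b) * \<phi> b x)"
        by (simp add: sum_distrib_left)
      also have "\<dots> = k (norm x) * v (norm x)"
        unfolding rad by (cases "x = 0") (simp_all add: k_def power2_norm_eq_inner[symmetric] power2_eq_square)
      finally show ?thesis .
    qed
    have "(LBINT x. w0 (norm (x::'a)) * \<sigma> (norm x)) = (\<Sum>b\<in>Basis. LBINT x. w0 (norm x) * (grad (\<phi> b) x \<bullet> b))"
      unfolding S[symmetric] by (intro Bochner_Integration.integral_sum by_parts(1)[OF w0 tf _ aR supp])
    also have "\<dots> = (\<Sum>b\<in>Basis. - (LBINT x. v (norm x) * ((x \<bullet> b) / norm x * \<phi> b x)))"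
      by (intro sum.cong refl by_parts(3)[OF w0 tf _ aR supp])
    also have "\<dots> = - (LBINT x. (\<Sum>b\<in>Basis. v (norm x) * ((x \<bullet> b) / norm x * \<phi> b x)))"
    proof -
      have "(LBINT x. (\<Sum>b\<in>Basis. v (norm x) * ((x \<bullet> b) / norm x * \<phi> b x)))
          = (\<Sum>b\<in>Basis. LBINT x. v (norm x) * ((x \<bullet> b) / norm x * \<phi> b x))"
        by (rule Bochner_Integration.integral_sum) (rule by_parts(2)[OF w0 tf _ aR supp])
      then show ?thesis by (simp only: sum_negf)
    qed
    also have "\<dots> = - (LBINT x. k (norm x) * v (norm (x::'a)))" by (simp only: kv)
    also have "(LBINT x. k (norm x) * v (norm (x::'a))) = (LINT x|lebesgue. k (norm x) * v (norm (x::'a)))"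
      by (rule integral_completion[symmetric]) measurable
    also have "\<dots> = (LINT x|lebesgue. k (norm x) * h x)" by (rule v_avg[OF _ kh]) measurable
    finally have eq2: "(LBINT x. w0 (norm (x::'a)) * \<sigma> (norm x)) = (LINT x|lebesgue. u x * \<sigma> (norm x))"
      by (simp add: eq1)
    have iw': "integrable lebesgue (\<lambda>x::'a. w0 (norm x) * \<sigma> (norm x))"
      using iw by (subst integrable_completion) auto
    have "(LINT x|lebesgue. z (norm (x::'a)) * \<sigma> (norm x)) = (LINT x|lebesgue. u x * \<sigma> (norm x) - w0 (norm x) * \<sigma> (norm x))"
    proof (rule integral_cong_AE)
      show "AE x::'a in lebesgue. z (norm x) * \<sigma> (norm x) = u x * \<sigma> (norm x) - w0 (norm x) * \<sigma> (norm x)"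
        using ug AE_norm_pos by eventually_elim (simp add: z_def algebra_simps)
      show "(\<lambda>x::'a. z (norm x) * \<sigma> (norm x)) \<in> borel_measurable lebesgue"
        by (rule measurable_completion) measurable
      show "(\<lambda>x. u x * \<sigma> (norm x) - w0 (norm x) * \<sigma> (norm x)) \<in> borel_measurable lebesgue"
        using iu iw' by (intro borel_measurable_diff borel_measurable_integrable)
    qed
    also have "\<dots> = (LINT x|lebesgue. u x * \<sigma> (norm x)) - (LINT x|lebesgue. w0 (norm (x::'a)) * \<sigma> (norm x))"
      by (rule Bochner_Integration.integral_diff[OF iu iw'])
    also have "(LINT x|lebesgue. w0 (norm (x::'a)) * \<sigma> (norm x)) = (LBINT x. w0 (norm (x::'a)) * \<sigma> (norm x))"
      using iw by (intro integral_completion) auto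
    finally have "(LINT x|lebesgue. z (norm (x::'a)) * \<sigma> (norm x)) = 0" by (simp add: eq2)
    then have "sphere_area TYPE('a) * (LBINT r:{0<..}. r ^ (DIM('a) - 1) * (z r * \<sigma> r)) = 0"
      by (subst (asm) polar_integral) auto
    then have "(LBINT r:{0<..}. r ^ (DIM('a) - 1) * (z r * \<sigma> r)) = 0"
      using less_imp_neq[OF unit_ball_vol_pos[of "real DIM('a)"]] by simp
    moreover have "indicator {0<..} r *\<^sub>R (r ^ (DIM('a) - 1) * (z r * \<sigma> r)) = indicator {0<..} r *\<^sub>R (2 * r * deriv K (r\<^sup>2) * z r)" for r
    proof (cases "0 < r")
      case True
      have "real (DIM('a) - 1) = ?N - 1" by (simp add: of_nat_diff)
      then have "r ^ (DIM('a) - 1) = r powr (?N - 1)" using powr_realpow[OF True, of "DIM('a) - 1"] by simp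
      then have "r ^ (DIM('a) - 1) * r powr (2 - ?N) = r powr (?N - 1) * r powr (2 - ?N)" by simp
      also have "\<dots> = r" using True by (simp add: powr_add[symmetric])
      finally have "r ^ (DIM('a) - 1) * r powr (2 - ?N) = r" .
      moreover have "r ^ (DIM('a) - 1) * (z r * \<sigma> r) = (r ^ (DIM('a) - 1) * r powr (2 - ?N)) * (2 * deriv K (r\<^sup>2) * z r)"
        unfolding \<sigma>_def by (simp only: mult_ac)
      ultimately have "r ^ (DIM('a) - 1) * (z r * \<sigma> r) = 2 * r * deriv K (r\<^sup>2) * z r" by (simp only: mult_ac)
      then show ?thesis by (simp only:)
    qed simp
    ultimately show ?thesis by (simp only: set_lebesgue_integral_def)
  qed
  obtain C where C: "AE r in lborel. 0 < r \<longrightarrow> z r = C"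
    by (rule constant_if_radial_test_integrals_0[OF z_meas z_int test0])
  define w where "w r = w0 r + C" for r
  have w_inc: "w s - w r = (LBINT t:{r..s}. v t)" if "0 < r" "r \<le> s" for r s
    using w0[OF that] by (simp add: w_def)
  have gw: "AE r in lborel. 0 < r \<longrightarrow> g r = w r"
    using C by eventually_elim (auto simp: z_def w_def)
  have "AE x::'a in lebesgue. z (norm x) = C" using C by (subst polar_AE) auto
  then have uw: "AE x in lebesgue. u x = w (norm x)"
    using ug AE_norm_pos by eventually_elim (auto simp: z_def w_def)
  have comp: "AE x in lebesgue. G x \<bullet> b = v (norm x) * ((x \<bullet> b) / norm x)" if b: "b \<in> Basis" for b
  proof -
    define a where "a n = 1 / real (n + 2)" for n
    define R where "R n = real (n + 2)" for n
    have aR: "0 < a n" "a n < R n" for n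
    proof -
      have "a n < 1" "1 < R n" by (simp_all add: a_def R_def)
      then show "a n < R n" by (rule less_trans)
    qed (simp add: a_def)
    \<comment> \<open>A cutoff to an annulus, as integration by parts was shown for test functions vanishing near the origin.\<close>
    define \<eta> where "\<eta> n x = bump ((a n)\<^sup>2) ((R n)\<^sup>2) 1 (x \<bullet> x)" for n and x :: 'a
    have \<eta>0: "\<eta> n x = 0" if x: "norm x \<notin> {a n..R n}" for n x
    proof -
      have "a n < norm x \<and> norm x < R n" if "(a n)\<^sup>2 < (norm x)\<^sup>2" "(norm x)\<^sup>2 < (R n)\<^sup>2"
        using power2_less_imp_less[OF that(1)] power2_less_imp_less[OF that(2)] aR[of n] by simp
      then have "x \<bullet> x \<notin> {(a n)\<^sup>2<..<(R n)\<^sup>2}"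
        using x by (auto simp: power2_norm_eq_inner)
      then show ?thesis unfolding \<eta>_def by (rule bump_eq_0)
    qed
    have \<eta>_smooth: "C_k k (\<eta> n)" for k n
      unfolding \<eta>_def[abs_def] by (rule C_k_compose[OF C_k_bump C_k_norm_square])
    have tf: "test_function (\<lambda>x. \<eta> n x * \<phi> x)" if \<phi>: "\<And>k. C_k k \<phi>" for \<phi> n
    proof (rule test_functionI[where R = "R n"])
      show "C_k k (\<lambda>x. \<eta> n x * \<phi> x)" for k by (rule C_k_mult[OF \<eta>_smooth \<phi>])
    qed (simp add: \<eta>0)
    have tf\<eta>: "test_function (\<eta> n)" for n using tf[OF C_k_const[of _ 1], of n] by simp
    have "AE x in lebesgue. (G x \<bullet> b) * \<eta> n x - v (norm x) * ((x \<bullet> b) / norm x * \<eta> n x) = 0" for n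
    proof (rule fundamental_lemma)
      have iv: "integrable lebesgue (\<lambda>x. v (norm x) * ((x \<bullet> b) / norm x * \<psi> x))"
        if "test_function \<psi>" "\<And>x. norm x \<notin> {a n..R n} \<Longrightarrow> \<psi> x = 0" for \<psi>
        using by_parts(2)[OF w_inc that(1) b aR that(2)] by (subst integrable_completion) auto
      show "integrable lebesgue (\<lambda>x. (G x \<bullet> b) * \<eta> n x - v (norm x) * ((x \<bullet> b) / norm x * \<eta> n x))"
        by (intro Bochner_Integration.integrable_diff G_phi tf\<eta> iv \<eta>0)
      fix \<phi> :: "'a \<Rightarrow> real" assume \<phi>: "test_function \<phi>"
      define \<psi> where "\<psi> x = \<eta> n x * \<phi> x" for x
      have \<psi>: "test_function \<psi>" unfolding \<psi>_def[abs_def] by (rule tf[OF test_function_C_k[OF \<phi>]])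
      have \<psi>0: "\<psi> x = 0" if "norm x \<notin> {a n..R n}" for x using \<eta>0[OF that] by (simp add: \<psi>_def)
      have "(LINT x|lebesgue. ((G x \<bullet> b) * \<eta> n x - v (norm x) * ((x \<bullet> b) / norm x * \<eta> n x)) * \<phi> x)
          = (LINT x|lebesgue. (G x \<bullet> b) * \<psi> x - v (norm x) * ((x \<bullet> b) / norm x * \<psi> x))"
        by (rule Bochner_Integration.integral_cong) (auto simp: \<psi>_def algebra_simps)
      also have "\<dots> = (LINT x|lebesgue. (G x \<bullet> b) * \<psi> x) - (LINT x|lebesgue. v (norm x) * ((x \<bullet> b) / norm x * \<psi> x))"
        by (rule Bochner_Integration.integral_diff[OF G_phi[OF \<psi>] iv[OF \<psi> \<psi>0]])
      also have "(LINT x|lebesgue. (G x \<bullet> b) * \<psi> x) = - (LINT x|lebesgue. u x * (grad \<psi> x \<bullet> b))"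
        using weak[OF \<psi> b] by simp
      also have "(LINT x|lebesgue. u x * (grad \<psi> x \<bullet> b)) = (LINT x|lebesgue. w (norm x) * (grad \<psi> x \<bullet> b))"
      proof (rule integral_cong_AE)
        show "AE x in lebesgue. u x * (grad \<psi> x \<bullet> b) = w (norm x) * (grad \<psi> x \<bullet> b)"
          using uw by eventually_elim simp
        show "(\<lambda>x. u x * (grad \<psi> x \<bullet> b)) \<in> borel_measurable lebesgue"
          using u_grad[OF \<psi> b] by (rule borel_measurable_integrable)
        show "(\<lambda>x. w (norm x) * (grad \<psi> x \<bullet> b)) \<in> borel_measurable lebesgue"
          by (rule measurable_completion[OF borel_measurable_integrable[OF by_parts(1)[OF w_inc \<psi> b aR \<psi>0]]])
      qed
      also have "\<dots> = (LBINT x. w (norm x) * (grad \<psi> x \<bullet> b))"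
        by (rule integral_completion[OF borel_measurable_integrable[OF by_parts(1)[OF w_inc \<psi> b aR \<psi>0]]])
      also have "\<dots> = - (LBINT x. v (norm x) * ((x \<bullet> b) / norm x * \<psi> x))"
        by (rule by_parts(3)[OF w_inc \<psi> b aR \<psi>0])
      also have "(LBINT x. v (norm x) * ((x \<bullet> b) / norm x * \<psi> x)) = (LINT x|lebesgue. v (norm x) * ((x \<bullet> b) / norm x * \<psi> x))"
        using by_parts(2)[OF w_inc \<psi> b aR \<psi>0] by (intro integral_completion[symmetric]) auto
      finally show "(LINT x|lebesgue. ((G x \<bullet> b) * \<eta> n x - v (norm x) * ((x \<bullet> b) / norm x * \<eta> n x)) * \<phi> x) = 0" by simp
    qed
    then have "AE x in lebesgue. \<forall>n. (G x \<bullet> b) * \<eta> n x - v (norm x) * ((x \<bullet> b) / norm x * \<eta> n x) = 0"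
      by (subst AE_all_countable) blast
    then show ?thesis
      using AE_norm_pos
    proof eventually_elim
      case (elim x)
      obtain n1 n2 :: nat where n: "1 / norm x < real n1" "norm x < real n2" using reals_Archimedean2 by metis
      define n where "n = n1 + n2"
      have "1 / norm x < real (n + 2)" "norm x < R n" using n by (auto simp: n_def R_def)
      then have "a n < norm x" "norm x < R n" using elim(2) by (simp_all add: a_def divide_less_eq mult.commute)
      then have "(a n)\<^sup>2 < (norm x)\<^sup>2" "(norm x)\<^sup>2 < (R n)\<^sup>2" using aR[of n] by (auto intro!: power_strict_mono)
      then have "0 < \<eta> n x" unfolding \<eta>_def by (intro bump_pos) (auto simp: power2_norm_eq_inner)
      moreover have "(G x \<bullet> b) * \<eta> n x = (v (norm x) * ((x \<bullet> b) / norm x)) * \<eta> n x"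
        using elim(1)[rule_format, of n] by simp
      ultimately show ?case using mult_right_cancel[of "\<eta> n x" "G x \<bullet> b" "v (norm x) * ((x \<bullet> b) / norm x)"] by simp
    qed
  qed
  have "AE x in lebesgue. \<forall>b\<in>Basis. G x \<bullet> b = v (norm x) * ((x \<bullet> b) / norm x)"
    using comp by (intro AE_finite_allI) auto
  then have G_eq: "AE x in lebesgue. G x = (v (norm x) / norm x) *\<^sub>R x"
  proof eventually_elim
    case (elim x)
    show ?case by (rule euclidean_eqI) (simp add: elim)
  qed
  show thesis by (rule that[OF v v_loc w_inc gw G_eq])
qed

section \<open>The ordinary differential equation\<close>

text \<open>
  For comparison arguments that start at the singular point 0.
\<close>

lemma nonneg_if_powr_lower_bound:
  fixes r :: real
  assumes r: "0 < r" and le: "\<And>t. 0 < t \<Longrightarrow> t \<le> r \<Longrightarrow> - (c * t powr e) \<le> A" and e: "0 < e"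
  shows "0 \<le> A"
proof -
  have "((\<lambda>t. t powr e) \<longlongrightarrow> 0) (at_right 0)" using e by real_asymp
  then have "((\<lambda>t. - (c * t powr e)) \<longlongrightarrow> - (c * 0)) (at_right 0)" by (intro tendsto_intros)
  moreover have "eventually (\<lambda>t. - (c * t powr e) \<le> A) (at_right 0)"
    unfolding eventually_at_right_field using r le by (intro exI[of _ r]) auto
  ultimately have "- (c * 0) \<le> A" by (intro tendsto_upperbound) auto
  then show ?thesis by simp
qed

text \<open>
  Here \<open>- y\<close> is the derivative of \<open>U\<close>, and \<open>E(r)\<close> is the energy in the ball of radius \<open>r\<close>: the
  integrand \<open>r^(N-1) y^p\<close> equals \<open>F y\<close>. Finite energy near 0 is essential: for some admissible \<open>q\<close>, a
  multiple of \<open>r^(-(p+\<gamma>)/(q-p+1))\<close> satisfies all the conditions on \<open>U\<close> and \<open>F\<close>.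
\<close>

lemma decreasing_solution_eq_0:
  fixes U F E :: "real \<Rightarrow> real" and N p q \<gamma> :: real
  defines "y \<equiv> \<lambda>r. (F r / r powr (N - 1)) powr (1 / (p - 1))"
  assumes p: "1 < p" "p < N" and \<gamma>: "0 \<le> \<gamma>" and q: "p - 1 < q"
    and subcritical: "q < ((N + \<gamma>) * (p - 1) + p + \<gamma>) / (N - p)"
    and dU: "\<And>r. 0 < r \<Longrightarrow> (U has_real_derivative - y r) (at r)"
    and dF: "\<And>r. 0 < r \<Longrightarrow> (F has_real_derivative r powr (N - 1 + \<gamma>) * U r powr q) (at r)"
    and dE: "\<And>r. 0 < r \<Longrightarrow> (E has_real_derivative F r * y r) (at r)"
    and U0: "\<And>r. 0 < r \<Longrightarrow> 0 \<le> U r" and F0: "\<And>r. 0 < r \<Longrightarrow> 0 \<le> F r"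
    and E0: "\<And>r. 0 < r \<Longrightarrow> 0 \<le> E r"
    and limF: "(F \<longlongrightarrow> 0) (at_right 0)" and limE: "(E \<longlongrightarrow> 0) (at_right 0)"
    and r0: "0 < r0"
  shows "U r0 = 0"
proof (rule ccontr)
  assume "U r0 \<noteq> 0"
  with U0[OF r0] have Ur0: "0 < U r0" by simp
  define m where "m = 1 / (p - 1)"
  have m: "m > 0" "m * (p - 1) = 1" using p by (auto simp: m_def)
  have y_m: "y r = (F r / r powr (N - 1)) powr m" for r by (simp add: y_def m_def)
  have q0: "q > 0" using p q by linarith
  have U_anti: "U s \<le> U r" if "0 < r" "r \<le> s" for r s
  proof (rule DERIV_nonpos_imp_nonincreasing[OF that(2)])
    fix x assume "r \<le> x" "x \<le> s"
    then show "\<exists>y. (U has_real_derivative y) (at x) \<and> y \<le> 0"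
      using dU[of x] that(1) by (intro exI[of _ "- y x"]) (auto simp: y_def)
  qed
  have F_mono: "F r \<le> F s" if "0 < r" "r \<le> s" for r s
  proof (rule DERIV_nonneg_imp_nondecreasing[OF that(2)])
    fix x assume "r \<le> x" "x \<le> s"
    then show "\<exists>y. (F has_real_derivative y) (at x) \<and> 0 \<le> y"
      using dF[of x] that(1) by (intro exI conjI) auto
  qed
  \<comment> \<open>The monotonicity of \<open>U\<close> bounds the integrand of \<open>F\<close> on \<open>(0, r)\<close> from below
    through \<open>U(s) \<ge> U(r)\<close>.\<close>
  have F_lower: "U r powr q * r powr (N + \<gamma>) / (N + \<gamma>) \<le> F r" if r: "0 < r" for r
  proof -
    define c where "c = U r powr q / (N + \<gamma>)"
    have step: "F t - c * t powr (N + \<gamma>) \<le> F r - c * r powr (N + \<gamma>)" if t: "0 < t" "t \<le> r" for t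
    proof (rule DERIV_nonneg_imp_nondecreasing[OF t(2)])
      fix x assume x: "t \<le> x" "x \<le> r"
      have "((\<lambda>t. F t - c * t powr (N + \<gamma>)) has_real_derivative
          (x powr (N - 1 + \<gamma>) * U x powr q - c * ((N + \<gamma>) * x powr (N + \<gamma> - 1)))) (at x)"
        using x t(1) by (auto intro!: derivative_eq_intros dF)
      moreover have "c * (N + \<gamma>) = U r powr q" using p \<gamma> by (simp add: c_def)
      then have "c * ((N + \<gamma>) * x powr (N + \<gamma> - 1)) = U r powr q * x powr (N - 1 + \<gamma>)"
        by (simp add: mult.assoc[symmetric] add_diff_eq diff_add_eq)
      then have "x powr (N - 1 + \<gamma>) * U x powr q - c * ((N + \<gamma>) * x powr (N + \<gamma> - 1))
          = x powr (N - 1 + \<gamma>) * (U x powr q - U r powr q)"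
        by (simp only: right_diff_distrib mult.commute)
      moreover have "0 \<le> x powr (N - 1 + \<gamma>) * (U x powr q - U r powr q)"
        using U_anti[of x r] U0[of r] x t(1) q0 r by (auto intro!: mult_nonneg_nonneg powr_mono2)
      ultimately show "\<exists>y. ((\<lambda>t. F t - c * t powr (N + \<gamma>)) has_real_derivative y) (at x) \<and> 0 \<le> y"
        by metis
    qed
    have "- (c * t powr (N + \<gamma>)) \<le> F r - c * r powr (N + \<gamma>)" if "0 < t" "t \<le> r" for t
      using step[OF that] F0[OF that(1)] by simp
    then have "0 \<le> F r - c * r powr (N + \<gamma>)"
      by (rule nonneg_if_powr_lower_bound[OF r]) (use p \<gamma> in auto)
    then show ?thesis by (simp add: c_def)
  qed
  have F_pos: "0 < F r" if r: "0 < r" for r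
  proof -
    have "0 < U (min r r0)" using U_anti[of "min r r0" r0] Ur0 r r0 by auto
    then have "0 < U (min r r0) powr q * (min r r0) powr (N + \<gamma>) / (N + \<gamma>)"
      using p \<gamma> r r0 by (auto intro!: divide_pos_pos)
    also have "\<dots> \<le> F (min r r0)" using r r0 by (intro F_lower) auto
    also have "\<dots> \<le> F r" using r r0 by (intro F_mono) auto
    finally show ?thesis .
  qed
  have y_pos: "0 < y r" if "0 < r" for r
    using F_pos[OF that] that by (simp add: y_def)
  have U_pos: "0 < U r" if r: "0 < r" for r
  proof -
    have "U (r + 1) < U r"
    proof (rule DERIV_neg_imp_decreasing[of r "r + 1" U])
      fix x assume "r \<le> x" "x \<le> r + 1"
      then show "\<exists>y. (U has_real_derivative y) (at x) \<and> y < 0"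
        using dU[of x] y_pos[of x] r by (intro exI[of _ "- y x"]) auto
    qed simp
    then show ?thesis using U0[of "r + 1"] r by simp
  qed

  \<comment> \<open>Inserting the lower bound for \<open>F\<close> into the equation gives a differential inequality
    for a negative power of \<open>U\<close>; the exponent \<open>s\<close> is positive because \<open>q > p - 1\<close>.\<close>
  define s where "s = q * m - 1"
  define a where "a = (\<gamma> + 1) * m + 1"
  have s: "s > 0"
  proof -
    have "(p - 1) * m < q * m" using m q by (intro mult_strict_right_mono) auto
    then show ?thesis using m by (simp add: s_def mult.commute)
  qed
  have a: "a > 0" using m \<gamma> by (simp add: a_def add_nonneg_pos)
  define C where "C = s * (1 / (N + \<gamma>)) powr m / a"
  have C: "C > 0" using s a p \<gamma> by (simp add: C_def)
  have decay: "C * r powr a \<le> U r powr (- s)" if r: "0 < r" for r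
  proof -
    have step: "U t powr (- s) - C * t powr a \<le> U r powr (- s) - C * r powr a"
      if t: "0 < t" "t \<le> r" for t
    proof (rule DERIV_nonneg_imp_nondecreasing[OF t(2)])
      fix x assume x: "t \<le> x" "x \<le> r"
      then have x0: "0 < x" using t by simp
      have "((\<lambda>t. U t powr (- s) - C * t powr a) has_real_derivative
          (s * U x powr (- s - 1) * y x - C * (a * x powr (a - 1)))) (at x)"
        using x0 U_pos[OF x0] by (auto intro!: derivative_eq_intros dU)
      moreover have "C * (a * x powr (a - 1)) \<le> s * U x powr (- s - 1) * y x"
      proof -
        have "x powr (N + \<gamma>) / x powr (N - 1) = x powr (\<gamma> + 1)"
          using x0 by (simp add: powr_diff[symmetric])
        then have "U x powr q * (1 / (N + \<gamma>)) * x powr (\<gamma> + 1)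
            = (U x powr q * x powr (N + \<gamma>) / (N + \<gamma>)) / x powr (N - 1)"
          by (metis (no_types, lifting) divide_divide_eq_left' mult.commute mult.left_neutral times_divide_eq_left times_divide_eq_right)
        also have "\<dots> \<le> F x / x powr (N - 1)"
          using F_lower[OF x0] by (intro divide_right_mono) auto
        finally have "(U x powr q * (1 / (N + \<gamma>)) * x powr (\<gamma> + 1)) powr m \<le> y x"
          unfolding y_m using m p \<gamma> by (intro powr_mono2) auto
        moreover have "(U x powr q * (1 / (N + \<gamma>)) * x powr (\<gamma> + 1)) powr m
            = U x powr (q * m) * (1 / (N + \<gamma>)) powr m * x powr (a - 1)"
          using p \<gamma> by (simp add: powr_mult powr_powr powr_divide a_def)
        ultimately have "U x powr (- s - 1) * (U x powr (q * m) * (1 / (N + \<gamma>)) powr m * x powr (a - 1))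
            \<le> U x powr (- s - 1) * y x"
          by (intro mult_left_mono) auto
        moreover have "U x powr (- s - 1) * U x powr (q * m) = 1"
          using U_pos[OF x0] by (simp add: powr_add[symmetric] s_def)
        ultimately have "(1 / (N + \<gamma>)) powr m * x powr (a - 1) \<le> U x powr (- s - 1) * y x"
          by (simp add: mult.assoc[symmetric])
        then have "s * ((1 / (N + \<gamma>)) powr m * x powr (a - 1)) \<le> s * (U x powr (- s - 1) * y x)"
          using s by (intro mult_left_mono) auto
        then show ?thesis using a by (simp add: C_def mult.assoc)
      qed
      ultimately show "\<exists>y. ((\<lambda>t. U t powr (- s) - C * t powr a) has_real_derivative y) (at x) \<and> 0 \<le> y"
        by (intro exI conjI) auto
    qed
    have "- (C * t powr a) \<le> U r powr (- s) - C * r powr a" if "0 < t" "t \<le> r" for t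
      using step[OF that] powr_ge_zero[of "U t" "- s"] by linarith
    then have "0 \<le> U r powr (- s) - C * r powr a"
      by (rule nonneg_if_powr_lower_bound[OF r]) (use a in auto)
    then show ?thesis by simp
  qed
  have U_upper: "U r powr e \<le> C powr (- e / s) * r powr (- (a * e / s))" if r: "0 < r" and e: "0 \<le> e" for r e
  proof -
    have "(U r powr (- s)) powr (- e / s) \<le> (C * r powr a) powr (- e / s)"
      using decay[OF r] C r s e by (intro powr_mono2') (auto simp: divide_nonpos_pos)
    moreover have "(U r powr (- s)) powr (- e / s) = U r powr e" using s by (simp add: powr_powr)
    moreover have "(C * r powr a) powr (- e / s) = C powr (- e / s) * r powr (- (a * e / s))"
      using C by (simp add: powr_mult powr_powr)
    ultimately show ?thesis by simp
  qed

  \<comment> \<open>The Pohozaev function. The term with \<open>|U'|^p\<close> is expressed through \<open>F\<close>, whose derivative is known.\<close>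
  define H where "H r = (p - 1) / p * F r powr (p * m) * r powr (- (N - p) * m)
      + r powr (N + \<gamma>) * U r powr (q + 1) / (q + 1) - (N - p) / p * F r * U r" for r
  define \<kappa> where "\<kappa> = (N + \<gamma>) / (q + 1) - (N - p) / p"
  have \<kappa>: "\<kappa> > 0"
  proof -
    have "q * (N - p) < (N + \<gamma>) * (p - 1) + p + \<gamma>"
      using subcritical p by (simp add: field_simps)
    then have "(N - p) * (q + 1) < p * (N + \<gamma>)" by (simp add: algebra_simps)
    then have "(N - p) / p < (N + \<gamma>) / (q + 1)" using p q0 by (simp add: divide_simps mult.commute)
    then show ?thesis by (simp add: \<kappa>_def)
  qed
  have dH: "(H has_real_derivative \<kappa> * r powr (N + \<gamma> - 1) * U r powr (q + 1)) (at r)" if r: "0 < r" for r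
  proof -
    have pm: "p * m - 1 = m" using m by (simp add: algebra_simps)
    have d: "(H has_real_derivative
       (p - 1) / p * (p * m * F r powr (p * m - 1) * (r powr (N - 1 + \<gamma>) * U r powr q)) * r powr (- (N - p) * m)
       + (p - 1) / p * F r powr (p * m) * ((- (N - p) * m) * r powr (- (N - p) * m - 1))
       + ((N + \<gamma>) * r powr (N + \<gamma> - 1) * U r powr (q + 1)
          + r powr (N + \<gamma>) * ((q + 1) * U r powr (q + 1 - 1) * (- y r))) / (q + 1)
       - (N - p) / p * ((r powr (N - 1 + \<gamma>) * U r powr q) * U r + F r * (- y r))) (at r)"
      unfolding H_def[abs_def]
    proof (intro DERIV_diff DERIV_add DERIV_cdivide)
      note dFp = DERIV_fun_powr[OF dF[OF r] F_pos[OF r], of "p * m"]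
      note dUp = DERIV_fun_powr[OF dU[OF r] U_pos[OF r], of "q + 1"]
      show "((\<lambda>r. (p - 1) / p * F r powr (p * m) * r powr (- (N - p) * m)) has_real_derivative
         (p - 1) / p * (p * m * F r powr (p * m - 1) * (r powr (N - 1 + \<gamma>) * U r powr q)) * r powr (- (N - p) * m)
         + (p - 1) / p * F r powr (p * m) * ((- (N - p) * m) * r powr (- (N - p) * m - 1))) (at r)"
        by (rule DERIV_cong[OF DERIV_mult[OF DERIV_cmult[OF dFp] has_real_derivative_powr[OF r]]]) simp
      show "((\<lambda>r. r powr (N + \<gamma>) * U r powr (q + 1)) has_real_derivative
          (N + \<gamma>) * r powr (N + \<gamma> - 1) * U r powr (q + 1)
          + r powr (N + \<gamma>) * ((q + 1) * U r powr (q + 1 - 1) * (- y r))) (at r)"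
        by (rule DERIV_cong[OF DERIV_mult[OF has_real_derivative_powr[OF r] dUp]]) simp
      show "((\<lambda>r. (N - p) / p * F r * U r) has_real_derivative
          (N - p) / p * ((r powr (N - 1 + \<gamma>) * U r powr q) * U r + F r * (- y r))) (at r)"
        by (rule DERIV_cong[OF DERIV_mult[OF DERIV_cmult[OF dF[OF r]] dU[OF r]]]) (simp only: distrib_left mult.assoc mult.commute mult.left_commute add.commute)
    qed
    have y: "y r = F r powr m * r powr (- (N - 1) * m)"
    proof -
      have "y r = F r powr m / r powr ((N - 1) * m)"
        unfolding y_m using F_pos[OF r] r by (simp add: powr_divide powr_powr)
      then show ?thesis by (simp add: powr_minus_divide[symmetric] divide_inverse powr_minus[symmetric] del: minus_diff_eq mult_minus_left)
    qed
    have c1: "(p - 1) / p * (p * m) = 1" "(p - 1) / p * ((N - p) * m) = (N - p) / p"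
      using m p by (auto simp: field_simps)
    have t1: "r powr (N - 1 + \<gamma>) * r powr (- (N - p) * m) = r powr (N + \<gamma>) * r powr (- (N - 1) * m)"
    proof -
      have "(N - p) * m = (N - 1) * m - 1" using m by (simp add: algebra_simps)
      then have "N - 1 + \<gamma> + - (N - p) * m = N + \<gamma> + - (N - 1) * m" unfolding mult_minus_left by linarith
      then show ?thesis unfolding powr_add[symmetric] by (rule arg_cong)
    qed
    have t2: "F r powr (p * m) * r powr (- (N - p) * m - 1) = F r * y r"
    proof -
      have "- (N - p) * m - 1 = - (N - 1) * m" "p * m = 1 + m" using m by (auto simp: algebra_simps)
      then show ?thesis unfolding y using F_pos[OF r] by (simp add: powr_add)
    qed
    have t3: "U r powr (q + 1) = U r powr q * U r" using U_pos[OF r] by (simp add: powr_add)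
    have e1: "(p - 1) / p * (p * m * F r powr (p * m - 1) * (r powr (N - 1 + \<gamma>) * U r powr q)) * r powr (- (N - p) * m)
        = r powr (N + \<gamma>) * U r powr q * y r"
    proof -
      have "(p - 1) / p * (p * m * F r powr (p * m - 1) * (r powr (N - 1 + \<gamma>) * U r powr q)) * r powr (- (N - p) * m)
        = ((p - 1) / p * (p * m)) * (F r powr m * U r powr q) * (r powr (N - 1 + \<gamma>) * r powr (- (N - p) * m))"
        unfolding pm by (simp add: mult_ac)
      then show ?thesis unfolding c1 t1 y by (simp add: mult_ac)
    qed
    have e2: "(p - 1) / p * F r powr (p * m) * ((- (N - p) * m) * r powr (- (N - p) * m - 1))
        = - ((N - p) / p * (F r * y r))"
    proof -
      have "(p - 1) / p * F r powr (p * m) * ((- (N - p) * m) * r powr (- (N - p) * m - 1))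
         = - ((p - 1) / p * ((N - p) * m)) * (F r powr (p * m) * r powr (- (N - p) * m - 1))"
        by (simp add: algebra_simps)
      then show ?thesis unfolding c1 t2 by simp
    qed
    have e3: "((N + \<gamma>) * r powr (N + \<gamma> - 1) * U r powr (q + 1)
          + r powr (N + \<gamma>) * ((q + 1) * U r powr (q + 1 - 1) * (- y r))) / (q + 1)
        = (N + \<gamma>) / (q + 1) * r powr (N + \<gamma> - 1) * U r powr (q + 1) - r powr (N + \<gamma>) * U r powr q * y r"
      using q0 by (simp add: field_simps)
    have e4: "(r powr (N - 1 + \<gamma>) * U r powr q) * U r = r powr (N + \<gamma> - 1) * U r powr (q + 1)"
      unfolding t3 by (simp add: algebra_simps)
    show ?thesis
      using d unfolding e1 e2 e3 e4 by (simp add: \<kappa>_def algebra_simps)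
  qed
  have H_less: "H r < H t" if "0 < r" "r < t" for r t
  proof (rule DERIV_pos_imp_increasing[OF that(2)])
    fix x assume "r \<le> x" "x \<le> t"
    then show "\<exists>y. (H has_real_derivative y) (at x) \<and> 0 < y"
      using dH[of x] that(1) U_pos[of x] \<kappa> by (intro exI conjI[rotated]) auto
  qed
  \<comment> \<open>Since \<open>F\<close> increases, \<open>F(r) (U(r) - U(d))\<close> is at most the energy between the radii \<open>r\<close> and \<open>d\<close>.\<close>
  have FU_lim: "((\<lambda>r. F r * U r) \<longlongrightarrow> 0) (at_right 0)"
  proof (rule tendstoI)
    fix e :: real assume e: "e > 0"
    have "eventually (\<lambda>r. E r < e / 2) (at_right 0)"
      using limE e by (intro order_tendstoD) auto
    then obtain b where b: "b > 0" "\<And>r. 0 < r \<Longrightarrow> r < b \<Longrightarrow> E r < e / 2"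
      unfolding eventually_at_right_field by auto
    define d where "d = b / 2"
    have d: "0 < d" "E d < e / 2" using b by (auto simp: d_def)
    have est: "F r * (U r - U d) \<le> E d" if r: "0 < r" "r < d" for r
    proof -
      have "E r + F r * U r \<le> E d + F r * U d"
      proof (rule DERIV_nonneg_imp_nondecreasing[of r d])
        show "r \<le> d" using r by simp
        fix x assume x: "r \<le> x" "x \<le> d"
        have "((\<lambda>t. E t + F r * U t) has_real_derivative (F x - F r) * y x) (at x)"
          using r x by (auto intro!: derivative_eq_intros dE dU simp: algebra_simps)
        moreover have "0 \<le> (F x - F r) * y x"
          using F_mono[of r x] y_pos[of x] r x by (intro mult_nonneg_nonneg) auto
        ultimately show "\<exists>y. ((\<lambda>t. E t + F r * U t) has_real_derivative y) (at x) \<and> 0 \<le> y" by blast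
      qed
      then show ?thesis using E0[OF r(1)] by (simp add: algebra_simps)
    qed
    have "((\<lambda>r. F r * U d) \<longlongrightarrow> 0 * U d) (at_right 0)" by (intro tendsto_intros limF)
    then have "eventually (\<lambda>r. F r * U d < e / 2) (at_right 0)"
      using e by (intro order_tendstoD) auto
    moreover have "eventually (\<lambda>r. 0 < r \<and> r < d) (at_right 0)"
      unfolding eventually_at_right_field using d by blast
    ultimately show "eventually (\<lambda>r. dist (F r * U r) 0 < e) (at_right 0)"
    proof eventually_elim
      case (elim r)
      then have "F r * U r < e" using est[of r] d by (simp add: algebra_simps)
      moreover have "0 \<le> F r * U r" using F0[of r] U0[of r] elim by simp
      ultimately show ?case by simp
    qed
  qed
  have H_nonneg: "0 \<le> H r" if r: "0 < r" for r
  proof -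
    have "((\<lambda>t. - ((N - p) / p) * (F t * U t)) \<longlongrightarrow> - ((N - p) / p) * 0) (at_right 0)"
      by (intro tendsto_intros FU_lim)
    moreover have "eventually (\<lambda>t. - ((N - p) / p) * (F t * U t) \<le> H r) (at_right 0)"
      unfolding eventually_at_right_field
    proof (intro exI[of _ r] conjI allI impI r)
      fix t assume t: "0 < t" "t < r"
      have "0 \<le> (p - 1) / p * F t powr (p * m) * t powr (- (N - p) * m)"
        "0 \<le> t powr (N + \<gamma>) * U t powr (q + 1) / (q + 1)"
        using p q0 by auto
      then have "- ((N - p) / p) * (F t * U t) \<le> H t" unfolding H_def by simp
      then show "- ((N - p) / p) * (F t * U t) \<le> H r" using H_less[OF t] by simp
    qed
    ultimately have "- ((N - p) / p) * 0 \<le> H r" by (intro tendsto_upperbound) auto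
    then show ?thesis by simp
  qed
  have H1: "0 < H 1" using H_nonneg[of "1/2"] H_less[of "1/2" 1] by simp

  \<comment> \<open>By the mean value theorem, each interval \<open>(r, 2r)\<close> contains a point where the
    derivative is at most \<open>U(r) / r\<close> in absolute value; there \<open>H\<close> is bounded by \<open>B(r)\<close>.\<close>
  define B where "B r = 2 powr N * (C powr (- p / s) * r powr (N - p - a * p / s))
      + 2 powr (N + \<gamma>) * (C powr (- (q + 1) / s) * r powr (N + \<gamma> - a * (q + 1) / s))" for r
  have HB: "H 1 \<le> B r" if r: "r \<ge> 1" for r
  proof -
    have r0: "0 < r" using r by simp
    obtain \<xi> where \<xi>: "r < \<xi>" "\<xi> < 2 * r" "U (2 * r) - U r = (2 * r - r) * (- y \<xi>)"
      using MVT2[of r "2 * r" U "\<lambda>r. - y r"] dU r0 by auto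
    have \<xi>0: "0 < \<xi>" using \<xi> r0 by simp
    have "r * y \<xi> \<le> U r" using \<xi>(3) U0[of "2 * r"] r0 by (simp add: algebra_simps)
    then have y1: "y \<xi> \<le> U r / r" using r0 by (simp add: field_simps)
    have "F \<xi> powr (p * m) * \<xi> powr (- (N - p) * m) = \<xi> powr N * y \<xi> powr p"
    proof -
      have "N - (N - 1) * (m * p) = - (N - p) * m"
        using m by (simp add: algebra_simps)
      then have "\<xi> powr N * \<xi> powr (- ((N - 1) * (m * p))) = \<xi> powr (- (N - p) * m)"
        by (simp add: powr_add[symmetric])
      moreover have "y \<xi> powr p = F \<xi> powr (p * m) * \<xi> powr (- ((N - 1) * (m * p)))"
        unfolding y_m using F_pos[OF \<xi>0] \<xi>0
        by (simp add: powr_divide powr_powr powr_minus_divide mult_ac)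
      ultimately show ?thesis by (simp add: algebra_simps)
    qed
    then have "H \<xi> = (p - 1) / p * (\<xi> powr N * y \<xi> powr p)
        + \<xi> powr (N + \<gamma>) * U \<xi> powr (q + 1) / (q + 1) - (N - p) / p * F \<xi> * U \<xi>"
      unfolding H_def by (simp add: mult.assoc)
    also have "\<dots> \<le> 1 * (\<xi> powr N * y \<xi> powr p) + \<xi> powr (N + \<gamma>) * U \<xi> powr (q + 1) / 1 - 0"
      using p q0 F0[OF \<xi>0] U0[OF \<xi>0]
      by (intro add_mono diff_mono mult_right_mono divide_left_mono mult_nonneg_nonneg) auto
    also have "\<dots> \<le> (2 * r) powr N * (U r / r) powr p + (2 * r) powr (N + \<gamma>) * U r powr (q + 1)"
      using p q0 \<gamma> \<xi> \<xi>0 y1 y_pos[OF \<xi>0] U_anti[of r \<xi>] U0[OF \<xi>0] r0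
      by (simp, intro add_mono mult_mono powr_mono2) auto
    also have "\<dots> = 2 powr N * (r powr (N - p) * U r powr p) + 2 powr (N + \<gamma>) * (r powr (N + \<gamma>) * U r powr (q + 1))"
      using r0 U_pos[OF r0] by (simp add: powr_mult powr_divide powr_diff)
    also have "\<dots> \<le> 2 powr N * (r powr (N - p) * (C powr (- p / s) * r powr (- (a * p / s))))
        + 2 powr (N + \<gamma>) * (r powr (N + \<gamma>) * (C powr (- (q + 1) / s) * r powr (- (a * (q + 1) / s))))"
      using p q0 r0 by (intro add_mono mult_left_mono U_upper) auto
    also have "\<dots> = B r"
      unfolding B_def diff_conv_add_uminus[of _ "a * p / s"] diff_conv_add_uminus[of _ "a * (q + 1) / s"]
        powr_add by (simp add: mult_ac)
    finally have "H \<xi> \<le> B r" .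
    moreover have "H 1 < H \<xi>" using \<xi> r by (intro H_less) auto
    ultimately show ?thesis by simp
  qed
  have as: "a / s = (\<gamma> + p) / (q - p + 1)"
  proof -
    have "a = (\<gamma> + p) * m" "s = (q - p + 1) * m" using m by (auto simp: a_def s_def algebra_simps)
    then show ?thesis using m by simp
  qed
  \<comment> \<open>Each of the two inequalities is equivalent to the upper bound on \<open>q\<close>.\<close>
  have neg: "N - p - a * p / s < 0" "N + \<gamma> - a * (q + 1) / s < 0"
  proof -
    have sub: "q * (N - p) < (N + \<gamma>) * (p - 1) + p + \<gamma>"
      using subcritical p by (simp add: field_simps)
    have "(N - p) * (q - p + 1) < p * (\<gamma> + p)"
      using sub by (simp add: algebra_simps)
    then have "N - p < p * ((\<gamma> + p) / (q - p + 1))"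
      using q by (simp add: field_simps)
    then show "N - p - a * p / s < 0" unfolding as[symmetric] by (simp add: field_simps)
    have "(N + \<gamma>) * (q - p + 1) < (q + 1) * (\<gamma> + p)"
      using sub by (simp add: algebra_simps)
    then have "N + \<gamma> < (q + 1) * ((\<gamma> + p) / (q - p + 1))"
      using q by (simp add: field_simps)
    then show "N + \<gamma> - a * (q + 1) / s < 0" unfolding as[symmetric] by (simp add: field_simps)
  qed
  have "(B \<longlongrightarrow> 2 powr N * (C powr (- p / s) * 0) + 2 powr (N + \<gamma>) * (C powr (- (q + 1) / s) * 0)) at_top"
    unfolding B_def[abs_def] using neg
    by (intro tendsto_intros tendsto_neg_powr filterlim_ident) auto
  then have "eventually (\<lambda>r. B r < H 1) at_top"
    using H1 by (intro order_tendstoD) auto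
  then have "eventually (\<lambda>r. B r < H 1 \<and> 1 \<le> r) at_top"
    using eventually_ge_at_top[of 1] by eventually_elim auto
  then obtain r where "B r < H 1" "1 \<le> r"
    using eventually_happens'[of at_top] by (metis (mono_tags, lifting) trivial_limit_at_top_linorder)
  with HB[of r] show False by simp
qed

section \<open>Radial weak solutions\<close>

text \<open>
  The hypotheses of \<open>decreasing_solution_eq_0\<close> are established for the profile: first the flux
  identity almost everywhere, which expresses \<open>v\<close> through the continuous function \<open>F\<close>, then
  differentiability.
\<close>

lemma radial_weak_solution_eq_0:
  fixes u :: "'a::euclidean_space \<Rightarrow> real" and p \<gamma> q :: real
  defines "N \<equiv> real DIM('a)"
  assumes p: "1 < p" "p < N" and \<gamma>: "0 \<le> \<gamma>" and q: "p - 1 < q"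
    and subcritical: "q < ((N + \<gamma>) * (p - 1) + p + \<gamma>) / (N - p)"
    and nonneg: "AE x in lebesgue. 0 \<le> u x"
    and ws: "weak_solution p u (\<lambda>x. norm x powr \<gamma> * u x powr q)"
    and rad: "radial u"
  shows "AE x in lebesgue. u x = 0"
proof -
  define n where "n = DIM('a) - 1"
  have n: "real n = N - 1" by (simp add: n_def N_def of_nat_diff)
  have rn: "r ^ n = r powr (N - 1)" if "0 < r" for r using powr_realpow[OF that, of n] n by simp
  obtain G where wg: "has_weak_gradient u G" and GLp: "locally_Lp p G"
    and test: "\<And>\<phi>. test_function \<phi> \<Longrightarrow>
          integrable lebesgue (\<lambda>x. (norm (G x) powr (p - 2) *\<^sub>R G x) \<bullet> grad \<phi> x)"
      "\<And>\<phi>. test_function \<phi> \<Longrightarrow> integrable lebesgue (\<lambda>x. (norm x powr \<gamma> * u x powr q) * \<phi> x)"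
      "\<And>\<phi>. test_function \<phi> \<Longrightarrow>
          (LINT x|lebesgue. (norm (G x) powr (p - 2) *\<^sub>R G x) \<bullet> grad \<phi> x)
            = (LINT x|lebesgue. (norm x powr \<gamma> * u x powr q) * \<phi> x)"
    using ws unfolding weak_solution_def by blast
  have "u \<in> borel_measurable lebesgue" using ws by (simp add: weak_solution_def locally_Lp_def)
  then obtain g where g[measurable]: "g \<in> borel_measurable borel" and ug: "AE x in lebesgue. u x = g (norm x)"
    using rad by (rule radial_borel_representative)
  obtain v w where v[measurable]: "v \<in> borel_measurable borel"
    and v_loc: "\<And>a b. 0 < a \<Longrightarrow> a < b \<Longrightarrow> set_integrable lborel {a..b} v"
    and w: "\<And>r s. 0 < r \<Longrightarrow> r \<le> s \<Longrightarrow> w s - w r = (LBINT t:{r..s}. v t)"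
    and gw: "AE r in lborel. 0 < r \<longrightarrow> g r = w r"
    and Gv: "AE x in lebesgue. G x = (v (norm x) / norm x) *\<^sub>R x"
    by (rule radial_weak_gradient[OF wg g ug]) (rule that)
  have norm_G: "AE x in lebesgue. norm (G x) = \<bar>v (norm x)\<bar>"
    using Gv AE_norm_pos by eventually_elim simp
  define a where "a r = \<bar>v r\<bar> powr (p - 2) * v r" for r
  have [measurable]: "a \<in> borel_measurable borel" unfolding a_def[abs_def] by measurable
  define \<rho> where "\<rho> r = r ^ n * (r powr \<gamma> * g r powr q)" for r
  have \<rho>_meas[measurable]: "\<rho> \<in> borel_measurable borel" unfolding \<rho>_def[abs_def] by measurable

  \<comment> \<open>The test functions \<open>F1(|x|^2) - F1(\<beta>)\<close> are constant near the origin; their gradient is a multiple of a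
    bump times \<open>x\<close>.\<close>
  have weak_radial:
      "set_integrable lborel {0<..} (\<lambda>r. r ^ n * (a r * (2 * bump \<alpha> \<beta> m (r\<^sup>2) * r)))"
      "set_integrable lborel {0<..} (\<lambda>r. r ^ n * ((r powr \<gamma> * g r powr q) * (F1 (r\<^sup>2) - F1 \<beta>)))"
      "(LBINT r:{0<..}. r ^ n * (a r * (2 * bump \<alpha> \<beta> m (r\<^sup>2) * r)))
        = (LBINT r:{0<..}. r ^ n * ((r powr \<gamma> * g r powr q) * (F1 (r\<^sup>2) - F1 \<beta>)))"
    if \<alpha>\<beta>: "0 < \<alpha>" "\<alpha> < \<beta>" and F1: "\<And>t. (F1 has_real_derivative bump \<alpha> \<beta> m t) (at t)" for \<alpha> \<beta> m F1
  proof -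
    define \<phi> where "\<phi> x = F1 (x \<bullet> x) - F1 \<beta>" for x :: 'a
    have d: "((\<lambda>t. F1 t - F1 \<beta>) has_real_derivative bump \<alpha> \<beta> m t) (at t)" for t
      using DERIV_diff[OF F1 DERIV_const] by simp
    have smooth: "C_k k (\<lambda>t. F1 t - F1 \<beta>)" for k
      by (rule C_k_Suc_D[OF C_k_Suc_realI[OF d C_k_bump]])
    have tf: "test_function \<phi>"
    proof (rule test_functionI[where R = "sqrt \<beta>"])
      show "C_k k \<phi>" for k unfolding \<phi>_def[abs_def] by (rule C_k_compose[OF smooth C_k_norm_square])
      show "\<phi> x = 0" if "norm x > sqrt \<beta>" for x
      proof -
        have "(sqrt \<beta>)\<^sup>2 \<le> (norm x)\<^sup>2" using that \<alpha>\<beta> by (intro power_mono) auto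
        then have "\<beta> \<le> x \<bullet> x" using \<alpha>\<beta> by (simp add: power2_norm_eq_inner)
        from bump_antiderivative(1)[OF F1 \<alpha>\<beta>(2) this] show ?thesis by (simp add: \<phi>_def)
      qed
    qed
    have grad: "grad \<phi> x = (2 * bump \<alpha> \<beta> m (x \<bullet> x)) *\<^sub>R x" for x
      unfolding \<phi>_def[abs_def] by (rule grad_eqI[OF radial_has_derivative[OF d]])
    have [measurable]: "F1 \<in> borel_measurable borel"
      using F1 by (intro borel_measurable_continuous_onI continuous_at_imp_continuous_on ballI DERIV_isCont)
    have lhs: "AE x in lebesgue. (norm (G x) powr (p - 2) *\<^sub>R G x) \<bullet> grad \<phi> x
        = a (norm x) * (2 * bump \<alpha> \<beta> m ((norm x)\<^sup>2) * norm x)"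
      using Gv norm_G AE_norm_pos
    proof eventually_elim
      case (elim x)
      have "(norm (G x) powr (p - 2) *\<^sub>R G x) \<bullet> grad \<phi> x
          = \<bar>v (norm x)\<bar> powr (p - 2) * (v (norm x) / norm x * (2 * bump \<alpha> \<beta> m (x \<bullet> x) * (x \<bullet> x)))"
        unfolding grad elim(2) by (subst elim(1)) simp
      also have "x \<bullet> x = (norm x)\<^sup>2" by (simp add: power2_norm_eq_inner)
      finally show ?case using elim(3) by (simp add: a_def power2_eq_square)
    qed
    have rhs: "AE x in lebesgue. (norm x powr \<gamma> * u x powr q) * \<phi> x
        = (norm x powr \<gamma> * g (norm x) powr q) * (F1 ((norm x)\<^sup>2) - F1 \<beta>)"
      using ug by eventually_elim (simp add: \<phi>_def power2_norm_eq_inner)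
    note L = polar_integral_AE[OF test(1)[OF tf] lhs, folded n_def]
    note R = polar_integral_AE[OF test(2)[OF tf] rhs, folded n_def]
    show "set_integrable lborel {0<..} (\<lambda>r. r ^ n * (a r * (2 * bump \<alpha> \<beta> m (r\<^sup>2) * r)))"
      by (rule L(1)) measurable
    show "set_integrable lborel {0<..} (\<lambda>r. r ^ n * ((r powr \<gamma> * g r powr q) * (F1 (r\<^sup>2) - F1 \<beta>)))"
      by (rule R(1)) measurable
    have "sphere_area TYPE('a) * (LBINT r:{0<..}. r ^ n * (a r * (2 * bump \<alpha> \<beta> m (r\<^sup>2) * r)))
        = sphere_area TYPE('a) * (LBINT r:{0<..}. r ^ n * ((r powr \<gamma> * g r powr q) * (F1 (r\<^sup>2) - F1 \<beta>)))"
      using test(3)[OF tf] by (subst L(2)[symmetric], measurable, subst R(2)[symmetric], measurable)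
    then show "(LBINT r:{0<..}. r ^ n * (a r * (2 * bump \<alpha> \<beta> m (r\<^sup>2) * r)))
        = (LBINT r:{0<..}. r ^ n * ((r powr \<gamma> * g r powr q) * (F1 (r\<^sup>2) - F1 \<beta>)))"
      using less_imp_neq[OF unit_ball_vol_pos[of "real DIM('a)"]] by simp
  qed

  have \<rho>_nonneg: "0 \<le> \<rho> r" if "0 < r" for r using that by (simp add: \<rho>_def)
  have \<rho>_int: "set_integrable lborel {0<..R} \<rho>" for R
  proof -
    \<comment> \<open>A test function that is a nonzero constant on the ball of radius \<open>R\<close>: integrability of the
      right-hand side up to the origin comes from here.\<close>
    define \<alpha> where "\<alpha> = R\<^sup>2 + 1"
    define \<beta> where "\<beta> = \<alpha> + 1"
    have \<alpha>\<beta>: "0 < \<alpha>" "\<alpha> < \<beta>" by (auto simp: \<alpha>_def \<beta>_def add_nonneg_pos)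
    obtain F1 where F1: "\<And>t. (F1 has_real_derivative bump \<alpha> \<beta> 1 t) (at t)"
      using antiderivative_exists[OF C_k_continuous[OF C_k_bump[of 0 \<alpha> \<beta> 1]]] by blast
    define c where "c = F1 \<beta> - F1 \<alpha>"
    have c: "c > 0" using bump_antiderivative(3)[OF F1 \<alpha>\<beta>(2)] by (simp add: c_def)
    have i: "integrable lborel (\<lambda>r. (1 / c) * (indicator {0<..} r *\<^sub>R (r ^ n * ((r powr \<gamma> * g r powr q) * (F1 (r\<^sup>2) - F1 \<beta>)))))"
      using weak_radial(2)[OF \<alpha>\<beta> F1] unfolding set_integrable_def by (rule integrable_mult_right)
    show ?thesis unfolding set_integrable_def
    proof (rule integrable_pointwise_bound[OF i])
      show "norm (indicator {0<..R} r *\<^sub>R \<rho> r)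
          \<le> norm ((1 / c) * (indicator {0<..} r *\<^sub>R (r ^ n * ((r powr \<gamma> * g r powr q) * (F1 (r\<^sup>2) - F1 \<beta>)))))" for r
      proof (cases "r \<in> {0<..R}")
        case True
        then have "r\<^sup>2 \<le> R\<^sup>2" by (intro power_mono) auto
        then have "r\<^sup>2 \<le> \<alpha>" by (simp add: \<alpha>_def)
        then have "F1 (r\<^sup>2) - F1 \<beta> = - c"
          using bump_antiderivative(2)[OF F1 \<alpha>\<beta>(2), of "r\<^sup>2"] by (simp add: c_def)
        then show ?thesis using True c by (simp add: \<rho>_def abs_mult)
      qed simp
    qed measurable
  qed
  define F where "F r = (LBINT t:{0<..r}. \<rho> t)" for r
  have F_inc: "F s - F r = (LBINT t:{r..s}. \<rho> t)" if "0 < r" "r \<le> s" for r s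
    unfolding F_def by (rule integral_from_0_increments[OF \<rho>_int that])
  have F_lim: "(F \<longlongrightarrow> 0) (at_right 0)"
    unfolding F_def[abs_def] by (rule integral_from_0_tendsto_0[OF \<rho>_int])
  have F_nonneg: "0 \<le> F r" for r
    unfolding F_def set_lebesgue_integral_def
    by (intro Bochner_Integration.integral_nonneg) (auto simp: indicator_def \<rho>_nonneg)
  have F_cont: "continuous_on {0<..} F"
  proof (rule integral_increments_continuous[OF _ F_inc])
    show "set_integrable lborel {a..b} \<rho>" if "0 < a" "a < b" for a b
      by (rule set_integrable_subset[OF \<rho>_int[of b]]) (use that in auto)
  qed
  have F_meas: "(\<lambda>r. indicator {0<..} r *\<^sub>R F r) \<in> borel_measurable borel"
    by (rule borel_measurable_continuous_on_indicator[OF _ F_cont]) simp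

  have flux_bump: "(LBINT r. indicator {0<..} r * (2 * r * bump \<alpha> \<beta> m (r\<^sup>2)) * (r ^ n * a r + F r)) = 0"
    if \<alpha>\<beta>: "0 < \<alpha>" "\<alpha> < \<beta>" for \<alpha> \<beta> m
  proof -
    obtain F1 where F1: "\<And>t. (F1 has_real_derivative bump \<alpha> \<beta> m t) (at t)"
      using antiderivative_exists[OF C_k_continuous[OF C_k_bump[of 0 \<alpha> \<beta> m]]] by blast
    \<comment> \<open>Fubini integrates by parts: it replaces the primitive of the bump by the bump, and \<open>\<rho>\<close> by \<open>F\<close>.\<close>
    define D where "D r = indicator {0<..sqrt \<beta>} r *\<^sub>R \<rho> r" for r
    define V where "V s = indicator {0<..} s * (2 * s * bump \<alpha> \<beta> m (s\<^sup>2))" for s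
    have D: "integrable lborel D" using \<rho>_int[of "sqrt \<beta>"] by (simp add: D_def[abs_def] set_integrable_def)
    have V: "integrable lborel V"
    proof -
      have "integrable lborel (\<lambda>s. indicator {0..} s * V s)"
        unfolding V_def by (rule bump_radial_FTC(1)[OF F1 \<alpha>\<beta> order_refl])
      moreover have "(\<lambda>s. indicator {0..} s * V s) = V" by (auto simp: V_def indicator_def)
      ultimately show ?thesis by simp
    qed
    have e1: "(LBINT s. indicator {norm x..} s * V s) * D x
        = - (indicator {0<..} x *\<^sub>R (x ^ n * ((x powr \<gamma> * g x powr q) * (F1 (x\<^sup>2) - F1 \<beta>))))" for x :: real
    proof -
      have I: "(LBINT s. indicator {norm x..} s * V s) = F1 \<beta> - F1 (x\<^sup>2)"
        unfolding V_def using bump_radial_FTC(2)[OF F1 \<alpha>\<beta>, of "norm x"] by simp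
      have "F1 (x\<^sup>2) = F1 \<beta>" if "sqrt \<beta> < x"
      proof -
        have "(sqrt \<beta>)\<^sup>2 \<le> x\<^sup>2" using that \<alpha>\<beta> by (intro power_mono) auto
        then show ?thesis using \<alpha>\<beta> by (intro bump_antiderivative(1)[OF F1 \<alpha>\<beta>(2)]) simp
      qed
      then show ?thesis
        unfolding I by (cases "0 < x"; cases "x \<le> sqrt \<beta>") (simp_all add: D_def \<rho>_def algebra_simps)
    qed
    have e2: "V s * (LBINT x. indicator {norm x..} s * D x) = V s * F s" for s
    proof (cases "0 < s \<and> s < sqrt \<beta>")
      case True
      have "(LBINT x. indicator {norm x..} s * D x) = F s"
        unfolding F_def set_lebesgue_integral_def
        by (rule Bochner_Integration.integral_cong) (use True in \<open>auto simp: D_def indicator_def\<close>)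
      then show ?thesis by simp
    next
      case False
      have "V s = 0"
      proof (cases "0 < s")
        case True
        then have "(sqrt \<beta>)\<^sup>2 \<le> s\<^sup>2" using False \<alpha>\<beta> by (intro power_mono) auto
        then have "bump \<alpha> \<beta> m (s\<^sup>2) = 0" using \<alpha>\<beta> by (intro bump_eq_0) simp
        then show ?thesis by (simp add: V_def)
      qed (simp add: V_def)
      then show ?thesis by simp
    qed
    note cake = radial_layer_cake[OF D V, unfolded e1 e2]
    have i1: "integrable lborel (\<lambda>r. V r * (r ^ n * a r))"
      using weak_radial(1)[OF \<alpha>\<beta> F1] by (simp add: set_integrable_def V_def mult_ac)
    have "(LBINT r. V r * (r ^ n * a r)) = (LBINT r:{0<..}. r ^ n * (a r * (2 * bump \<alpha> \<beta> m (r\<^sup>2) * r)))"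
      unfolding set_lebesgue_integral_def by (simp add: V_def mult_ac)
    also have "\<dots> = (LBINT r:{0<..}. r ^ n * ((r powr \<gamma> * g r powr q) * (F1 (r\<^sup>2) - F1 \<beta>)))"
      by (rule weak_radial(3)[OF \<alpha>\<beta> F1])
    also have "\<dots> = - (LBINT s. V s * F s)"
      using cake(3) unfolding set_lebesgue_integral_def by simp
    finally have eq: "(LBINT r. V r * (r ^ n * a r)) = - (LBINT s. V s * F s)" .
    have "(LBINT r. V r * (r ^ n * a r + F r)) = (LBINT r. V r * (r ^ n * a r) + V r * F r)"
      by (simp add: distrib_left)
    also have "\<dots> = 0"
      unfolding Bochner_Integration.integral_add[OF i1 cake(2)] eq by simp
    finally show ?thesis by (simp add: V_def)
  qed

  have G_p: "locally_integrable (\<lambda>x. norm (G x) powr p)"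
    unfolding locally_integrable_def
  proof (intro conjI allI impI)
    have [measurable]: "G \<in> borel_measurable lebesgue" using GLp by (simp add: locally_Lp_def)
    show "(\<lambda>x. norm (G x) powr p) \<in> borel_measurable lebesgue" by measurable
    show "set_integrable lebesgue K (\<lambda>x. norm (G x) powr p)" if "compact K" for K
      using GLp that by (simp add: locally_Lp_def)
  qed
  have G_p_v: "AE x in lebesgue. norm (G x) powr p = \<bar>v (norm x)\<bar> powr p"
    using norm_G by eventually_elim simp
  have v_p: "set_integrable lborel {a..b} (\<lambda>r. \<bar>v r\<bar> powr p)" if "0 < a" for a b
    by (rule locally_integrable_polar[OF G_p _ G_p_v that]) measurable
  have a_bound: "\<bar>a r\<bar> \<le> 1 + \<bar>v r\<bar> powr p" for r
  proof (cases "\<bar>v r\<bar> \<le> 1")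
    case True
    have "\<bar>a r\<bar> = \<bar>v r\<bar> powr (p - 1)"
      by (cases "v r = 0") (auto simp: a_def abs_mult powr_diff powr_numeral power2_eq_square)
    also have "\<dots> \<le> 1" using True p by (intro powr_le1) auto
    finally show ?thesis by (simp add: add_increasing2)
  next
    case False
    have "\<bar>a r\<bar> = \<bar>v r\<bar> powr (p - 1)"
      by (cases "v r = 0") (auto simp: a_def abs_mult powr_diff powr_numeral power2_eq_square)
    also have "\<dots> \<le> \<bar>v r\<bar> powr p" using False by (intro powr_mono) auto
    finally show ?thesis by simp
  qed
  have flux: "AE r in lborel. 0 < r \<longrightarrow> r ^ n * a r = - F r"
  proof -
    let ?Z = "\<lambda>r. indicator {0<..} r * (2 * r * (r ^ n * a r)) + 2 * r * (indicator {0<..} r *\<^sub>R F r)"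
    have "AE r in lborel. 0 < r \<longrightarrow> ?Z r = 0"
    proof (rule AE_eq_0_if_radial_bump_integrals_0)
      show Zm: "?Z \<in> borel_measurable borel" using F_meas by measurable
      show "(LBINT r:{0<..}. ?Z r * bump \<alpha> \<beta> m (r\<^sup>2)) = 0" if "0 < \<alpha>" "\<alpha> < \<beta>" for \<alpha> \<beta> m
      proof -
        have "(LBINT r:{0<..}. ?Z r * bump \<alpha> \<beta> m (r\<^sup>2))
            = (LBINT r. indicator {0<..} r * (2 * r * bump \<alpha> \<beta> m (r\<^sup>2)) * (r ^ n * a r + F r))"
          unfolding set_lebesgue_integral_def
          by (rule Bochner_Integration.integral_cong) (auto simp: indicator_def algebra_simps)
        then show ?thesis using flux_bump[OF that] by simp
      qed
      fix b c :: real assume bc: "0 < b" "b < c"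
      have "set_integrable lborel {b..c} (\<lambda>r. 2 * c * c ^ n * (1 + \<bar>v r\<bar> powr p) + 2 * c * \<bar>F r\<bar>)"
        by (intro set_integral_add set_integrable_mult_right v_p bc borel_integrable_atLeastAtMost'
            continuous_intros continuous_on_subset[OF F_cont]) (use bc in auto)
      then show "set_integrable lborel {b..c} ?Z"
        unfolding set_integrable_def
      proof (rule integrable_pointwise_bound)
        show "(\<lambda>r. indicator {b..c} r *\<^sub>R ?Z r) \<in> borel_measurable lborel" using Zm by measurable
        show "norm (indicator {b..c} r *\<^sub>R ?Z r)
            \<le> norm (indicator {b..c} r *\<^sub>R (2 * c * c ^ n * (1 + \<bar>v r\<bar> powr p) + 2 * c * \<bar>F r\<bar>))" for r
        proof (cases "r \<in> {b..c}")
          case True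
          then have r: "0 < r" "r \<le> c" using bc by auto
          have "\<bar>?Z r\<bar> \<le> 2 * r * (r ^ n * \<bar>a r\<bar>) + 2 * r * \<bar>F r\<bar>"
            using r abs_triangle_ineq[of "2 * r * (r ^ n * a r)" "2 * r * F r"] by (simp add: abs_mult)
          also have "\<dots> \<le> 2 * c * (c ^ n * (1 + \<bar>v r\<bar> powr p)) + 2 * c * \<bar>F r\<bar>"
            using r a_bound[of r] by (intro add_mono mult_mono power_mono) auto
          finally show ?thesis using True by (simp add: mult.assoc)
        qed simp
      qed
    qed
    then show ?thesis
    proof eventually_elim
      case (elim r)
      show ?case
      proof
        assume r: "0 < r"
        then have "2 * r * (r ^ n * a r + F r) = 0" using elim by (simp add: algebra_simps)
        then show "r ^ n * a r = - F r" using r by simp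
      qed
    qed
  qed

  define y where "y r = (F r / r powr (N - 1)) powr (1 / (p - 1))" for r
  have y_cont: "continuous_on {0<..} y"
    unfolding y_def[abs_def] using p F_nonneg
    by (intro continuous_on_powr' continuous_intros F_cont) auto
  have vy: "AE r in lborel. 0 < r \<longrightarrow> v r = - y r"
    using flux
  proof eventually_elim
    case (elim r)
    show ?case
    proof
      assume r: "0 < r"
      then have eq: "a r = - (F r / r powr (N - 1))" using elim rn[OF r] by (simp add: field_simps)
      then have "a r \<le> 0" using F_nonneg[of r] by simp
      then have "v r \<le> 0" by (auto simp: a_def mult_le_0_iff)
      then have "- a r = (- v r) powr (p - 1)"
        by (cases "v r = 0") (auto simp: a_def powr_diff powr_numeral power2_eq_square)
      then have "y r = ((- v r) powr (p - 1)) powr (1 / (p - 1))" by (simp add: y_def eq)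
      also have "\<dots> = - v r" using p \<open>v r \<le> 0\<close> by (simp add: powr_powr)
      finally show "v r = - y r" by simp
    qed
  qed
  have dw: "(w has_real_derivative - y r) (at r)" if "0 < r" for r
    by (rule integral_increments_has_derivative[OF v w _ vy that])
      (assumption | intro continuous_intros y_cont)+
  have w_cont: "continuous_on {0<..} w"
    by (intro continuous_at_imp_continuous_on ballI DERIV_isCont[OF dw]) simp
  have g_nonneg: "AE r in lborel. 0 < r \<longrightarrow> 0 \<le> g r"
  proof -
    have "AE x::'a in lebesgue. 0 \<le> g (norm x)" using nonneg ug by eventually_elim simp
    then show ?thesis by (subst (asm) polar_AE) auto
  qed
  have w_nonneg: "0 \<le> w r" if "0 < r" for r
    by (rule nonneg_if_AE_nonneg[OF w_cont _ that]) (use g_nonneg gw in eventually_elim, simp)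
  have dF: "(F has_real_derivative r powr (N - 1 + \<gamma>) * w r powr q) (at r)" if "0 < r" for r
  proof (rule integral_increments_has_derivative[OF \<rho>_meas F_inc _ _ that])
    show "continuous_on {0<..} (\<lambda>r. r powr (N - 1 + \<gamma>) * w r powr q)"
      using p q w_nonneg by (intro continuous_intros continuous_on_powr' w_cont) auto
    show "AE r in lborel. 0 < r \<longrightarrow> \<rho> r = r powr (N - 1 + \<gamma>) * w r powr q"
      using gw by eventually_elim (simp add: \<rho>_def rn powr_add)
  qed
  define \<epsilon> where "\<epsilon> r = r ^ n * \<bar>v r\<bar> powr p" for r
  have [measurable]: "\<epsilon> \<in> borel_measurable borel" unfolding \<epsilon>_def[abs_def] by measurable
  have \<epsilon>_int: "set_integrable lborel {0<..R} \<epsilon>" for R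
  proof -
    have 1: "integrable lebesgue (\<lambda>x. norm (G x) powr p * indicator {..R} (norm x))"
      by (rule locally_integrable_times_test[OF G_p, of _ 1 R]) (auto simp: indicator_def)
    have 2: "AE x in lebesgue. norm (G x) powr p * indicator {..R} (norm x) = \<bar>v (norm x)\<bar> powr p * indicator {..R} (norm x)"
      using G_p_v by eventually_elim simp
    have "set_integrable lborel {0<..} (\<lambda>r. r ^ n * (\<bar>v r\<bar> powr p * indicator {..R} r))"
      unfolding n_def by (rule polar_integral_AE(1)[OF 1 2]) measurable
    moreover have "indicator {0<..} r *\<^sub>R (r ^ n * (\<bar>v r\<bar> powr p * indicator {..R} r)) = indicator {0<..R} r *\<^sub>R \<epsilon> r" for r
      by (auto simp: \<epsilon>_def indicator_def)
    ultimately show ?thesis by (simp only: set_integrable_def)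
  qed
  define E where "E r = (LBINT t:{0<..r}. \<epsilon> t)" for r
  have E_inc: "E s - E r = (LBINT t:{r..s}. \<epsilon> t)" if "0 < r" "r \<le> s" for r s
    unfolding E_def by (rule integral_from_0_increments[OF \<epsilon>_int that])
  have E_lim: "(E \<longlongrightarrow> 0) (at_right 0)"
    unfolding E_def[abs_def] by (rule integral_from_0_tendsto_0[OF \<epsilon>_int])
  have E_nonneg: "0 \<le> E r" for r
    unfolding E_def set_lebesgue_integral_def
    by (intro Bochner_Integration.integral_nonneg) (auto simp: indicator_def \<epsilon>_def)
  have dE: "(E has_real_derivative F r * y r) (at r)" if "0 < r" for r
  proof (rule integral_increments_has_derivative[OF _ E_inc _ _ that])
    show "continuous_on {0<..} (\<lambda>r. F r * y r)" by (intro continuous_intros F_cont y_cont)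
    show "AE r in lborel. 0 < r \<longrightarrow> \<epsilon> r = F r * y r"
      using vy
    proof eventually_elim
      case (elim r)
      show ?case
      proof
        assume r: "0 < r"
        have "\<bar>v r\<bar> = y r" using elim r by (simp add: y_def)
        moreover have "y r powr p = y r powr (p - 1) * y r"
          using powr_add[of "y r" "p - 1" 1] by (simp add: y_def)
        moreover have "y r powr (p - 1) = F r / r powr (N - 1)"
          using p F_nonneg[of r] by (simp add: y_def powr_powr)
        ultimately show "\<epsilon> r = F r * y r" using r by (simp add: \<epsilon>_def rn)
      qed
    qed
  qed measurable
  have w0: "w r = 0" if "0 < r" for r
    using that
    by (intro decreasing_solution_eq_0[where U = w and F = F and E = E and N = N and p = p and q = q and \<gamma> = \<gamma>,
          folded y_def, OF p \<gamma> q subcritical dw dF dE w_nonneg F_nonneg E_nonneg F_lim E_lim])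
  have "AE r in lborel. 0 < r \<longrightarrow> g r = 0" using gw by eventually_elim (simp add: w0)
  then have "AE x::'a in lebesgue. g (norm x) = 0" by (subst polar_AE) auto
  with ug show ?thesis by eventually_elim simp
qed

theorem theorem3p8:
  fixes u :: "real ^ 'n \<Rightarrow> real" and N :: nat and p \<gamma> q :: real
  assumes "N = CARD('n)" and "N \<ge> 2"
    and "1 < p" and "p < real N"
    and "\<gamma> \<ge> 0"
    and "p - 1 < q"
    and "q < ((real N + \<gamma>) * (p - 1) + p + \<gamma>) / (real N - p)"
    and "u \<in> W1p_loc p"
    and "AE x in lebesgue. u x \<ge> 0"
    and "weak_solution p u (\<lambda>x. norm x powr \<gamma> * u x powr q)"
    and "radial u"
  shows "AE x in lebesgue. u x = 0"
  using assms by (intro radial_weak_solution_eq_0[of p \<gamma> q u]) (simp_all add: DIM_cart)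

end
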